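(* Let $k$, $X$, $g$, $\infty$, $d$, $\mathcal{R}$ and $\Delta_M$ ($M\geq 2$) be as in the context. Let $N\ge 2$ be an integer with $N\ge 2g-1$, let $r$ be a non-negative integer such that $g-r+\lfloor \frac{r}{d}\rfloor>0$, and let $\xi\in X[N]$ with $\xi\notin\mathcal{R}$. Then $\Delta_{N+r}$ has a zero of order at least $$\Big(g-r+\Big\lfloor\frac{r}{d}\Big\rfloor\Big)\Big(\Big\lfloor\frac{r}{d}\Big\rfloor+1\Big)$$ at $\xi$.
   Context: $k$ is an algebraically closed field of characteristic $p\ge0$, $X$ an irreducible smooth proper curve over $k$ of genus $g\ge2$, $\infty\in X(k)$, $J$ the jacobian of $X$, and $X$ is embedded in $J$ by $\xi\mapsto$ class of $[\xi]-[\infty]$. $J[N]$ is the group of points of $J(k)$ of order dividing $N$ and $X[N]=J[N]\cap X$. Let $d$ be the smallest positive integer such that $k(X)$ contains a function $x$ with a pole of order exactly $d$ at $\infty$ and finite elsewhere; fix such an $x$, and let $\pi:X\to\mathbb{P}^1$ be the morphism of degree $d$ it defines (the extension $k(X)/k(x)$ is separable). $\mathcal{R}$ is the set of points of $X$ where $\pi$ is ramified; $\infty\in\mathcal{R}$. $D=(D_n)_{n\ge0}$ is the Hasse-Schmidt derivation on $k(x)$, trivial on $k$, with each $D_n$ $k$-linear and $D_n(x^m)=\binom{m}{n}x^{m-n}$ for $m\in\mathbb{Z}$, $n\geq0$; it extends uniquely to a Hasse-Schmidt derivation on $k(X)$, still denoted $D$. Let $0=\delta_1<\delta_2<\cdots$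 be the strictly increasing sequence of pole orders at $\infty$ of functions in $k(X)$ regular on $X-\{\infty\}$; for each $n$ fix a function $y_n$ regular on $X-\{\infty\}$ with a pole of order exactly $\delta_n$ at $\infty$. For $M\ge2$ let $\mathsf{D}_M$ be the dimension of the space of functions regular on $X-\{\infty\}$ with pole order at most $M$ at $\infty$, i.e. $\delta_{\mathsf{D}_M}\le M<\delta_{\mathsf{D}_M+1}$. Then $\Delta_M$ is the determinant of the $\mathsf{D}_M\times\mathsf{D}_M$ matrix $(D_{j-1}(y_i))_{1\le i,j\le\mathsf{D}_M}$ (well-defined up to multiplication by a non-zero element of $k$). It is regular on $X-\mathcal{R}$. The zero function is regarded as having a zero of infinite order at every point. *)

theory Defs
  imports
    "HOL-Library.Infinite_Set"
    "HOL-Algebra.Coset"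
    "Jordan_Normal_Form.Determinant"
begin

text \<open>
  A smooth proper irreducible curve \<open>X\<close> over an algebraically closed field \<open>k\<close> is given by its
  function field: a field \<open>k(X)\<close>, here a type \<open>'f\<close> with an embedding \<open>emb\<close> of the type \<open>'k\<close>, that is
  finitely generated of transcendence degree one over \<open>k\<close>.  The closed points of \<open>X\<close>, which are
  all \<open>k\<close>-rational, are the discrete valuations of \<open>k(X)\<close> that are trivial on \<open>k\<close>; the value of
  the valuation \<open>P\<close> on a nonzero function \<open>f\<close> is the order of vanishing of \<open>f\<close> at \<open>P\<close>, negative
  for a pole.
\<close>

definition transcendental_over :: "('k::field \<Rightarrow> 'f::field) \<Rightarrow> 'f \<Rightarrow> bool" where
  "transcendental_over emb x \<longleftrightarrow> (\<forall>p. p \<noteq> 0 \<longrightarrow> poly (map_poly emb p) x \<noteq> 0)"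

definition rational_functions :: "('k::field \<Rightarrow> 'f::field) \<Rightarrow> 'f \<Rightarrow> 'f set" where
  "rational_functions emb x =
     {poly (map_poly emb p) x / poly (map_poly emb q) x | p q. poly (map_poly emb q) x \<noteq> 0}"

definition finite_over :: "'f::field set \<Rightarrow> bool" where
  "finite_over F \<longleftrightarrow>
     (\<exists>B. finite B \<and> (\<forall>f. \<exists>c. (\<forall>b\<in>B. c b \<in> F) \<and> f = (\<Sum>b\<in>B. c b * b)))"

text \<open>
  The binomial coefficient of a possibly negative integer.  This is the definition of \<open>gchoose\<close> at
  type \<open>int\<close>, where the division is exact; \<open>gchoose\<close> itself is constrained to fields here.
\<close>

definition int_binomial :: "int \<Rightarrow> nat \<Rightarrow> int" where
  "int_binomial m n = (\<Prod>i = 0..<n. m - int i) div fact n"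

locale function_field = field_hom emb
  for emb :: "'k::alg_closed_field \<Rightarrow> 'f::field" +
  assumes one_variable:
    "\<exists>x. transcendental_over emb x \<and> finite_over (rational_functions emb x)"

text \<open>
  The value of a valuation at \<open>0\<close> should be infinite; the clause \<open>v 0 = 0\<close> below merely makes the
  function \<open>v\<close> unique, and the order of the zero function is treated separately wherever it matters.
\<close>

type_synonym 'f place = "'f \<Rightarrow> int"

context function_field
begin

definition points :: "'f place set" where
  "points = {v. v 0 = 0 \<and>
     (\<forall>f g. f \<noteq> 0 \<longrightarrow> g \<noteq> 0 \<longrightarrow> v (f * g) = v f + v g) \<and>
     (\<forall>f g. f \<noteq> 0 \<longrightarrow> g \<noteq> 0 \<longrightarrow> f + g \<noteq> 0 \<longrightarrow> v (f + g) \<ge> min (v f) (v g)) \<and>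
     (\<forall>c. c \<noteq> 0 \<longrightarrow> v (emb c) = 0) \<and>
     (\<exists>t. v t = 1)}"

definition is_divisor :: "('f place \<Rightarrow> int) \<Rightarrow> bool" where
  "is_divisor A \<longleftrightarrow> finite {P. A P \<noteq> 0} \<and> {P. A P \<noteq> 0} \<subseteq> points"

text \<open>Every point is \<open>k\<close>-rational, so it contributes its bare multiplicity to the degree.\<close>

definition degree_div :: "('f place \<Rightarrow> int) \<Rightarrow> int" where
  "degree_div A = (\<Sum>P | A P \<noteq> 0. A P)"

definition point_div :: "'f place \<Rightarrow> 'f place \<Rightarrow> int" where
  "point_div P = (\<lambda>Q. if Q = P then 1 else 0)"

definition principal_div :: "'f \<Rightarrow> 'f place \<Rightarrow> int" where
  "principal_div f = (\<lambda>P. if P \<in> points then P f else 0)"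

definition riemann_roch_space :: "('f place \<Rightarrow> int) \<Rightarrow> 'f set" where
  "riemann_roch_space A = {f. f = 0 \<or> (\<forall>P\<in>points. P f \<ge> - A P)}"

definition ell :: "('f place \<Rightarrow> int) \<Rightarrow> nat" where
  "ell A = vector_space.dim (\<lambda>c f. emb c * f) (riemann_roch_space A)"

text \<open>The genus is the maximum of \<open>deg A + 1 - \<ell>(A)\<close> over all divisors \<open>A\<close> (it is nonnegative,
  as \<open>A = 0\<close> shows).\<close>

definition genus :: nat where
  "genus = (GREATEST n. \<exists>A. is_divisor A \<and> int n = degree_div A + 1 - int (ell A))"

text \<open>The group \<open>J(k)\<close> of the jacobian: divisors of degree zero modulo principal divisors.\<close>

definition div0_group :: "('f place \<Rightarrow> int) monoid" where
  "div0_group = \<lparr>carrier = {A. is_divisor A \<and> degree_div A = 0},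
     monoid.mult = (\<lambda>A B P. A P + B P), one = (\<lambda>P. 0)\<rparr>"

definition principal_divs :: "('f place \<Rightarrow> int) set" where
  "principal_divs = {principal_div f | f. f \<noteq> 0}"

definition jacobian :: "('f place \<Rightarrow> int) set monoid" where
  "jacobian = div0_group Mod principal_divs"

definition jacobian_torsion :: "nat \<Rightarrow> ('f place \<Rightarrow> int) set set" where
  "jacobian_torsion N = {a \<in> carrier jacobian. a [^]\<^bsub>jacobian\<^esub> N = \<one>\<^bsub>jacobian\<^esub>}"

definition embed_jacobian :: "'f place \<Rightarrow> 'f place \<Rightarrow> ('f place \<Rightarrow> int) set" where
  "embed_jacobian infty \<xi> =
     principal_divs #>\<^bsub>div0_group\<^esub> (\<lambda>P. point_div \<xi> P - point_div infty P)"

definition torsion_points :: "'f place \<Rightarrow> nat \<Rightarrow> 'f place set" where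
  "torsion_points infty N = {\<xi> \<in> points. embed_jacobian infty \<xi> \<in> jacobian_torsion N}"

definition regular_away :: "'f place \<Rightarrow> 'f \<Rightarrow> bool" where
  "regular_away infty f \<longleftrightarrow> f = 0 \<or> (\<forall>P\<in>points - {infty}. P f \<ge> 0)"

text \<open>For \<open>n = 0\<close> the following means that \<open>f\<close> is regular and non-vanishing at \<open>infty\<close>.\<close>

definition has_pole_order :: "'f place \<Rightarrow> 'f \<Rightarrow> nat \<Rightarrow> bool" where
  "has_pole_order infty f n \<longleftrightarrow> f \<noteq> 0 \<and> infty f = - int n"

definition pole_orders :: "'f place \<Rightarrow> nat set" where
  "pole_orders infty = {n. \<exists>f. regular_away infty f \<and> has_pole_order infty f n}"

definition min_pole_order :: "'f place \<Rightarrow> nat" where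
  "min_pole_order infty = (LEAST d. d > 0 \<and> d \<in> pole_orders infty)"

text \<open>\<open>pole_seq infty n\<close> is \<open>\<delta>\<^sub>n\<close>, with indices starting at \<open>1\<close>.\<close>

definition pole_seq :: "'f place \<Rightarrow> nat \<Rightarrow> nat" where
  "pole_seq infty n = enumerate (pole_orders infty) (n - 1)"

definition dim_bounded_pole :: "'f place \<Rightarrow> nat \<Rightarrow> nat" where
  "dim_bounded_pole infty M = ell (\<lambda>P. int M * point_div infty P)"

text \<open>
  Ramification of the morphism \<open>\<pi> : X \<rightarrow> \<bbbP>\<^sup>1\<close> defined by a nonconstant function \<open>x\<close>: the
  ramification index at \<open>P\<close> is the order at \<open>P\<close> of the pull-back of a local coordinate at \<open>\<pi>(P)\<close>,
  which is \<open>1/x\<close> if \<open>\<pi>(P)\<close> is the point at infinity of \<open>\<bbbP>\<^sup>1\<close> and \<open>x - x(P)\<close> otherwise.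
\<close>

definition value_at :: "'f place \<Rightarrow> 'f \<Rightarrow> 'k" where
  "value_at P f = (THE c. f = emb c \<or> P (f - emb c) > 0)"

definition ramification_index :: "'f \<Rightarrow> 'f place \<Rightarrow> int" where
  "ramification_index x P =
     (if P x < 0 then P (inverse x) else P (x - emb (value_at P x)))"

definition ramified_points :: "'f \<Rightarrow> 'f place set" where
  "ramified_points x = {P \<in> points. ramification_index x P > 1}"

definition hasse_schmidt_derivation :: "(nat \<Rightarrow> 'f \<Rightarrow> 'f) \<Rightarrow> bool" where
  "hasse_schmidt_derivation D \<longleftrightarrow>
     (\<forall>f. D 0 f = f) \<and>
     (\<forall>n f g. D n (f + g) = D n f + D n g) \<and>
     (\<forall>n f g. D n (f * g) = (\<Sum>i\<le>n. D i f * D (n - i) g)) \<and>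
     (\<forall>n>0. \<forall>c. D n (emb c) = 0)"

text \<open>
  The derivation \<open>D\<close> on \<open>k(X)\<close>, characterised as extending the given one on \<open>k(x)\<close>.  Being trivial
  on \<open>k\<close>, it is \<open>k\<close>-linear by the product rule.
\<close>

definition hasse_derivation_wrt :: "'f \<Rightarrow> (nat \<Rightarrow> 'f \<Rightarrow> 'f) \<Rightarrow> bool" where
  "hasse_derivation_wrt x D \<longleftrightarrow> hasse_schmidt_derivation D \<and>
     (\<forall>(m::int) n. D n (x powi m) = of_int (int_binomial m n) * x powi (m - int n))"

text \<open>Matrix indices start at \<open>0\<close> here, so the entry at \<open>(i, j)\<close> is \<open>D\<^sub>j(y\<^sub>i\<^sub>+\<^sub>1)\<close>.\<close>

definition Delta :: "'f place \<Rightarrow> (nat \<Rightarrow> 'f \<Rightarrow> 'f) \<Rightarrow> (nat \<Rightarrow> 'f) \<Rightarrow> nat \<Rightarrow> 'f" where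
  "Delta infty D y M =
     (let n = dim_bounded_pole infty M in det (mat n n (\<lambda>(i, j). D j (y (Suc i)))))"

definition zero_of_order_at_least :: "'f place \<Rightarrow> 'f \<Rightarrow> int \<Rightarrow> bool" where
  "zero_of_order_at_least P f n \<longleftrightarrow> f = 0 \<or> P f \<ge> n"

end

end

theory Submission
  imports Defs "Jordan_Normal_Form.Char_Poly"
begin

text \<open>
  As \<open>N\<close> times the class of \<open>[\<xi>] - [infty]\<close> is zero, there is a function \<open>f\<close> with divisor
  \<open>N[\<xi>] - N[infty]\<close>.  Put \<open>t = x - x(\<xi>)\<close>, a local coordinate at \<open>\<xi>\<close> because \<open>\<xi>\<close> is unramified,
  and \<open>q = r div d\<close>.  The functions \<open>f, f t, \<dots>, f t^q\<close> are regular outside \<open>infty\<close>, have there the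
  distinct pole orders \<open>N + k d \<le> N + r\<close>, and vanish at \<open>\<xi>\<close> to the orders \<open>N, N + 1, \<dots>, N + q\<close>.
  They may therefore replace those \<open>q + 1\<close> of the functions \<open>y_1, \<dots>, y_n\<close> which have the same pole
  orders, where \<open>n\<close> is the size of the determinant.  The change of basis is triangular
  with constant entries, so it multiplies the determinant by a nonzero constant
  (\<open>det_triangular_change\<close>).  The operator \<open>D_j\<close> lowers the order of vanishing at \<open>\<xi>\<close> by at most \<open>j\<close>
  (\<open>D_lowers_order\<close>).  Each term of the Leibniz expansion takes the entries of the \<open>q + 1\<close> new rows
  from distinct columns \<open>j < n\<close>, so its order is at least the sum of the \<open>N + k\<close> minus the sum of
  the \<open>q + 1\<close> largest column numbers (\<open>det_order\<close>), which is \<open>(q + 1)(N - n + 1 + q)\<close>.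
  Since \<open>n = N + r + 1 - g\<close>, this is the asserted bound.

  The value of \<open>n\<close> is the Riemann-Roch theorem for large multiples of \<open>infty\<close>
  (\<open>ell_pole_space_large\<close>), which has the following elementary proof.  The dimension of the space of
  functions with pole order at most \<open>M\<close> is the number of pole orders up to \<open>M\<close>, and the genus is the number of gaps
  (\<open>genus_eq_card_gaps\<close>).  Pole orders are closed under addition, so if \<open>m\<close> is a gap then one of
  \<open>a\<close> and \<open>m - a\<close> is a gap for every \<open>a \<le> m\<close>; hence \<open>m + 1 \<le> 2 g\<close>, and all gaps are at most \<open>N\<close>.
  That no divisor \<open>A\<close> has a larger defect \<open>deg A + 1 - ell A\<close> than the large multiples of \<open>infty\<close> is
  Riemann's inequality (\<open>riemann_inequality\<close>): multiplication by a product of powers of functions \<open>x - c\<close> makes any divisor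
  at most a multiple of \<open>infty\<close>, and does not decrease the degree, since \<open>x - c\<close> has no more zeros
  than poles (\<open>zeros_le\<close>).  Underneath lies the existence of enough points: a nonconstant function
  has a pole (\<open>pole_exists\<close>).

  For \<open>D_lowers_order\<close> it must be shown that every \<open>D_n\<close> maps the local ring at \<open>\<xi>\<close> to itself.
  A regular \<open>h\<close> is a separable algebraic element over \<open>k(t)\<close> (\<open>separable_relation\<close>), and
  a suitable remainder of its Taylor expansion in \<open>t\<close> is a simple root modulo \<open>t\<close>
  (\<open>relation_descent\<close>).  For a simple root, applying \<open>D_n\<close> to the equation expresses \<open>D_n h\<close> through \<open>D_i h\<close> with \<open>i < n\<close>, up to
  division by a unit (\<open>D_regular_simple_root\<close>).
\<close>

section \<open>Linear dependence, polynomials and sums of distinct numbers\<close>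

text \<open>
  A family rather than a set, since in the applications nothing prevents two members from
  coinciding; a coincidence is itself a relation.
\<close>
lemma (in vector_space) family_dependent:
  assumes "finite I" "finite S" "f ` I \<subseteq> span S" "card S < card I"
  shows "\<exists>c. (\<exists>i\<in>I. c i \<noteq> 0) \<and> (\<Sum>i\<in>I. scale (c i) (f i)) = 0"
proof (cases "inj_on f I")
  case True
  have "dependent (f ` I)"
    using independent_span_bound[OF assms(2) _ assms(3)] assms(4) True by (auto simp: card_image)
  then obtain u where u: "(\<Sum>v\<in>f ` I. scale (u v) v) = 0" "\<exists>v\<in>f ` I. u v \<noteq> 0"
    using assms(1) by (auto simp: dependent_finite)
  then show ?thesis
    using True by (intro exI[of _ "\<lambda>i. u (f i)"]) (auto simp: sum.reindex)
next
  case False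
  then obtain i j where ij: "i \<in> I" "j \<in> I" "i \<noteq> j" "f i = f j"
    by (auto simp: inj_on_def)
  have "(\<Sum>l\<in>I. scale (if l = i then 1 else if l = j then - 1 else 0) (f l)) =
        (\<Sum>l\<in>{i, j}. scale (if l = i then 1 else if l = j then - 1 else 0) (f l))"
    using assms(1) ij by (intro sum.mono_neutral_right) auto
  also have "\<dots> = 0"
    using ij by simp
  finally show ?thesis
    using ij(1) by (intro exI[of _ "\<lambda>l. if l = i then 1 else if l = j then - 1 else 0"]) auto
qed

text \<open>
  Makes a polynomial relation evaluated at \<open>t\<close> primitive: cancelling the common power of \<open>t\<close> leaves a
  relation whose reduction modulo \<open>t\<close> is not zero.
\<close>
lemma common_factor_X:
  fixes p :: "'i \<Rightarrow> 'a::field poly"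
  assumes I: "finite I" and "\<exists>j\<in>I. p j \<noteq> 0"
  shows "\<exists>a r. (\<forall>j\<in>I. p j = [:0, 1:] ^ a * r j) \<and> (\<exists>j\<in>I. coeff (r j) 0 \<noteq> 0)"
  using assms(2)
proof (induction "\<Sum>j\<in>I. degree (p j)" arbitrary: p rule: less_induct)
  case less
  show ?case
  proof (cases "\<exists>j\<in>I. coeff (p j) 0 \<noteq> 0")
    case True
    then show ?thesis by (intro exI[of _ 0]) auto
  next
    case False
    define r where "r j = poly_shift 1 (p j)" for j
    have p: "p j = pCons 0 (r j)" if "j \<in> I" for j
      using False that by (auto simp: r_def poly_eq_iff coeff_pCons coeff_poly_shift split: nat.split)
    obtain i where i: "i \<in> I" "p i \<noteq> 0" using less.prems by blast
    have "degree (r j) \<le> degree (p j)" if "j \<in> I" for j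
      using p[OF that] by (simp add: degree_pCons_eq_if)
    moreover have "degree (r i) < degree (p i)" "r i \<noteq> 0"
      using p[OF i(1)] i(2) by auto
    ultimately have "(\<Sum>j\<in>I. degree (r j)) < (\<Sum>j\<in>I. degree (p j))"
      using i(1) I by (intro sum_strict_mono_ex1) auto
    then obtain a r' where r': "\<forall>j\<in>I. r j = [:0, 1:] ^ a * r' j" "\<exists>j\<in>I. coeff (r' j) 0 \<noteq> 0"
      using less.hyps[of r] \<open>r i \<noteq> 0\<close> i(1) by blast
    then have "\<forall>j\<in>I. p j = [:0, 1:] ^ Suc a * r' j"
      using p by simp
    with r'(2) show ?thesis by blast
  qed
qed

text \<open>
  The largest of \<open>m\<close> distinct natural numbers is at least \<open>m - 1\<close>.
\<close>
lemma sum_distinct_ge: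
  fixes B :: "nat set"
  assumes "finite B"
  shows "(\<Sum>k<card B. k) \<le> \<Sum>B"
  using assms
proof (induction "card B" arbitrary: B)
  case 0
  then show ?case by simp
next
  case (Suc m)
  then have B: "finite B" "B \<noteq> {}" "card B = Suc m" by auto
  have "B \<subseteq> {..Max B}" using B by auto
  then have "card B \<le> card {..Max B}" by (intro card_mono) auto
  then have max: "m \<le> Max B" using B by simp
  have "(\<Sum>k<card (B - {Max B}). k) \<le> \<Sum>(B - {Max B})"
    using Suc.hyps(1)[of "B - {Max B}"] B by simp
  moreover have "\<Sum>B = Max B + \<Sum>(B - {Max B})" 
    by (rule sum.remove) (use B in auto)
  ultimately show ?case using max B by simp
qed

text \<open>
  The previous bound, read from the other end of the interval by the reflection \<open>a \<mapsto> n - 1 - a\<close>.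
\<close>
lemma sum_distinct_le:
  assumes A: "A \<subseteq> {..<n::nat}" and c: "card A = q + 1"
  shows "(\<Sum>a\<in>A. int a) \<le> int (q + 1) * (int n - 1) - (\<Sum>k\<le>q. int k)"
proof -
  have fin: "finite A" using A by (rule finite_subset) simp
  have inj: "inj_on (\<lambda>a. n - 1 - a) A"
  proof (rule inj_onI)
    fix a b assume ab: "a \<in> A" "b \<in> A" "n - 1 - a = n - 1 - b"
    then have "a < n" "b < n" using A by auto
    then show "a = b" using ab(3) by linarith
  qed
  have "(\<Sum>k<card ((\<lambda>a. n - 1 - a) ` A). k) \<le> \<Sum>((\<lambda>a. n - 1 - a) ` A)"
    using fin by (intro sum_distinct_ge) auto
  also have "\<Sum>((\<lambda>a. n - 1 - a) ` A) = (\<Sum>a\<in>A. n - 1 - a)"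
    using sum.reindex[OF inj, of "\<lambda>x. x"] by (simp add: comp_def)
  also have "{..<card ((\<lambda>a. n - 1 - a) ` A)} = {..q}"
    unfolding card_image[OF inj] c by auto
  finally have "int (\<Sum>k\<le>q. k) \<le> int (\<Sum>a\<in>A. n - 1 - a)" by (simp only: of_nat_le_iff)
  then have "(\<Sum>k\<le>q. int k) \<le> (\<Sum>a\<in>A. int (n - 1 - a))" by (simp only: of_nat_sum)
  also have "\<dots> = (\<Sum>a\<in>A. (int n - 1) - int a)"
    using A by (intro sum.cong) (auto simp: of_nat_diff)
  also have "\<dots> = int (q + 1) * (int n - 1) - (\<Sum>a\<in>A. int a)"
    using c by (simp add: sum_subtractf)
  finally show ?thesis by simp
qed

lemma double_sum_int: "2 * (\<Sum>k\<le>q. int k) = int q * (int q + 1)"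
  by (induction q) (auto simp: algebra_simps)

lemma enumerate_le_iff:
  fixes S :: "nat set"
  assumes "infinite S"
  shows "enumerate S l \<le> M \<longleftrightarrow> l < card (S \<inter> {..M})"
proof -
  define e where "e = enumerate S"
  have mono: "e a < e b \<longleftrightarrow> a < b" for a b
    using assms by (simp add: e_def)
  have inj: "inj e" by (metis injI linorder_neq_iff mono)
  have "S \<inter> {..M} = e ` {l. e l \<le> M}"
    using enumerate_Ex[of S] enumerate_in_set[OF assms] assms by (auto simp: e_def image_iff)
  then have card: "card (S \<inter> {..M}) = card {l. e l \<le> M}"
    using inj by (simp add: card_image inj_on_subset)
  have fin: "finite {l. e l \<le> M}"
    using \<open>S \<inter> {..M} = _\<close> inj by (metis finite_Int finite_atMost finite_imageD inj_on_subset subset_UNIV)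
  show ?thesis
  proof
    assume "enumerate S l \<le> M"
    then have "{..l} \<subseteq> {l. e l \<le> M}"
      using mono by (auto simp: e_def[symmetric]) (metis le_neq_implies_less less_imp_le order_trans)
    then have "card {..l} \<le> card {l. e l \<le> M}" using fin by (intro card_mono)
    then show "l < card (S \<inter> {..M})" by (simp add: card)
  next
    assume l: "l < card (S \<inter> {..M})"
    show "enumerate S l \<le> M"
    proof (rule ccontr)
      assume "\<not> enumerate S l \<le> M"
      then have "{l. e l \<le> M} \<subseteq> {..<l}"
        using mono by (auto simp: e_def[symmetric]) (metis linorder_neqE_nat not_le order.strict_trans2 order_less_imp_le)
      then have "card {l. e l \<le> M} \<le> card {..<l}" by (intro card_mono) auto
      then show False using l by (simp add: card)
    qed
  qed
qed

section \<open>Algebraic dependence in a function field of one variable\<close>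

context function_field
begin

definition ev :: "'f \<Rightarrow> 'k poly \<Rightarrow> 'f" where
  "ev a p = poly (map_poly emb p) a"

lemma emb_eq_0_iff [simp]: "emb c = 0 \<longleftrightarrow> c = 0"
  by (metis hom_mult hom_one hom_zero mult_zero_left right_inverse zero_neq_one)

interpretation emb_poly: map_poly_idom_hom emb
  by unfold_locales

lemma ev_hom: "idom_hom (ev a)"
  unfolding ev_def
  by unfold_locales (simp_all add: emb_poly.hom_add emb_poly.hom_mult)

sublocale ev: idom_hom "ev a" for a
  by (rule ev_hom)

lemma ev_pCons [simp]: "ev a (pCons c p) = emb c + a * ev a p"
  by (simp add: ev_def map_poly_pCons_hom)

lemma ev_monom [simp]: "ev a (monom c n) = emb c * a ^ n"
  by (simp add: ev_def poly_monom)

lemma ev_eq_sum: "degree p \<le> n \<Longrightarrow> ev a p = (\<Sum>i\<le>n. emb (coeff p i) * a ^ i)"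
  by (subst poly_as_sum_of_monoms'[symmetric]) (auto simp: ev.hom_sum)

interpretation vs: vector_space "\<lambda>c f. emb c * f"
  by unfold_locales (auto simp: hom_add hom_mult algebra_simps)

text \<open>
  The degree of the function field over \<open>k(w)\<close> is finite for every \<open>w\<close>, in the form that any
  \<open>n + 1\<close> elements are linearly dependent over \<open>k[w]\<close> for a suitable \<open>n\<close>.  Let \<open>B\<close> generate the field
  over \<open>k(x0)\<close> and let \<open>W l\<close> be the combinations of \<open>B\<close> whose coefficients are polynomials in \<open>x0\<close> of
  degree at most \<open>l\<close>.  Up to a common denominator, multiplication by \<open>w\<close> maps \<open>W l\<close> into \<open>W (l + C)\<close>.
  So the products of the given elements with \<open>1, w, \<dots>, w^T\<close> lie in a space whose dimension grows by
  a fixed amount with each increase of \<open>T\<close>; once \<open>n + 1\<close> exceeds that amount, they are dependent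
  over \<open>k\<close> for large \<open>T\<close>.
\<close>
lemma bounded_relation_degree:
  "\<exists>n. \<forall>c :: nat \<Rightarrow> 'f. \<exists>p. (\<exists>j\<le>n. p j \<noteq> 0) \<and> (\<Sum>j\<le>n. ev w (p j) * c j) = 0"
proof -
  obtain x0 B where x0: "transcendental_over emb x0" and finB: "finite B"
    and B: "\<And>f. \<exists>c. (\<forall>b\<in>B. c b \<in> rational_functions emb x0) \<and> f = (\<Sum>b\<in>B. c b * b)"
    using one_variable by (auto simp: finite_over_def)
  define m where "m = card B"
  have ev0: "ev x0 p \<noteq> 0" if "p \<noteq> 0" for p
    using x0 that by (auto simp: transcendental_over_def ev_def)
  define W where "W n = vs.span ((\<lambda>(i, b). x0 ^ i * b) ` ({..n} \<times> B))" for n :: nat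
  have W_mono: "W n \<subseteq> W n'" if "n \<le> n'" for n n'
    unfolding W_def using that by (intro vs.span_mono) auto
  have W_sub: "vs.subspace (W n)" for n
    by (simp add: W_def)
  have W_pow: "x0 ^ i * f \<in> W (n + i)" if "f \<in> W n" for f n i
    using that unfolding W_def
  proof (induction rule: vs.span_induct_alt)
    case base
    show ?case by (simp add: vs.span_zero)
  next
    case (step c z y)
    then obtain j b where z: "z = x0 ^ j * b" "j \<le> n" "b \<in> B" by auto
    have "x0 ^ i * z \<in> (\<lambda>(i, b). x0 ^ i * b) ` ({..n + i} \<times> B)"
      using z by (intro image_eqI[of _ _ "(j + i, b)"]) (auto simp: power_add)
    then have "emb c * (x0 ^ i * z) + x0 ^ i * y \<in> vs.span ((\<lambda>(i, b). x0 ^ i * b) ` ({..n + i} \<times> B))"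
      by (intro vs.span_add vs.span_scale vs.span_base step.IH)
    then show ?case by (simp add: algebra_simps)
  qed
  have W_poly: "ev x0 p * f \<in> W (n + degree p)" if "f \<in> W n" for f n p
  proof -
    have "ev x0 p * f = (\<Sum>i\<le>degree p. emb (coeff p i) * (x0 ^ i * f))"
      by (simp add: ev_eq_sum[of p "degree p"] sum_distrib_right mult.assoc)
    also have "\<dots> \<in> W (n + degree p)"
    proof (rule vs.subspace_sum[OF W_sub])
      fix i assume "i \<in> {..degree p}"
      then show "emb (coeff p i) * (x0 ^ i * f) \<in> W (n + degree p)"
        using W_pow[OF that, of i] W_mono[of "n + i" "n + degree p"]
        by (intro vs.subspace_scale[OF W_sub]) auto
    qed
    finally show ?thesis .
  qed
  have base: "b \<in> W 0" if "b \<in> B" for b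
    unfolding W_def using that by (intro vs.span_base image_eqI[of _ _ "(0, b)"]) auto
  have denom: "\<exists>q C. q \<noteq> 0 \<and> ev x0 q * f \<in> W C" for f
  proof -
    obtain c where c: "\<forall>b\<in>B. c b \<in> rational_functions emb x0" "f = (\<Sum>b\<in>B. c b * b)"
      using B by blast
    have "\<forall>b\<in>B. \<exists>p q. ev x0 q \<noteq> 0 \<and> c b = ev x0 p / ev x0 q"
      using c(1) unfolding rational_functions_def ev_def by blast
    then obtain p q where pq: "\<And>b. b \<in> B \<Longrightarrow> ev x0 (q b) \<noteq> 0 \<and> c b = ev x0 (p b) / ev x0 (q b)"
      by metis
    define Q where "Q = (\<Prod>b\<in>B. q b)"
    define h where "h b = p b * (\<Prod>b'\<in>B - {b}. q b')" for b
    have "q b \<noteq> 0" if "b \<in> B" for b using pq[OF that] by auto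
    then have Q: "Q \<noteq> 0" using finB by (auto simp: Q_def)
    have "ev x0 Q * (c b * b) = ev x0 (h b) * b" if "b \<in> B" for b
    proof -
      have "ev x0 Q = ev x0 (q b) * ev x0 (\<Prod>b'\<in>B - {b}. q b')"
        unfolding Q_def using finB that by (subst prod.remove[of _ b]) (auto simp: ev.hom_mult)
      then show ?thesis using pq[OF that] by (simp add: h_def ev.hom_mult)
    qed
    then have "ev x0 Q * f = (\<Sum>b\<in>B. ev x0 (h b) * b)"
      unfolding c(2) sum_distrib_left by (intro sum.cong) auto
    also have "\<dots> \<in> W (\<Sum>b\<in>B. degree (h b))"
    proof (rule vs.subspace_sum[OF W_sub])
      fix b assume b: "b \<in> B"
      have "degree (h b) \<le> (\<Sum>b\<in>B. degree (h b))"
        using b finB by (intro member_le_sum) auto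
      then show "ev x0 (h b) * b \<in> W (\<Sum>b\<in>B. degree (h b))"
        using W_poly[OF base[OF b], of "h b"] W_mono by fastforce
    qed
    finally show ?thesis using Q by blast
  qed
  have denoms: "\<exists>q C. q \<noteq> 0 \<and> (\<forall>f\<in>F. ev x0 q * f \<in> W C)" if "finite F" for F
    using that
  proof induction
    case empty
    show ?case by (intro exI[of _ 1]) auto
  next
    case (insert f F)
    obtain q C where q: "q \<noteq> 0" "\<forall>f\<in>F. ev x0 q * f \<in> W C" using insert by blast
    obtain q' C' where q': "q' \<noteq> 0" "ev x0 q' * f \<in> W C'" using denom by blast
    have "ev x0 (q * q') * g \<in> W (C + C' + degree q + degree q')" if "g \<in> insert f F" for g
    proof (cases "g = f")
      case True
      have "ev x0 q * (ev x0 q' * f) \<in> W (C' + degree q)" by (rule W_poly[OF q'(2)])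
      then show ?thesis using W_mono[of "C' + degree q" "C + C' + degree q + degree q'"] True
        by (auto simp: ev.hom_mult mult_ac)
    next
      case False
      then have "ev x0 q' * (ev x0 q * g) \<in> W (C + degree q')" using q(2) that by (intro W_poly) auto
      then show ?thesis using W_mono[of "C + degree q'" "C + C' + degree q + degree q'"]
        by (auto simp: ev.hom_mult mult_ac)
    qed
    then show ?case using q(1) q'(1) by (intro exI[of _ "q * q'"]) auto
  qed
  obtain q C where q: "q \<noteq> 0" "\<And>b. b \<in> B \<Longrightarrow> ev x0 q * (w * b) \<in> W C"
    using denoms[of "(\<lambda>b. w * b) ` B"] finB by auto
  have W_w: "ev x0 q * w * f \<in> W (n + C)" if "f \<in> W n" for f n
    using that unfolding W_def[of n]
  proof (induction rule: vs.span_induct_alt)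
    case base
    show ?case by (simp add: W_def vs.span_zero)
  next
    case (step c z y)
    then obtain j b where z: "z = x0 ^ j * b" "j \<le> n" "b \<in> B" by auto
    have "x0 ^ j * (ev x0 q * (w * b)) \<in> W (C + j)" by (intro W_pow q z)
    then have "ev x0 q * w * z \<in> W (n + C)" using W_mono[of "C + j" "n + C"] z by (auto simp: mult_ac)
    then have "emb c * (ev x0 q * w * z) + ev x0 q * w * y \<in> W (n + C)"
      using step W_sub by (intro vs.subspace_add vs.subspace_scale) auto
    then show ?case by (simp add: algebra_simps)
  qed
  have W_w_pow: "(ev x0 q * w) ^ i * f \<in> W (n + C * i)" if "f \<in> W n" for f n i
  proof (induction i)
    case 0
    then show ?case using that by simp
  next
    case (Suc i)
    show ?case using W_w[OF Suc] by (simp add: mult.assoc add_ac)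
  qed
  define K0 where "K0 = C + degree q"
  \<comment> \<open>each power of \<open>w\<close>, denominator included, costs \<open>K0\<close> degrees in each of the \<open>m\<close> generators\<close>
  define n where "n = m * K0"
  show ?thesis
  proof (intro exI[of _ n] allI)
    fix c :: "nat \<Rightarrow> 'f"
    obtain q' C' where q': "q' \<noteq> 0" "\<And>j. j \<le> n \<Longrightarrow> ev x0 q' * c j \<in> W C'"
      using denoms[of "c ` {..n}"] by auto
    \<comment> \<open>large enough for \<open>(n + 1) (T + 1) > m (L + 1)\<close>\<close>
    define T where "T = m * (C' + 1)"
    define L where "L = C' + K0 * T"
    define A where "A = ev x0 q ^ T * ev x0 q'"
    have A: "A \<noteq> 0" using ev0 q q' by (auto simp: A_def)
    define I where "I = {..n} \<times> {..T}"
    define F where "F = (\<lambda>(j, i). A * (w ^ i * c j))"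
    have "F (j, i) \<in> W L" if "j \<le> n" "i \<le> T" for j i
    proof -
      have "ev x0 (q ^ (T - i)) * ((ev x0 q * w) ^ i * (ev x0 q' * c j)) \<in> W (C' + C * i + degree (q ^ (T - i)))"
        by (intro W_poly W_w_pow q' that)
      also have "degree (q ^ (T - i)) = (T - i) * degree q"
        using q(1) by (simp add: Polynomial.degree_power_eq)
      also have "ev x0 (q ^ (T - i)) * ((ev x0 q * w) ^ i * (ev x0 q' * c j)) = F (j, i)"
        using that by (simp add: F_def A_def power_mult_distrib ev.hom_power power_diff mult_ac flip: power_add)
      also have "C' + C * i + (T - i) * degree q \<le> L"
      proof -
        have "C * i \<le> C * T" "(T - i) * degree q \<le> T * degree q"
          using that by auto
        moreover have "L = C' + C * T + T * degree q" by (simp add: L_def K0_def algebra_simps)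
        ultimately show ?thesis by linarith
      qed
      then have "W (C' + C * i + (T - i) * degree q) \<subseteq> W L" by (rule W_mono)
      finally show ?thesis .
    qed
    then have 1: "F ` I \<subseteq> vs.span ((\<lambda>(i, b). x0 ^ i * b) ` ({..L} \<times> B))"
      by (auto simp: I_def W_def)
    have "card ((\<lambda>(i, b). x0 ^ i * b) ` ({..L} \<times> B)) \<le> card ({..L} \<times> B)"
      using finB by (intro card_image_le) auto
    also have "\<dots> = (L + 1) * m"
      by (simp add: m_def card_cartesian_product)
    also have "\<dots> < (n + 1) * (T + 1)"
      by (simp add: L_def n_def T_def algebra_simps)
    also have "\<dots> = card I"
      by (simp add: I_def card_cartesian_product)
    finally obtain u where u: "\<exists>i\<in>I. u i \<noteq> 0" "(\<Sum>i\<in>I. emb (u i) * F i) = 0"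
      using vs.family_dependent[of I, OF _ _ 1] finB by (auto simp: I_def)
    define p where "p j = (\<Sum>i\<le>T. monom (u (j, i)) i)" for j
    have cp: "coeff (p j) i = u (j, i)" if "i \<le> T" for i j
      using that by (simp add: p_def coeff_sum)
    have "(\<Sum>i\<in>I. emb (u i) * F i) = (\<Sum>j\<le>n. \<Sum>i\<le>T. emb (u (j, i)) * F (j, i))"
      unfolding I_def by (simp add: sum.cartesian_product)
    also have "\<dots> = A * (\<Sum>j\<le>n. ev w (p j) * c j)"
      by (simp add: F_def p_def ev.hom_sum sum_distrib_left sum_distrib_right mult_ac)
    finally have "(\<Sum>j\<le>n. ev w (p j) * c j) = 0"
      using u(2) A by simp
    moreover have "\<exists>j\<le>n. p j \<noteq> 0"
    proof -
      obtain j i where "j \<le> n" "i \<le> T" "u (j, i) \<noteq> 0" using u(1) by (auto simp: I_def)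
      then show ?thesis using cp[of i j] by (intro exI[of _ j]) auto
    qed
    ultimately show "\<exists>p. (\<exists>j\<le>n. p j \<noteq> 0) \<and> (\<Sum>j\<le>n. ev w (p j) * c j) = 0"
      by blast
  qed
qed

lemma algebraically_dependent:
  "\<exists>n p. (\<exists>j\<le>n. p j \<noteq> 0) \<and> (\<Sum>j\<le>n. ev a (p j) * b ^ j) = 0"
  using bounded_relation_degree[of a] by metis

section \<open>Points as valuations\<close>

abbreviation zo :: "'f place \<Rightarrow> 'f \<Rightarrow> int \<Rightarrow> bool" where
  "zo \<equiv> zero_of_order_at_least"

context
  fixes P :: "'f place"
  assumes P: "P \<in> points"
begin

lemma val_0: "P 0 = 0"
  using P by (simp add: points_def)

lemma val_mult: "f \<noteq> 0 \<Longrightarrow> g \<noteq> 0 \<Longrightarrow> P (f * g) = P f + P g"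
  using P by (simp add: points_def)

lemma val_1: "P 1 = 0"
  using val_mult[of 1 1] by simp

lemma val_emb: "P (emb c) = 0"
  using P val_0 by (cases "c = 0") (auto simp: points_def)

lemma val_uminus: "P (- f) = P f"
proof (cases "f = 0")
  case False
  have "P (emb (- 1) * f) = P f" using False by (subst val_mult) (auto simp: val_emb)
  then show ?thesis by (simp add: hom_uminus)
qed simp

lemma val_inverse: "P (inverse f) = - P f"
proof (cases "f = 0")
  case False
  then show ?thesis using val_mult[of f "inverse f"] by (simp add: val_1)
qed (simp add: val_0)

lemma val_divide: "f \<noteq> 0 \<Longrightarrow> g \<noteq> 0 \<Longrightarrow> P (f / g) = P f - P g"
  by (simp add: divide_inverse val_mult val_inverse)

lemma val_power: "f \<noteq> 0 \<Longrightarrow> P (f ^ n) = int n * P f"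
  by (induction n) (auto simp: val_1 val_mult algebra_simps)

lemma val_powi: "f \<noteq> 0 \<Longrightarrow> P (f powi k) = k * P f"
  by (auto simp: power_int_def val_power val_inverse)

lemma val_prod: "(\<And>i. i \<in> I \<Longrightarrow> f i \<noteq> 0) \<Longrightarrow> P (prod f I) = (\<Sum>i\<in>I. P (f i))"
  by (induction I rule: infinite_finite_induct) (auto simp: val_1 val_mult)

lemma uniformizer_exists: "\<exists>t. t \<noteq> 0 \<and> P t = 1"
proof -
  obtain t where "P t = 1" using P by (auto simp: points_def)
  then show ?thesis using val_0 by (intro exI[of _ t]) auto
qed

lemma zo_0 [simp]: "zo P 0 n"
  by (simp add: zero_of_order_at_least_def)

lemma zo_mono: "zo P f n \<Longrightarrow> m \<le> n \<Longrightarrow> zo P f m"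
  by (auto simp: zero_of_order_at_least_def)

lemma zo_add: "zo P f n \<Longrightarrow> zo P g n \<Longrightarrow> zo P (f + g) n"
proof -
  assume f: "zo P f n" and g: "zo P g n"
  show ?thesis
  proof (cases "f = 0 \<or> g = 0 \<or> f + g = 0")
    case False
    then have "min (P f) (P g) \<le> P (f + g)" using P by (auto simp: points_def)
    then show ?thesis using False f g by (auto simp: zero_of_order_at_least_def)
  qed (use f g in \<open>auto simp: zero_of_order_at_least_def\<close>)
qed

lemma zo_uminus: "zo P (- f) n \<longleftrightarrow> zo P f n"
  by (auto simp: zero_of_order_at_least_def val_uminus)

lemma zo_diff: "zo P f n \<Longrightarrow> zo P g n \<Longrightarrow> zo P (f - g) n"
  using zo_add[of f n "- g"] by (simp add: zo_uminus)

lemma zo_sum: "(\<And>i. i \<in> I \<Longrightarrow> zo P (f i) n) \<Longrightarrow> zo P (sum f I) n"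
  by (induction I rule: infinite_finite_induct) (auto intro: zo_add)

lemma zo_mult: "zo P f m \<Longrightarrow> zo P g n \<Longrightarrow> zo P (f * g) (m + n)"
  by (cases "f = 0 \<or> g = 0") (auto simp: zero_of_order_at_least_def val_mult)

lemma zo_emb: "zo P (emb c) 0"
  by (simp add: zero_of_order_at_least_def val_emb)

lemma zo_1: "zo P 1 0"
  by (simp add: zero_of_order_at_least_def val_1)

lemma zo_of_nat: "zo P (of_nat n) 0"
  using zo_emb[of "of_nat n"] by (simp add: hom_of_nat)

lemma zo_power: "zo P f m \<Longrightarrow> zo P (f ^ n) (int n * m)"
proof (induction n)
  case (Suc n)
  then show ?case using zo_mult[of f m "f ^ n" "int n * m"] by (simp add: algebra_simps)
qed (simp add: zo_1)

lemma zo_power_0: "zo P f 0 \<Longrightarrow> zo P (f ^ n) 0"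
  using zo_power[of f 0] by simp

lemma zo_mult_0: "zo P f 0 \<Longrightarrow> zo P g 0 \<Longrightarrow> zo P (f * g) 0"
  using zo_mult[of f 0 g 0] by simp

lemma zo_ev: "zo P a 0 \<Longrightarrow> zo P (ev a p) 0"
  by (induction p) (auto intro!: zo_add zo_emb zo_mult_0)

lemma val_add_dominant:
  assumes "f \<noteq> 0" "zo P g (P f + 1)"
  shows "f + g \<noteq> 0" "P (f + g) = P f"
proof -
  show nz: "f + g \<noteq> 0"
  proof
    assume "f + g = 0"
    then have "g = - f" by (simp add: add_eq_0_iff)
    then show False using assms val_uminus[of f] by (simp add: zero_of_order_at_least_def)
  qed
  have ge: "zo P (f + g) (P f)"
    using assms by (intro zo_add) (auto simp: zero_of_order_at_least_def)
  have "\<not> zo P (f + g) (P f + 1)"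
  proof
    assume "zo P (f + g) (P f + 1)"
    from zo_diff[OF this assms(2)] show False using assms(1) by (simp add: zero_of_order_at_least_def)
  qed
  with ge nz show "P (f + g) = P f" by (auto simp: zero_of_order_at_least_def)
qed

lemma val_add_neq:
  assumes "f \<noteq> 0" "g \<noteq> 0" "P f \<noteq> P g"
  shows "f + g \<noteq> 0 \<and> P (f + g) = min (P f) (P g)"
  using val_add_dominant[of f g] val_add_dominant[of g f] assms
  by (cases "P f < P g") (auto simp: zero_of_order_at_least_def add.commute)

lemma val_sum_dominant:
  assumes "finite I" "i \<in> I" "F i \<noteq> 0" "\<And>j. j \<in> I \<Longrightarrow> j \<noteq> i \<Longrightarrow> zo P (F j) (P (F i) + 1)"
  shows "sum F I \<noteq> 0" "P (sum F I) = P (F i)"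
proof -
  have "sum F I = F i + sum F (I - {i})" using assms by (simp add: sum.remove)
  moreover have "zo P (sum F (I - {i})) (P (F i) + 1)" using assms by (intro zo_sum) auto
  ultimately show "sum F I \<noteq> 0" "P (sum F I) = P (F i)"
    using val_add_dominant[OF assms(3)] by simp_all
qed

text \<open>
  The term of least value dominates all others.
\<close>
lemma distinct_vals_sum:
  assumes "finite I"
    and dist: "\<And>i j. i \<in> I \<Longrightarrow> j \<in> I \<Longrightarrow> F i \<noteq> 0 \<Longrightarrow> F j \<noteq> 0 \<Longrightarrow> i \<noteq> j \<Longrightarrow> P (F i) \<noteq> P (F j)"
    and "k \<in> I" "F k \<noteq> 0"
  shows "sum F I \<noteq> 0 \<and> P (sum F I) \<le> P (F k)"
proof -
  define J where "J = {i \<in> I. F i \<noteq> 0}"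
  have J: "finite J" "k \<in> J" using assms by (auto simp: J_def)
  define i where "i = arg_min_on (\<lambda>i. P (F i)) J"
  have i: "i \<in> J" "\<And>j. j \<in> J \<Longrightarrow> P (F i) \<le> P (F j)"
    using arg_min_if_finite[of J "\<lambda>i. P (F i)"] J unfolding i_def by (auto simp: not_less)
  have "zo P (F j) (P (F i) + 1)" if "j \<in> I" "j \<noteq> i" for j
    using dist[of i j] i that by (force simp: J_def zero_of_order_at_least_def)
  then show ?thesis
    using val_sum_dominant[of I i F] i J assms(1) by (auto simp: J_def)
qed

lemma ev_nonzero_of_val:
  assumes "P f \<noteq> 0" "p \<noteq> 0"
  shows "ev f p \<noteq> 0"
proof -
  have f: "f \<noteq> 0" using assms(1) val_0 by auto
  have "P (emb (coeff p i) * f ^ i) = int i * P f" if "coeff p i \<noteq> 0" for i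
    using f that by (subst val_mult) (auto simp: val_emb val_power)
  then have "(\<Sum>i\<le>degree p. emb (coeff p i) * f ^ i) \<noteq> 0 \<and>
      P (\<Sum>i\<le>degree p. emb (coeff p i) * f ^ i) \<le> P (emb (coeff p (degree p)) * f ^ degree p)"
    using assms f by (intro distinct_vals_sum) auto
  then show ?thesis by (simp add: ev_eq_sum[of p "degree p"])
qed

lemma ev_const_coeff:
  assumes "zo P a 1"
  shows "zo P (ev a p - emb (coeff p 0)) 1"
proof (cases p)
  case (pCons c q)
  have "zo P (a * ev a q) (1 + 0)" using assms by (intro zo_mult zo_ev) (auto intro: zo_mono)
  then show ?thesis by (simp add: pCons)
qed

lemma val_ev_unit:
  assumes "zo P a 1" "coeff p 0 \<noteq> 0"
  shows "ev a p \<noteq> 0" "P (ev a p) = 0"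
  using val_add_dominant[of "emb (coeff p 0)" "ev a p - emb (coeff p 0)"]
    ev_const_coeff[OF assms(1), of p] assms(2) by (auto simp: val_emb)

lemma val_ev_pole:
  assumes "P a < 0" "p \<noteq> 0"
  shows "P (ev a p) = int (degree p) * P a"
proof -
  have a: "a \<noteq> 0" using assms(1) val_0 by auto
  have val: "P (emb (coeff p i) * a ^ i) = int i * P a" if "coeff p i \<noteq> 0" for i
    using a that by (subst val_mult) (auto simp: val_emb val_power)
  have "P (\<Sum>i\<le>degree p. emb (coeff p i) * a ^ i) = P (emb (coeff p (degree p)) * a ^ degree p)"
  proof (rule val_sum_dominant(2))
    fix i assume i: "i \<in> {..degree p}" "i \<noteq> degree p"
    have "(int i - int (degree p)) * P a \<ge> 1"
      using i assms(1) by (smt (verit) atMost_iff mult_neg_neg of_nat_le_iff of_nat_eq_iff)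
    then show "zo P (emb (coeff p i) * a ^ i) (P (emb (coeff p (degree p)) * a ^ degree p) + 1)"
      using assms(2) val by (cases "coeff p i = 0") (auto simp: zero_of_order_at_least_def algebra_simps)
  qed (use a assms in auto)
  then show ?thesis using val assms(2) by (simp add: ev_eq_sum[of p "degree p"])
qed

text \<open>
  \<open>q\<close> splits into linear factors over \<open>k\<close>, and one of the factors must vanish at the point.
\<close>
lemma root_mod_maximal_ideal:
  assumes "zo P f 0" "q \<noteq> 0" "zo P (ev f q) 1"
  shows "\<exists>c. zo P (f - emb c) 1"
  using assms(2,3)
proof (induction "degree q" arbitrary: q)
  case 0
  then obtain c where "q = [:c:]" using degree_0_id by metis
  with 0 show ?case by (auto simp: zero_of_order_at_least_def val_emb)
next
  case (Suc n)
  then obtain c where "poly q c = 0" using alg_closed_imp_poly_has_root[of q] by auto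
  then obtain r where q: "q = [:- c, 1:] * r" by (auto simp: poly_eq_0_iff_dvd elim: dvdE)
  have r: "r \<noteq> 0" "degree r = n"
    using Suc.prems(1) Suc.hyps(2) by (auto simp: q degree_mult_eq simp del: mult_pCons_left)
  have "ev f q = ev f [:- c, 1:] * ev f r" by (simp only: q ev.hom_mult)
  also have "ev f [:- c, 1:] = f - emb c" by (simp add: hom_uminus)
  finally have eq: "ev f q = (f - emb c) * ev f r" .
  show ?case
  proof (cases "zo P (f - emb c) 1")
    case False
    then have fc: "f - emb c \<noteq> 0" "P (f - emb c) \<le> 0" by (auto simp: zero_of_order_at_least_def)
    have "zo P (ev f r) 1"
      using Suc.prems(2) fc unfolding eq
      by (cases "ev f r = 0") (auto simp: zero_of_order_at_least_def val_mult)
    then show ?thesis using Suc.hyps(1)[of r] r by blast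
  qed blast
qed

text \<open>
  Points are rational.  A relation between \<open>f\<close> and a uniformizer \<open>t\<close>, made primitive and reduced
  modulo \<open>t\<close>, shows that the residue of \<open>f\<close> is algebraic over the algebraically closed field \<open>k\<close>.
\<close>
lemma residue_exists:
  assumes "zo P f 0"
  shows "\<exists>c. zo P (f - emb c) 1"
proof -
  obtain t where t: "t \<noteq> 0" "P t = 1" using uniformizer_exists by blast
  have t1: "zo P t 1" using t by (simp add: zero_of_order_at_least_def)
  obtain n p where p: "\<exists>j\<le>n. p j \<noteq> 0" "(\<Sum>j\<le>n. ev t (p j) * f ^ j) = 0"
    using algebraically_dependent[of t f] by auto
  obtain a r where r: "\<forall>j\<le>n. p j = [:0, 1:] ^ a * r j" "\<exists>j\<le>n. coeff (r j) 0 \<noteq> 0"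
    using common_factor_X[of "{..n}" p] p(1) by (auto simp del: mult_pCons_left)
  have "(\<Sum>j\<le>n. ev t (p j) * f ^ j) = t ^ a * (\<Sum>j\<le>n. ev t (r j) * f ^ j)"
    unfolding sum_distrib_left
    by (rule sum.cong) (use r(1) in \<open>auto simp: ev.hom_mult ev.hom_power simp del: mult_pCons_left\<close>)
  then have rel: "(\<Sum>j\<le>n. ev t (r j) * f ^ j) = 0" using p(2) t by simp
  define q where "q = (\<Sum>j\<le>n. monom (coeff (r j) 0) j)"
  have "coeff q j = coeff (r j) 0" if "j \<le> n" for j
    using that by (simp add: q_def coeff_sum)
  then have "q \<noteq> 0" using r(2) by auto
  moreover have "zo P (ev f q) 1"
  proof -
    have "zo P (\<Sum>j\<le>n. (ev t (r j) - emb (coeff (r j) 0)) * f ^ j) 1"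
      using zo_mult[OF ev_const_coeff[OF t1] zo_power_0[OF assms]] by (intro zo_sum) auto
    also have "(\<Sum>j\<le>n. (ev t (r j) - emb (coeff (r j) 0)) * f ^ j) = - ev f q"
      using rel by (simp add: q_def ev.hom_sum left_diff_distrib sum_subtractf)
    finally show ?thesis by (simp add: zo_uminus)
  qed
  ultimately show ?thesis using root_mod_maximal_ideal[OF assms] by blast
qed

end

lemma algebraic_imp_const:
  assumes "q \<noteq> 0" "ev f q = 0"
  shows "\<exists>c. f = emb c"
  using assms
proof (induction "degree q" arbitrary: q)
  case 0
  then obtain c where "q = [:c:]" using degree_0_id by metis
  with 0 show ?case by auto
next
  case (Suc n)
  then obtain c where "poly q c = 0" using alg_closed_imp_poly_has_root[of q] by auto
  then obtain r where q: "q = [:- c, 1:] * r" by (auto simp: poly_eq_0_iff_dvd elim: dvdE)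
  have r: "r \<noteq> 0" "degree r = n"
    using Suc.prems(1) Suc.hyps(2) by (auto simp: q degree_mult_eq simp del: mult_pCons_left)
  have "ev f q = ev f [:- c, 1:] * ev f r" by (simp only: q ev.hom_mult)
  also have "ev f [:- c, 1:] = f - emb c" by (simp add: hom_uminus)
  finally have eq: "ev f q = (f - emb c) * ev f r" .
  then show ?case using Suc.prems(2) Suc.hyps(1)[of r] r by auto
qed

section \<open>Existence of zeros and poles\<close>

definition k_subring :: "'f set \<Rightarrow> bool" where
  "k_subring R \<longleftrightarrow> range emb \<subseteq> R \<and> (\<forall>f\<in>R. \<forall>g\<in>R. f + g \<in> R \<and> f * g \<in> R)"

context
  fixes R :: "'f set"
  assumes R: "k_subring R"
begin

lemma k_subring_emb: "emb c \<in> R"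
  using R by (auto simp: k_subring_def)

lemma k_subring_0: "0 \<in> R"
  using k_subring_emb[of 0] by simp

lemma k_subring_1: "1 \<in> R"
  using k_subring_emb[of 1] by simp

lemma k_subring_add: "f \<in> R \<Longrightarrow> g \<in> R \<Longrightarrow> f + g \<in> R"
  using R by (auto simp: k_subring_def)

lemma k_subring_mult: "f \<in> R \<Longrightarrow> g \<in> R \<Longrightarrow> f * g \<in> R"
  using R by (auto simp: k_subring_def)

lemma k_subring_uminus: "f \<in> R \<Longrightarrow> - f \<in> R"
  using k_subring_mult[OF k_subring_emb[of "- 1"], of f] by (simp add: hom_uminus)

lemma k_subring_diff: "f \<in> R \<Longrightarrow> g \<in> R \<Longrightarrow> f - g \<in> R"
  using k_subring_add[of f "- g"] k_subring_uminus[of g] by simp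

lemma k_subring_power: "f \<in> R \<Longrightarrow> f ^ n \<in> R"
  by (induction n) (auto intro: k_subring_1 k_subring_mult)

lemma k_subring_sum: "(\<And>i. i \<in> I \<Longrightarrow> f i \<in> R) \<Longrightarrow> sum f I \<in> R"
  by (induction I rule: infinite_finite_induct) (auto intro: k_subring_0 k_subring_add)

lemma k_subring_ev: "f \<in> R \<Longrightarrow> ev f p \<in> R"
  by (induction p) (auto intro: k_subring_0 k_subring_add k_subring_mult k_subring_emb)

end

text \<open>
  The values of \<open>v\<close> form the subgroup generated by the least positive value \<open>m\<close>, so \<open>v / m\<close> is
  normalised.
\<close>
lemma place_of_order_function:
  fixes v :: "'f \<Rightarrow> int"
  assumes mult: "\<And>f g. f \<noteq> 0 \<Longrightarrow> g \<noteq> 0 \<Longrightarrow> v (f * g) = v f + v g"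
    and add: "\<And>f g. f \<noteq> 0 \<Longrightarrow> g \<noteq> 0 \<Longrightarrow> f + g \<noteq> 0 \<Longrightarrow> v (f + g) \<ge> min (v f) (v g)"
    and const: "\<And>c. c \<noteq> 0 \<Longrightarrow> v (emb c) = 0"
    and w: "w \<noteq> 0" "v w > 0"
  shows "\<exists>P\<in>points. P w > 0"
proof -
  have v1: "v 1 = 0" using mult[of 1 1] by simp
  have pow: "v (f ^ n) = int n * v f" if "f \<noteq> 0" for f n
    by (induction n) (use that in \<open>auto simp: v1 mult algebra_simps\<close>)
  have inv: "v (inverse f) = - v f" if "f \<noteq> 0" for f
    using mult[of f "inverse f"] that by (simp add: v1)
  define m where "m = (LEAST m. m > 0 \<and> (\<exists>f. f \<noteq> 0 \<and> v f = int m))"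
  have "\<exists>m. m > 0 \<and> (\<exists>f. f \<noteq> 0 \<and> v f = int m)"
    using w by (intro exI[of _ "nat (v w)"]) auto
  then have "m > 0 \<and> (\<exists>f. f \<noteq> 0 \<and> v f = int m)"
    unfolding m_def by (rule LeastI_ex)
  then obtain t where m: "m > 0" and t: "t \<noteq> 0" "v t = int m" by blast
  have m_least: "m \<le> n" if "n > 0" "f \<noteq> 0" "v f = int n" for n f
    unfolding m_def using that by (intro Least_le) auto
  have dvd: "int m dvd v f" if f: "f \<noteq> 0" for f
  proof -
    define q where "q = v f div int m"
    define h where "h = (if q \<ge> 0 then f * inverse t ^ nat q else f * t ^ nat (- q))"
    have h: "h \<noteq> 0" "v h = v f - q * int m"
      using f t by (auto simp: h_def mult pow inv)
    then have "v h = v f mod int m" by (simp add: q_def minus_div_mult_eq_mod)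
    then have "0 \<le> v h" "v h < int m" using m by auto
    then have "v h = 0" using m_least[of "nat (v h)" h] h(1) by (cases "v h = 0") auto
    then show ?thesis using \<open>v h = v f mod int m\<close> by auto
  qed
  define P where "P f = (if f = 0 then 0 else v f div int m)" for f
  have "P \<in> points"
    unfolding points_def
  proof (intro CollectI conjI allI impI)
    fix f g :: 'f assume fg: "f \<noteq> 0" "g \<noteq> 0"
    show "P (f * g) = P f + P g"
      using fg dvd[of f] by (simp add: P_def mult div_plus_div_distrib_dvd_left)
    assume "f + g \<noteq> 0"
    then have "v (f + g) \<ge> min (v f) (v g)" using fg add by blast
    then have "v f div int m \<le> v (f + g) div int m \<or> v g div int m \<le> v (f + g) div int m"
      using m by (auto simp: min_def intro: zdiv_mono1 split: if_splits)
    then show "P (f + g) \<ge> min (P f) (P g)" using fg \<open>f + g \<noteq> 0\<close> by (auto simp: P_def)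
  next
    show "\<exists>t. P t = 1" using t m by (intro exI[of _ t]) (simp add: P_def)
  qed (use const in \<open>auto simp: P_def\<close>)
  moreover have "P w > 0"
  proof -
    have "v w = int m * (v w div int m)" using dvd[OF w(1)] by simp
    then show ?thesis using w m by (metis P_def of_nat_0_less_iff zero_less_mult_pos)
  qed
  ultimately show ?thesis by blast
qed

text \<open>
  The start of Chevalley's construction of a valuation ring in which \<open>w\<close> is not invertible: by Zorn's
  lemma the ring \<open>k[w]\<close>, which does not contain \<open>1/w\<close>, lies in a maximal subring with that property.
\<close>
lemma maximal_subring_without_inverse:
  assumes w: "transcendental_over emb w"
  obtains M where "k_subring M" "w \<in> M" "inverse w \<notin> M"
    "\<And>R. k_subring R \<Longrightarrow> M \<subseteq> R \<Longrightarrow> inverse w \<notin> R \<Longrightarrow> R = M"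
proof -
  define A where "A = {R. k_subring R \<and> w \<in> R \<and> inverse w \<notin> R}"
  have ev0: "ev w p \<noteq> 0" if "p \<noteq> 0" for p
    using w that by (auto simp: transcendental_over_def ev_def)
  have w0: "w \<noteq> 0" using ev0[of "[:0, 1:]"] by auto
  have "range (ev w) \<in> A"
    unfolding A_def
  proof (intro CollectI conjI)
    show "k_subring (range (ev w))"
      unfolding k_subring_def
    proof (intro conjI ballI)
      show "range emb \<subseteq> range (ev w)"
        by (auto intro!: image_eqI[of _ _ "[:_:]"])
    qed (auto simp: image_iff simp flip: ev.hom_add ev.hom_mult)
    show "w \<in> range (ev w)" by (intro image_eqI[of _ _ "[:0, 1:]"]) auto
    show "inverse w \<notin> range (ev w)"
    proof
      assume "inverse w \<in> range (ev w)"
      then obtain p where "inverse w = ev w p" by blast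
      then have "ev w (pCons (- 1) p) = 0" using w0 by (simp add: hom_uminus flip: \<open>inverse w = ev w p\<close>)
      then show False using ev0[of "pCons (- 1) p"] by simp
    qed
  qed
  moreover have "\<Union>C \<in> A" if C: "C \<noteq> {}" "subset.chain A C" for C
    unfolding A_def
  proof (intro CollectI conjI)
    have CA: "\<And>R. R \<in> C \<Longrightarrow> k_subring R \<and> w \<in> R \<and> inverse w \<notin> R"
      using C by (auto simp: subset.chain_def A_def)
    show "w \<in> \<Union>C" "inverse w \<notin> \<Union>C" using CA C by auto
    show "k_subring (\<Union>C)"
      unfolding k_subring_def
    proof (intro conjI ballI)
      show "range emb \<subseteq> \<Union>C" using CA C(1) by (auto intro: k_subring_emb)
      fix f g assume "f \<in> \<Union>C" "g \<in> \<Union>C"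
      then obtain R where "R \<in> C" "f \<in> R" "g \<in> R"
        using C(2) unfolding subset_chain_def by blast
      then show "f + g \<in> \<Union>C" "f * g \<in> \<Union>C" using CA by (auto intro: k_subring_add k_subring_mult)
    qed
  qed
  ultimately obtain M where "M \<in> A" "\<forall>R\<in>A. M \<subseteq> R \<longrightarrow> R = M"
    using subset_Zorn_nonempty[of A] by blast
  then show ?thesis using that unfolding A_def by blast
qed

context
  fixes w :: 'f and M :: "'f set"
  assumes w: "transcendental_over emb w"
    and M: "k_subring M" "w \<in> M" "inverse w \<notin> M"
    and M_max: "\<And>R. k_subring R \<Longrightarrow> M \<subseteq> R \<Longrightarrow> inverse w \<notin> R \<Longrightarrow> R = M"
begin

lemmas M_rules = k_subring_0[OF M(1)] k_subring_1[OF M(1)] k_subring_add[OF M(1)] k_subring_mult[OF M(1)]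
  k_subring_uminus[OF M(1)] k_subring_diff[OF M(1)] k_subring_power[OF M(1)] k_subring_sum[OF M(1)]
  k_subring_emb[OF M(1)] k_subring_ev[OF M(1)] M(2)

lemma w_nonzero: "w \<noteq> 0"
  using M k_subring_0 by auto

lemma one_plus_w_nonzero:
  assumes "b \<in> M"
  shows "1 + w * b \<noteq> 0"
proof
  assume "1 + w * b = 0"
  then have "inverse w = - b" using w_nonzero by (simp add: field_simps add_eq_0_iff)
  then show False using M(3) M_rules assms by auto
qed

text \<open>
  Otherwise the fractions with denominators in \<open>1 + w M\<close> would form a larger ring without \<open>1/w\<close>.
\<close>
lemma one_plus_w_unit:
  assumes "a \<in> M"
  shows "inverse (1 + w * a) \<in> M"
proof -
  define R where "R = {f / (1 + w * b) | f b. f \<in> M \<and> b \<in> M}"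
  have "R = M"
  proof (rule M_max)
    show "M \<subseteq> R"
    proof
      fix f assume "f \<in> M"
      then show "f \<in> R"
        unfolding R_def by (intro CollectI exI[of _ f] exI[of _ 0]) (auto simp: k_subring_0[OF M(1)])
    qed
    show "k_subring R"
      unfolding k_subring_def
    proof (intro conjI ballI)
      show "range emb \<subseteq> R" using \<open>M \<subseteq> R\<close> M_rules by auto
      fix f g assume "f \<in> R" "g \<in> R"
      then obtain f' b g' c where f: "f = f' / (1 + w * b)" "f' \<in> M" "b \<in> M"
        and g: "g = g' / (1 + w * c)" "g' \<in> M" "c \<in> M" by (auto simp: R_def)
      have nz: "1 + w * b \<noteq> 0" "1 + w * c \<noteq> 0" using one_plus_w_nonzero f g by auto
      have prod: "(1 + w * b) * (1 + w * c) = 1 + w * (b + c + w * b * c)" by (simp add: algebra_simps)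
      have in_M: "b + c + w * b * c \<in> M" using f g by (intro M_rules)
      have "f + g = (f' * (1 + w * c) + g' * (1 + w * b)) / ((1 + w * b) * (1 + w * c))"
        unfolding f(1) g(1) using nz by (rule add_frac_eq)
      moreover have "f' * (1 + w * c) + g' * (1 + w * b) \<in> M" using f g by (intro M_rules)
      ultimately show "f + g \<in> R" unfolding R_def prod using in_M by blast
      have "f * g = (f' * g') / ((1 + w * b) * (1 + w * c))" by (simp add: f g)
      moreover have "f' * g' \<in> M" using f g by (intro M_rules)
      ultimately show "f * g \<in> R" unfolding R_def prod using in_M by blast
    qed
    show "inverse w \<notin> R"
    proof
      assume "inverse w \<in> R"
      then obtain f b where f: "inverse w = f / (1 + w * b)" "f \<in> M" "b \<in> M" by (auto simp: R_def)
      then have "1 + w * b = w * f" using one_plus_w_nonzero[of b] w_nonzero by (simp add: field_simps)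
      then have "inverse w = f - b" using w_nonzero by (simp add: field_simps)
      then show False using M(3) M_rules f by auto
    qed
  qed
  moreover have "inverse (1 + w * a) \<in> R"
    unfolding R_def using assms M_rules by (auto simp: inverse_eq_divide)
  ultimately show ?thesis by simp
qed

text \<open>
  By maximality the ring \<open>M[a]\<close> contains \<open>1/w\<close>.
\<close>
lemma relation_exists:
  assumes "a \<notin> M"
  shows "\<exists>n p. (\<forall>i\<le>n. p i \<in> M) \<and> (\<Sum>i\<le>n::nat. w * p i * a ^ i) = 1"
proof -
  \<comment> \<open>the ring \<open>M[a]\<close>; the equality \<open>R_eq\<close> below makes polynomial arithmetic available for the closure properties\<close>
  define R where "R = {\<Sum>i\<le>n. p i * a ^ i | n p. \<forall>i. p i \<in> M}"
  have M_sub: "M \<subseteq> R"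
  proof
    fix f assume "f \<in> M"
    then show "f \<in> R"
      using M_rules unfolding R_def
      by (intro CollectI exI[of _ "0::nat"] exI[of _ "\<lambda>i. f"]) auto
  qed
  have a: "a \<in> R"
    unfolding R_def
    by (intro CollectI exI[of _ "Suc 0"] exI[of _ "\<lambda>i. if i = 1 then 1 else 0"]) (auto simp: M_rules)
  have R_eq: "R = {poly p a | p. \<forall>i. coeff p i \<in> M}"
  proof (intro equalityI subsetI)
    fix f assume "f \<in> R"
    then obtain n p where p: "f = (\<Sum>i\<le>n. p i * a ^ i)" "\<forall>i. p i \<in> M" by (auto simp: R_def)
    have "f = poly (\<Sum>i\<le>n. monom (p i) i) a" by (simp add: p poly_sum poly_monom)
    moreover have "\<forall>i. coeff (\<Sum>i\<le>n. monom (p i) i) i \<in> M" using p by (auto simp: coeff_sum M_rules)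
    ultimately show "f \<in> {poly p a | p. \<forall>i. coeff p i \<in> M}" by blast
  qed (auto simp: R_def poly_altdef)
  have "k_subring R"
    unfolding k_subring_def
  proof (intro conjI ballI)
    show "range emb \<subseteq> R" using M_sub M_rules by auto
    fix f g assume "f \<in> R" "g \<in> R"
    then obtain p q where pq: "f = poly p a" "g = poly q a" "\<forall>i. coeff p i \<in> M" "\<forall>i. coeff q i \<in> M"
      unfolding R_eq by blast
    have "\<forall>i. coeff (p + q) i \<in> M" using pq M_rules by auto
    then show "f + g \<in> R" unfolding R_eq pq poly_add[symmetric] by blast
    have "\<forall>i. coeff (p * q) i \<in> M" using pq unfolding coeff_mult by (intro allI M_rules) auto
    then show "f * g \<in> R" unfolding R_eq pq poly_mult[symmetric] by blast
  qed
  then have "inverse w \<in> R" using M_max[of R] M_sub a assms by auto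
  then obtain n p where "inverse w = (\<Sum>i\<le>n. p i * a ^ i)" "\<forall>i. p i \<in> M" by (auto simp: R_def)
  moreover have "w * inverse w = 1" using w_nonzero by simp
  ultimately show ?thesis by (intro exI[of _ n] exI[of _ p]) (auto simp: sum_distrib_left mult.assoc)
qed

text \<open>
  The step that makes \<open>M\<close> a valuation ring: as \<open>1 - w q_0\<close> is a unit, the relation for \<open>1/a\<close> expresses
  \<open>a^n\<close> through lower powers with coefficients in \<open>w M\<close>, which eliminates the leading term of the
  relation for \<open>a\<close>.
\<close>
lemma relation_shorten:
  assumes a: "a \<noteq> 0" and "m \<le> n"
    and p: "\<And>i. i \<le> n \<Longrightarrow> p i \<in> M" "(\<Sum>i\<le>n. w * p i * a ^ i) = 1"
    and q: "\<And>i. i \<le> m \<Longrightarrow> q i \<in> M" "(\<Sum>i\<le>m. w * q i * inverse a ^ i) = 1"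
  shows "n > 0 \<and> (\<exists>p'. (\<forall>i\<le>n - 1. p' i \<in> M) \<and> (\<Sum>i\<le>n - 1. w * p' i * a ^ i) = 1)"
proof -
  have "n > 0"
  proof (rule ccontr)
    assume "\<not> n > 0"
    then have "w * p 0 = 1" using p by simp
    then have "inverse w = p 0" using w_nonzero by (simp add: field_simps)
    then show False using M(3) p by auto
  qed
  define u where "u = inverse (1 - w * q 0)"
  have u: "u \<in> M" "u * (1 - w * q 0) = 1"
    using one_plus_w_unit[of "- q 0"] one_plus_w_nonzero[of "- q 0"] q M_rules by (auto simp: u_def)
  have top: "a ^ n = (\<Sum>i<n. w * (if n - i \<le> m then u * q (n - i) else 0) * a ^ i)"
  proof -
    have "(\<Sum>i\<le>m. w * q i * inverse a ^ i) = w * q 0 + (\<Sum>i\<in>{1..m}. w * q i * inverse a ^ i)"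
      by (simp add: sum.atLeast_Suc_atMost atMost_atLeast0)
    then have "1 - w * q 0 = (\<Sum>i\<in>{1..m}. w * q i * inverse a ^ i)" using q by (simp add: algebra_simps)
    then have "a ^ n = u * (\<Sum>i\<in>{1..m}. w * q i * inverse a ^ i) * a ^ n" using u by simp
    also have "\<dots> = (\<Sum>i\<in>{1..m}. w * (u * q i) * a ^ (n - i))"
      unfolding sum_distrib_left sum_distrib_right
    proof (rule sum.cong)
      fix i assume "i \<in> {1..m}"
      then have "a ^ n = a ^ i * a ^ (n - i)" using \<open>m \<le> n\<close> by (simp flip: power_add)
      then show "u * (w * q i * inverse a ^ i) * a ^ n = w * (u * q i) * a ^ (n - i)"
        using a by (simp add: power_inverse)
    qed simp
    also have "\<dots> = (\<Sum>i\<in>{n - m..<n}. w * (u * q (n - i)) * a ^ i)"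
      using \<open>m \<le> n\<close> by (intro sum.reindex_bij_witness[of _ "\<lambda>i. n - i" "\<lambda>i. n - i"]) auto
    also have "\<dots> = (\<Sum>i<n. w * (if n - i \<le> m then u * q (n - i) else 0) * a ^ i)"
      by (intro sum.mono_neutral_cong_left) auto
    finally show ?thesis .
  qed
  define p' where "p' i = p i + w * p n * (if n - i \<le> m then u * q (n - i) else 0)" for i
  have "p' i \<in> M" if "i \<le> n - 1" for i
    using p(1)[of i] p(1)[of n] q(1)[of "n - i"] u that M_rules by (auto simp: p'_def)
  moreover have "(\<Sum>i\<le>n - 1. w * p' i * a ^ i) = 1"
  proof -
    have "(\<Sum>i\<le>n - 1. w * p' i * a ^ i) = (\<Sum>i<n. w * p' i * a ^ i)"
      using \<open>n > 0\<close> by (intro sum.cong) auto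
    also have "\<dots> = (\<Sum>i<n. w * p i * a ^ i) +
        w * p n * (\<Sum>i<n. w * (if n - i \<le> m then u * q (n - i) else 0) * a ^ i)"
      by (simp add: p'_def algebra_simps sum.distrib sum_distrib_left del: if_image_distrib)
    also have "\<dots> = (\<Sum>i\<le>n. w * p i * a ^ i)"
      unfolding top[symmetric] by (simp flip: lessThan_Suc_atMost)
    finally show ?thesis using p by simp
  qed
  ultimately show ?thesis using \<open>n > 0\<close> by blast
qed

text \<open>
  If neither belonged to \<open>M\<close>, both would satisfy relations, and the longer of the two could be
  shortened forever.
\<close>
lemma valuation_ring:
  assumes "a \<noteq> 0"
  shows "a \<in> M \<or> inverse a \<in> M"
proof (rule ccontr)
  assume "\<not> ?thesis"
  then obtain n p m q where 1: "(\<forall>i\<le>n. p i \<in> M)" "(\<Sum>i\<le>n::nat. w * p i * a ^ i) = 1"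
    "(\<forall>i\<le>m. q i \<in> M)" "(\<Sum>i\<le>m::nat. w * q i * inverse a ^ i) = 1"
    using relation_exists[of a] relation_exists[of "inverse a"] by blast
  from assms this show False
  proof (induction "n + m" arbitrary: a n p m q rule: less_induct)
    case less
    show False
    proof (cases "m \<le> n")
      case True
      then obtain p' where "n > 0" "\<forall>i\<le>n - 1. p' i \<in> M" "(\<Sum>i\<le>n - 1. w * p' i * a ^ i) = 1"
        using relation_shorten[of a m n p q] less.prems by blast
      then show False using less.hyps[of "n - 1" m a p' q] less.prems by auto
    next
      case False
      then obtain q' where "m > 0" "\<forall>i\<le>m - 1. q' i \<in> M" "(\<Sum>i\<le>m - 1. w * q' i * inverse a ^ i) = 1"
        using relation_shorten[of "inverse a" n m q p] less.prems by auto
      then show False using less.hyps[of n "m - 1" a p q'] less.prems by auto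
    qed
  qed
qed

definition unit :: "'f \<Rightarrow> bool" where
  "unit u \<longleftrightarrow> u \<noteq> 0 \<and> u \<in> M \<and> inverse u \<in> M"

lemma unit_mult: "unit u \<Longrightarrow> unit v \<Longrightarrow> unit (u * v)"
  by (auto simp: unit_def M_rules)

lemma unit_inverse: "unit u \<Longrightarrow> unit (inverse u)"
  by (auto simp: unit_def)

lemma unit_power: "unit u \<Longrightarrow> unit (u ^ n)"
  by (auto simp: unit_def M_rules simp flip: power_inverse)

lemma unit_emb: "c \<noteq> 0 \<Longrightarrow> unit (emb c)"
  using M_rules(9)[of "inverse c"] by (auto simp: unit_def M_rules hom_inverse)

lemma unit_factor: "f \<in> M \<Longrightarrow> g \<in> M \<Longrightarrow> unit (f * g) \<Longrightarrow> unit f"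
proof -
  assume 1: "f \<in> M" "g \<in> M" "unit (f * g)"
  then have "g * inverse (f * g) \<in> M" by (auto simp: unit_def intro: M_rules)
  moreover have "g * inverse (f * g) = inverse f" using 1 by (auto simp: unit_def)
  ultimately have "inverse f \<in> M" by (simp only:)
  then show ?thesis using 1 by (auto simp: unit_def)
qed

lemma nonunit_add:
  assumes "f \<in> M" "g \<in> M" "\<not> unit f" "\<not> unit g"
  shows "\<not> unit (f + g)"
proof (cases "f = 0 \<or> g = 0")
  case False
  have *: "\<not> unit (a + b)" if "a \<in> M" "b \<in> M" "\<not> unit b" "a / b \<in> M" "b \<noteq> 0" for a b
  proof
    assume "unit (a + b)"
    moreover have "a + b = b * (1 + a / b)" using that by (simp add: field_simps)
    moreover have "1 + a / b \<in> M" using that by (intro M_rules)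
    ultimately show False using unit_factor[of b "1 + a / b"] that by auto
  qed
  have "f / g \<in> M \<or> g / f \<in> M" using valuation_ring[of "f / g"] False by simp
  then show ?thesis using *[of f g] *[of g f] assms False by (auto simp: add.commute)
qed (use assms in auto)

lemma not_unit_0: "\<not> unit 0"
  by (simp add: unit_def)

lemma not_unit_w_power:
  assumes "n > 0"
  shows "\<not> unit (w ^ n)"
proof
  assume "unit (w ^ n)"
  then have "unit w" using unit_factor[of w "w ^ (n - 1)"] assms M_rules by (cases n) auto
  then show False using M(3) by (auto simp: unit_def)
qed

text \<open>
  Hence the value of a nonzero element of \<open>k(w)\<close> is a multiple of the value of \<open>w\<close>.
\<close>
lemma ev_eq_power_times_unit:
  assumes "p \<noteq> 0"
  shows "\<exists>l u. unit u \<and> ev w p = w ^ l * u"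
proof -
  obtain l r where r: "p = [:0, 1:] ^ l * r" "coeff r 0 \<noteq> 0"
    using common_factor_X[of "{()}" "\<lambda>_. p"] assms by auto
  have "ev w p = w ^ l * ev w r" unfolding r(1) by (simp only: ev.hom_mult ev.hom_power) simp
  moreover have "unit (ev w r)"
  proof (cases r)
    case (pCons c s)
    then have c: "c \<noteq> 0" using r by simp
    have "unit (1 + w * (inverse (emb c) * ev w s))"
      unfolding unit_def using M_rules unit_emb[OF c]
      by (intro conjI one_plus_w_nonzero one_plus_w_unit) (auto simp: unit_def)
    then have "unit (emb c * (1 + w * (inverse (emb c) * ev w s)))" using unit_emb[OF c] by (rule unit_mult[rotated])
    moreover have "emb c * (1 + w * (inverse (emb c) * ev w s)) = ev w r"
      using c by (simp add: pCons field_simps)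
    ultimately show ?thesis by simp
  qed
  ultimately show ?thesis by blast
qed

text \<open>
  The analogue of \<open>distinct_vals_sum\<close> for the valuation ring \<open>M\<close>, whose value group is not yet known to
  be that of the integers: divisibility in \<open>M\<close> is a total preorder, and a least term that is
  associated to no other would dominate the sum.
\<close>
lemma sum_eq_0_imp_two_associated:
  assumes "finite I" "sum F I = 0" "i0 \<in> I" "F i0 \<noteq> 0"
  shows "\<exists>i\<in>I. \<exists>j\<in>I. i \<noteq> j \<and> F i \<noteq> 0 \<and> F j \<noteq> 0 \<and> unit (F i / F j)"
proof (rule ccontr)
  assume not: "\<not> ?thesis"
  define J where "J = {i \<in> I. F i \<noteq> 0}"
  have "finite J" "J \<noteq> {}" using assms by (auto simp: J_def)
  then have "\<exists>i\<in>J. \<forall>j\<in>J. F j / F i \<in> M"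
  proof (induction rule: finite_ne_induct)
    case (singleton x)
    then show ?case using M_rules by (cases "F x = 0") auto
  next
    case (insert x S)
    then obtain i where i: "i \<in> S" "\<And>j. j \<in> S \<Longrightarrow> F j / F i \<in> M" by blast
    have refl: "f / f \<in> M" for f using M_rules by (cases "f = 0") auto
    show ?case
    proof (cases "F x / F i \<in> M")
      case True
      then show ?thesis using i by auto
    next
      case False
      then have *: "F i / F x \<in> M"
        using valuation_ring[of "F x / F i"] M_rules by (cases "F x / F i = 0") auto
      have "F j / F x \<in> M" if "j \<in> S" for j
      proof (cases "F i = 0")
        case True
        then show ?thesis using False M_rules by auto
      next
        case nz: False
        have "F j / F i * (F i / F x) \<in> M" by (intro M_rules * i(2) that)
        then show ?thesis using nz by simp
      qed
      then show ?thesis using refl by auto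
    qed
  qed
  then obtain i where i: "i \<in> J" "\<And>j. j \<in> J \<Longrightarrow> F j / F i \<in> M" by blast
  have "(\<Sum>j\<in>S. F j / F i) \<in> M \<and> \<not> unit (\<Sum>j\<in>S. F j / F i)" if "finite S" "S \<subseteq> J - {i}" for S
    using that
  proof (induction S)
    case empty
    then show ?case by (simp add: not_unit_0 M_rules)
  next
    case (insert j S)
    then have "\<not> unit (F j / F i)" using not i(1) by (auto simp: J_def)
    then show ?case using insert i(2)[of j] nonunit_add M_rules by auto
  qed
  then have "\<not> unit (\<Sum>j\<in>J - {i}. F j / F i)" using \<open>finite J\<close> by blast
  moreover have "(\<Sum>j\<in>J - {i}. F j / F i) = - 1"
  proof -
    have "sum F I = (\<Sum>j\<in>J. F j)" using assms(1) by (intro sum.mono_neutral_right) (auto simp: J_def)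
    then have "0 = (\<Sum>j\<in>J. F j)" using assms(2) by simp
    also have "\<dots> = F i + (\<Sum>j\<in>J - {i}. F j)" using \<open>finite J\<close> i(1) by (rule sum.remove)
    finally have "(\<Sum>j\<in>J - {i}. F j) = - F i" by (metis add_eq_0_iff)
    then show ?thesis using i(1) by (simp add: J_def flip: sum_divide_distrib)
  qed
  moreover have "unit (- 1)" using unit_emb[of "- 1"] by (simp add: hom_uminus)
  ultimately show False by simp
qed

text \<open>
  The value group of \<open>M\<close> modulo the multiples of the value of \<open>w\<close> has finite exponent.  Among
  \<open>1, a, \<dots>, a^n\<close>, where \<open>n\<close> bounds the degree over \<open>k(w)\<close>, two must have values that are congruent
  modulo the value of \<open>w\<close>; so some \<open>a^s\<close> with \<open>1 \<le> s \<le> n\<close> is a power of \<open>w\<close> times a unit, and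
  \<open>n!\<close> works for all \<open>a\<close> at once.
\<close>
lemma common_exponent:
  "\<exists>E :: nat. E > 0 \<and> (\<forall>a. a \<noteq> 0 \<longrightarrow> (\<exists>k. unit (a ^ E * w powi k)))"
proof -
  obtain n where n: "\<forall>c :: nat \<Rightarrow> 'f. \<exists>p. (\<exists>j\<le>n. p j \<noteq> 0) \<and> (\<Sum>j\<le>n. ev w (p j) * c j) = 0"
    using bounded_relation_degree[of w] by (rule exE)
  have ev0: "ev w p \<noteq> 0" if "p \<noteq> 0" for p
    using w that by (auto simp: transcendental_over_def ev_def)
  have "\<exists>k. unit (a ^ fact n * w powi k)" if a: "a \<noteq> 0" for a
  proof -
    obtain p where p: "\<exists>j\<le>n. p j \<noteq> 0" "(\<Sum>j\<le>n. ev w (p j) * a ^ j) = 0"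
      using n[THEN spec, of "\<lambda>j. a ^ j"] by blast
    then obtain j0 where "j0 \<in> {..n}" "p j0 \<noteq> 0" by blast
    then have j0: "j0 \<in> {..n}" "ev w (p j0) * a ^ j0 \<noteq> 0" using ev0[of "p j0"] a by simp_all
    obtain i j where ij: "i \<in> {..n}" "j \<in> {..n}" "i \<noteq> j" "ev w (p i) * a ^ i \<noteq> 0" "ev w (p j) * a ^ j \<noteq> 0"
        "unit ((ev w (p i) * a ^ i) / (ev w (p j) * a ^ j))"
      using sum_eq_0_imp_two_associated[OF finite_atMost p(2), of j0] j0 by blast
    define Q where "Q i j \<longleftrightarrow> i \<le> n \<and> j \<le> n \<and> i < j \<and> p i \<noteq> 0 \<and> p j \<noteq> 0
        \<and> unit ((ev w (p i) * a ^ i) / (ev w (p j) * a ^ j))" for i j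
    have "unit ((ev w (p j) * a ^ j) / (ev w (p i) * a ^ i))"
      using unit_inverse[OF ij(6)] by (simp only: inverse_divide)
    moreover have "i < j \<or> j < i" "i \<le> n" "j \<le> n" using ij(1-3) by auto
    moreover have "p i \<noteq> 0" "p j \<noteq> 0" using ij(4,5) by auto
    ultimately have "Q i j \<or> Q j i" using ij(6) unfolding Q_def by blast
    then obtain i j where ij: "i \<le> n" "j \<le> n" "i < j" "p i \<noteq> 0" "p j \<noteq> 0"
      "unit ((ev w (p i) * a ^ i) / (ev w (p j) * a ^ j))"
      unfolding Q_def by blast
    obtain l u where u: "unit u" "ev w (p i) = w ^ l * u"
      using ev_eq_power_times_unit[OF ij(4)] by blast
    obtain l' u' where u': "unit u'" "ev w (p j) = w ^ l' * u'"
      using ev_eq_power_times_unit[OF ij(5)] by blast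
    define s where "s = j - i"
    have s: "s > 0" "s \<le> n" using ij by (auto simp: s_def)
    have "(ev w (p i) * a ^ i) / (ev w (p j) * a ^ j) = (u / u') * inverse (a ^ s * w powi (int l' - int l))"
      using a w_nonzero u u' ij by (simp add: s_def power_diff power_int_diff field_simps unit_def)
    then have "unit ((u / u') * inverse (a ^ s * w powi (int l' - int l)))" using ij by simp
    moreover have uu: "unit (u / u')" using unit_mult[OF u(1) unit_inverse[OF u'(1)]] by (simp add: divide_inverse)
    ultimately have "unit (inverse (u / u') * ((u / u') * inverse (a ^ s * w powi (int l' - int l))))"
      by (intro unit_mult[OF unit_inverse[OF uu]])
    moreover have "inverse (u / u') * ((u / u') * z) = z" for z
      using uu by (simp add: unit_def field_simps)
    ultimately have "unit (inverse (a ^ s * w powi (int l' - int l)))" by (simp only:)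
    from unit_inverse[OF this] have 1: "unit (a ^ s * w powi (int l' - int l))" by simp
    have "s dvd fact n" using s by (simp add: dvd_fact)
    then obtain e where e: "fact n = s * e" by blast
    have "(a ^ s * w powi (int l' - int l)) ^ e = a ^ fact n * w powi ((int l' - int l) * int e)"
      by (simp add: e power_mult_distrib power_int_mult flip: power_mult)
    then show ?thesis using unit_power[OF 1, of e] by auto
  qed
  then show ?thesis by (intro exI[of _ "fact n"]) simp
qed

text \<open>
  With the common exponent \<open>E\<close>, the integer \<open>v a\<close> for which \<open>a^E\<close> is \<open>w^(v a)\<close> times a unit is \<open>E\<close> times
  the order of \<open>a\<close> measured in units of the order of \<open>w\<close>.
\<close>
lemma place_of_maximal_subring: "\<exists>P\<in>points. P w > 0"
proof -
  obtain E :: nat where E': "E > 0 \<and> (\<forall>a. a \<noteq> 0 \<longrightarrow> (\<exists>k. unit (a ^ E * w powi k)))"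
    using common_exponent by (rule exE)
  then have E: "E > 0" "\<And>a. a \<noteq> 0 \<Longrightarrow> \<exists>k. unit (a ^ E * w powi k)" by simp_all
  define v where "v a = (SOME k. unit (a ^ E * w powi (- k)))" for a
  have v: "unit (a ^ E * w powi (- v a))" if a: "a \<noteq> 0" for a
  proof -
    obtain k where "unit (a ^ E * w powi k)" using E(2)[OF a] by (rule exE)
    then have "\<exists>k. unit (a ^ E * w powi (- k))" by (intro exI[of _ "- k"]) simp
    then show ?thesis unfolding v_def by (rule someI_ex)
  qed
  have powi_unit: "k = 0" if "unit (w powi k)" for k
  proof (rule ccontr)
    assume "k \<noteq> 0"
    have "unit (w ^ nat \<bar>k\<bar>)"
      using that unit_inverse[OF that] by (cases "k \<ge> 0") (auto simp: power_int_def power_inverse)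
    then show False using not_unit_w_power[of "nat \<bar>k\<bar>"] \<open>k \<noteq> 0\<close> by simp
  qed
  have v_unique: "v a = k" if "a \<noteq> 0" "unit (a ^ E * w powi (- k))" for a k
  proof -
    have "unit ((a ^ E * w powi (- k)) * inverse (a ^ E * w powi (- v a)))"
      by (rule unit_mult[OF that(2) unit_inverse[OF v[OF that(1)]]])
    also have "(a ^ E * w powi (- k)) * inverse (a ^ E * w powi (- v a)) = w powi (v a - k)"
      using that(1) w_nonzero by (simp add: power_int_minus power_int_diff field_simps)
    finally show ?thesis using powi_unit[of "v a - k"] by simp
  qed
  have v_nonneg: "v a \<ge> 0" if "a \<noteq> 0" "a \<in> M" for a
  proof (rule ccontr)
    assume neg: "\<not> v a \<ge> 0"
    then have "w powi (- v a) = w ^ nat (- v a)" by (simp add: power_int_def)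
    then have "unit (w ^ nat (- v a) * a ^ E)" using v[OF that(1)] by (simp add: mult.commute)
    then have "unit (w ^ nat (- v a))" 
      by (rule unit_factor[OF M_rules(7)[OF M(2)] M_rules(7)[OF that(2)]])
    then show False using not_unit_w_power[of "nat (- v a)"] neg by simp
  qed
  have v_mult: "v (f * g) = v f + v g" if "f \<noteq> 0" "g \<noteq> 0" for f g
  proof (rule v_unique)
    have "unit ((f ^ E * w powi (- v f)) * (g ^ E * w powi (- v g)))" by (rule unit_mult[OF v[OF that(1)] v[OF that(2)]])
    then show "unit ((f * g) ^ E * w powi - (v f + v g))"
      using w_nonzero by (simp add: power_mult_distrib power_int_add power_int_diff power_int_minus field_simps)
  qed (use that in auto)
  have v_in_M: "a \<in> M" if "a \<noteq> 0" "v a \<ge> 0" for a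
  proof (rule ccontr)
    assume a: "a \<notin> M"
    then have a': "inverse a \<in> M" using valuation_ring that by blast
    have "v 1 = 0" using v_mult[of 1 1] by simp
    then have "v (inverse a) = - v a" using v_mult[of a "inverse a"] that by simp
    moreover have "v (inverse a) \<ge> 0" using v_nonneg[of "inverse a"] a' that by simp
    ultimately have "v (inverse a) = 0" using that by simp
    then have "unit (inverse a ^ E)" using v[of "inverse a"] that by simp
    then have "unit (inverse a * inverse a ^ (E - 1))" using E by (cases E) auto
    then have "unit (inverse a)" 
      by (rule unit_factor[OF a' M_rules(7)[OF a']])
    then show False using a by (simp add: unit_def)
  qed
  show ?thesis
  proof (rule place_of_order_function[of v])
    fix f g :: 'f assume fg: "f \<noteq> 0" "g \<noteq> 0" "f + g \<noteq> 0"
    have *: "v (a + b) \<ge> v a" if "a \<noteq> 0" "b \<noteq> 0" "a + b \<noteq> 0" "v a \<le> v b" for a b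
    proof -
      have "v b = v a + v (b / a)" using v_mult[of a "b / a"] that by simp
      then have "b / a \<in> M" using v_in_M[of "b / a"] that by simp
      then have "1 + b / a \<in> M" by (intro M_rules)
      moreover have ne: "1 + b / a \<noteq> 0" using that by (simp add: field_simps)
      ultimately have "v (1 + b / a) \<ge> 0" by (intro v_nonneg)
      moreover have "a + b = a * (1 + b / a)" using that by (simp add: field_simps)
      ultimately show ?thesis using v_mult[of a "1 + b / a"] that ne by simp
    qed
    show "min (v f) (v g) \<le> v (f + g)"
      using *[of f g] *[of g f] fg by (auto simp: min_def add.commute)
  next
    fix c :: 'k assume "c \<noteq> 0"
    then show "v (emb c) = 0" using unit_power[OF unit_emb, of c E] by (intro v_unique) auto
  next
    have "v w = int E"
    proof (rule v_unique)
      have "w ^ E * w powi (- int E) = 1" using w_nonzero by (simp add: power_int_minus)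
      then show "unit (w ^ E * w powi (- int E))" using unit_emb[of 1] by simp
    qed (rule w_nonzero)
    then show "v w > 0" using E by simp
  qed (use v_mult w_nonzero in auto)
qed

end

theorem zero_exists:
  assumes "transcendental_over emb w"
  shows "\<exists>P\<in>points. P w > 0"
  using maximal_subring_without_inverse[OF assms] place_of_maximal_subring[OF assms] by metis

text \<open>
  A pole of \<open>f\<close> is a zero of \<open>1/f\<close>.
\<close>
lemma pole_exists:
  assumes "\<And>c. f \<noteq> emb c"
  shows "\<exists>P\<in>points. P f < 0"
proof -
  have f0: "f \<noteq> 0" using assms[of 0] by simp
  have "transcendental_over emb (inverse f)"
    unfolding transcendental_over_def
  proof (intro allI impI notI)
    fix p :: "'k poly" assume "p \<noteq> 0" "poly (map_poly emb p) (inverse f) = 0"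
    then obtain c where "inverse f = emb c" using algebraic_imp_const[of p "inverse f"] by (auto simp: ev_def)
    then have "f = emb (inverse c)" by (metis hom_inverse inverse_inverse_eq)
    then show False using assms by blast
  qed
  then obtain P where "P \<in> points" "P (inverse f) > 0" using zero_exists by blast
  then show ?thesis using val_inverse[of P f] by auto
qed

section \<open>Approximation and Riemann-Roch spaces\<close>

text \<open>
  If every function regular at \<open>P\<close> were regular at \<open>Q\<close>, units at \<open>P\<close> would be units at \<open>Q\<close>, and the
  order at \<open>Q\<close> would be a multiple of the order at \<open>P\<close>; both are onto the integers, so they would
  coincide.
\<close>
lemma places_incomparable:
  assumes P: "P \<in> points" and Q: "Q \<in> points" and "P \<noteq> Q"
  shows "\<exists>f. f \<noteq> 0 \<and> P f \<ge> 0 \<and> Q f < 0"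
proof (rule ccontr)
  assume "\<not> ?thesis"
  then have ge: "Q f \<ge> 0" if "f \<noteq> 0" "P f \<ge> 0" for f using that by force
  have unit: "Q f = 0" if "f \<noteq> 0" "P f = 0" for f
    using ge[of f] ge[of "inverse f"] that by (auto simp: val_inverse[OF P] val_inverse[OF Q])
  obtain t where t: "t \<noteq> 0" "P t = 1" using uniformizer_exists[OF P] by blast
  obtain s where s: "s \<noteq> 0" "Q s = 1" using uniformizer_exists[OF Q] by blast
  have mult: "Q f = P f * Q t" if f: "f \<noteq> 0" for f
  proof -
    have "Q (f * t powi (- P f)) = 0"
      using f t by (intro unit) (auto simp: val_mult[OF P] val_powi[OF P])
    then show ?thesis using f t by (simp add: val_mult[OF Q] val_powi[OF Q])
  qed
  have "Q t dvd 1" using mult[OF s(1)] s(2) by (metis dvd_triv_right)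
  then have "Q t = 1" using ge[of t] t by (simp add: zdvd1_eq)
  then have "Q f = P f" for f
    using mult[of f] val_0[OF P] val_0[OF Q] by (cases "f = 0") simp_all
  then have "P = Q" by (intro ext) simp
  then show False using assms(3) by simp
qed

lemma separate_two_places:
  assumes P: "P \<in> points" and Q: "Q \<in> points" and "P \<noteq> Q"
  shows "\<exists>z. z \<noteq> 0 \<and> P z > 0 \<and> Q z < 0"
proof -
  obtain f where f: "f \<noteq> 0" "P f \<ge> 0" "Q f < 0" using places_incomparable assms by blast
  obtain h where h: "h \<noteq> 0" "Q h \<ge> 0" "P h < 0" using places_incomparable[of Q P] assms by blast
  show ?thesis
    using f h by (intro exI[of _ "f / h"]) (auto simp: val_divide[OF P] val_divide[OF Q])
qed

text \<open>
  Induction on \<open>T\<close>: if \<open>f\<close> has no pole at the new point, a high power of a function that separates \<open>P\<close>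
  from it is added.
\<close>
lemma separate_places:
  assumes "finite T" "T \<subseteq> points" and P: "P \<in> points" "P \<notin> T"
  shows "\<exists>f. f \<noteq> 0 \<and> P f > 0 \<and> (\<forall>Q\<in>T. Q f < 0)"
  using assms(1,2,4)
proof (induction T)
  case empty
  then show ?case using uniformizer_exists[OF P(1)] by force
next
  case (insert R T)
  then obtain f where f: "f \<noteq> 0" "P f > 0" "\<forall>Q\<in>T. Q f < 0" by auto
  have R: "R \<in> points" using insert by auto
  obtain z where z: "z \<noteq> 0" "P z > 0" "R z < 0"
    using separate_two_places[OF P(1) R] insert by auto
  show ?case
  proof (cases "R f < 0")
    case True
    then show ?thesis using f by auto
  next
    case False
    \<comment> \<open>so large that \<open>f\<close> and \<open>z^m\<close> never have the same order at a point of \<open>T\<close>\<close>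
    define m where "m = nat (1 + (\<Sum>Q\<in>T. \<bar>Q f\<bar>))"
    have m: "int m > \<bar>Q f\<bar>" if "Q \<in> T" for Q
    proof -
      have "\<bar>Q f\<bar> \<le> (\<Sum>Q\<in>T. \<bar>Q f\<bar>)" using that insert(1) by (intro member_le_sum) auto
      then show ?thesis by (simp add: m_def)
    qed
    have m1: "int m \<ge> 1" by (simp add: m_def sum_nonneg)
    have nz: "z ^ m \<noteq> 0" using z by simp
    have "R (z ^ m) < 0" using z m1 by (simp add: val_power[OF R] mult_pos_neg)
    then have 1: "f + z ^ m \<noteq> 0 \<and> R (f + z ^ m) < 0"
      using val_add_neq[OF R f(1) nz] False by auto
    have "Q (f + z ^ m) < 0" if Q: "Q \<in> T" for Q
    proof -
      have Qp: "Q \<in> points" using Q insert by auto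
      have Qz: "Q (z ^ m) = int m * Q z" by (rule val_power[OF Qp z(1)])
      have "Q (z ^ m) \<noteq> Q f"
      proof (cases "Q z = 0")
        case True
        then show ?thesis using Qz f(3) Q by auto
      next
        case False
        then have "int m * 1 \<le> int m * \<bar>Q z\<bar>" by (intro mult_left_mono) auto
        then have "\<bar>Q (z ^ m)\<bar> \<ge> int m" unfolding Qz by (simp add: abs_mult)
        then show ?thesis using m[OF Q] by auto
      qed
      then show ?thesis using val_add_neq[OF Qp f(1) nz] f(3) Q by auto
    qed
    moreover have "P (f + z ^ m) > 0"
    proof -
      have "P (z ^ m) \<ge> 1" using z m1 by (simp add: val_power[OF P(1)] int_one_le_iff_zero_less)
      then have "zo P (f + z ^ m) 1" using f by (intro zo_add[OF P(1)]) (auto simp: zero_of_order_at_least_def)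
      then show ?thesis using 1 by (simp add: zero_of_order_at_least_def)
    qed
    ultimately show ?thesis using 1 by auto
  qed
qed

text \<open>
  The weak approximation that is needed: prescribed order at \<open>P\<close>, high order at the other points.
  If \<open>f\<close> vanishes at \<open>P\<close> and has poles on \<open>T\<close>, then \<open>1/(1 + f)\<close> is a unit at \<open>P\<close> and vanishes on \<open>T\<close>.
\<close>
lemma local_function_exists:
  assumes T: "finite T" "T \<subseteq> points" and P: "P \<in> points" "P \<notin> T"
  shows "\<exists>w. w \<noteq> 0 \<and> P w = int j \<and> (\<forall>Q\<in>T. Q w \<ge> E Q)"
proof -
  obtain f where f: "f \<noteq> 0" "P f > 0" "\<forall>Q\<in>T. Q f < 0" using separate_places assms by blast
  obtain u where u: "u \<noteq> 0" "P u = 1" using uniformizer_exists[OF P(1)] by blast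
  define e where "e = inverse (1 + f)"
  have "1 + f \<noteq> 0" "P (1 + f) = 0"
    using val_add_dominant[OF P(1), of 1 f] f by (auto simp: val_1[OF P(1)] zero_of_order_at_least_def)
  then have e: "e \<noteq> 0" "P e = 0" by (auto simp: e_def val_inverse[OF P(1)])
  have eQ: "Q e \<ge> 1" if "Q \<in> T" for Q
  proof -
    have Qp: "Q \<in> points" using that T by auto
    have "Q (f + 1) = Q f"
      using val_add_dominant(2)[OF Qp f(1), of 1] f(3) that by (auto simp: val_1[OF Qp] zero_of_order_at_least_def)
    moreover have "Q f < 0" using f(3) that by blast
    ultimately show ?thesis by (simp add: e_def val_inverse[OF Qp] add.commute)
  qed
  \<comment> \<open>the power of \<open>e\<close> reaches the orders \<open>E\<close> and compensates possible poles of \<open>u^j\<close>\<close>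
  define n where "n = nat (\<Sum>Q\<in>T. \<bar>E Q\<bar> + int j * \<bar>Q u\<bar>)"
  have "Q (e ^ n * u ^ j) \<ge> E Q" if Q: "Q \<in> T" for Q
  proof -
    have Qp: "Q \<in> points" using that T by auto
    have "\<bar>E Q\<bar> + int j * \<bar>Q u\<bar> \<le> (\<Sum>Q\<in>T. \<bar>E Q\<bar> + int j * \<bar>Q u\<bar>)"
      using Q T(1) by (intro member_le_sum[of Q T "\<lambda>Q. \<bar>E Q\<bar> + int j * \<bar>Q u\<bar>"]) auto
    then have "\<bar>E Q\<bar> + int j * \<bar>Q u\<bar> \<le> int n" by (simp add: n_def)
    also have "int n \<le> int n * Q e" using eQ[OF Q] by (simp add: mult_le_cancel_left1)
    finally have "E Q \<le> int n * Q e - \<bar>int j * Q u\<bar>" by (simp add: abs_mult)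
    then show ?thesis
      using e u by (simp add: val_mult[OF Qp] val_power[OF Qp])
  qed
  moreover have "P (e ^ n * u ^ j) = int j"
    using e u by (simp add: val_mult[OF P(1)] val_power[OF P(1)])
  ultimately show ?thesis using e u by (intro exI[of _ "e ^ n * u ^ j"]) auto
qed

lemma riemann_roch_space_iff:
  "f \<in> riemann_roch_space A \<longleftrightarrow> (\<forall>P\<in>points. zo P f (- A P))"
  by (auto simp: riemann_roch_space_def zero_of_order_at_least_def)

lemma subspace_riemann_roch_space: "vs.subspace (riemann_roch_space A)"
proof (rule vs.subspaceI)
  fix c f assume f: "f \<in> riemann_roch_space A"
  have "zo P (emb c * f) (0 + - A P)" if "P \<in> points" for P
    using f that by (intro zo_mult zo_emb) (auto simp: riemann_roch_space_iff)
  then show "emb c * f \<in> riemann_roch_space A" by (simp add: riemann_roch_space_iff)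
qed (auto simp: riemann_roch_space_iff zo_add)

text \<open>
  Two functions of the same order at \<open>P\<close> differ by a constant factor up to higher order, because
  points are rational.
\<close>
lemma riemann_roch_space_step:
  assumes P: "P \<in> points"
  obtains f where "\<And>h. h \<in> riemann_roch_space (\<lambda>Q. A Q + point_div P Q) \<Longrightarrow>
    \<exists>c. h - emb c * f \<in> riemann_roch_space A"
proof (cases "riemann_roch_space (\<lambda>Q. A Q + point_div P Q) \<subseteq> riemann_roch_space A")
  case True
  then show ?thesis by (intro that[of 0]) auto
next
  case False
  let ?L = "riemann_roch_space (\<lambda>Q. A Q + point_div P Q)"
  obtain f where f: "f \<in> ?L" "f \<notin> riemann_roch_space A" using False by blast
  have other: "zo Q h (- A Q)" if "h \<in> ?L" "Q \<in> points" "Q \<noteq> P" for h Q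
    using that by (auto simp: riemann_roch_space_iff point_div_def)
  have f0: "f \<noteq> 0" "P f = - A P - 1"
  proof -
    have "\<not> zo P f (- A P)" using f other by (auto simp: riemann_roch_space_iff)
    moreover have "zo P f (- A P - 1)" using f P by (auto simp: riemann_roch_space_iff point_div_def algebra_simps)
    ultimately show "f \<noteq> 0" "P f = - A P - 1" by (auto simp: zero_of_order_at_least_def)
  qed
  show ?thesis
  proof (rule that[of f])
    fix h assume h: "h \<in> ?L"
    have h1: "zo P h (- A P - 1)" using h P by (auto simp: riemann_roch_space_iff point_div_def algebra_simps)
    have "zo P (h / f) 0"
      using h1 f0 by (cases "h = 0") (auto simp: zero_of_order_at_least_def val_divide[OF P])
    then obtain c where c: "zo P (h / f - emb c) 1" using residue_exists[OF P] by blast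
    have "zo P ((h / f - emb c) * f) (1 + (- A P - 1))"
      using f0 by (intro zo_mult[OF P] c) (simp add: zero_of_order_at_least_def)
    then have *: "zo P (h - emb c * f) (- A P)" using f0 by (simp add: algebra_simps)
    have "h - emb c * f \<in> ?L"
      using h f(1) subspace_riemann_roch_space by (intro vs.subspace_diff vs.subspace_scale) auto
    with * other have "h - emb c * f \<in> riemann_roch_space A" by (auto simp: riemann_roch_space_iff)
    then show "\<exists>c. h - emb c * f \<in> riemann_roch_space A" by blast
  qed
qed

lemma riemann_roch_space_add_point:
  assumes P: "P \<in> points" and "finite S" "riemann_roch_space A \<subseteq> vs.span S"
  shows "\<exists>S'. finite S' \<and> card S' \<le> card S + 1 \<and>
    riemann_roch_space (\<lambda>Q. A Q + point_div P Q) \<subseteq> vs.span S'"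
proof -
  obtain f where f: "\<And>h. h \<in> riemann_roch_space (\<lambda>Q. A Q + point_div P Q) \<Longrightarrow>
    \<exists>c. h - emb c * f \<in> riemann_roch_space A" using riemann_roch_space_step[OF P] by blast
  have "riemann_roch_space (\<lambda>Q. A Q + point_div P Q) \<subseteq> vs.span (insert f S)"
    using f assms(3) by (auto simp: vs.span_insert)
  then show ?thesis using assms(2) by (intro exI[of _ "insert f S"]) (auto simp: card_insert_if)
qed

lemma zo_all_positive_imp_0:
  assumes P: "P \<in> points" "zo P f 1" and "\<And>Q. Q \<in> points \<Longrightarrow> zo Q f 0"
  shows "f = 0"
proof (rule ccontr)
  assume f: "f \<noteq> 0"
  have "\<not> (\<exists>Q\<in>points. Q f < 0)" using assms(3) f by (force simp: zero_of_order_at_least_def)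
  then obtain c where "f = emb c" using pole_exists[of f] by auto
  then show False using P f by (auto simp: zero_of_order_at_least_def val_emb)
qed

text \<open>
  The chain of spaces starts, at \<open>-[P]\<close>, with the zero space: a function without poles is constant.
\<close>
lemma pole_space_span:
  assumes P: "P \<in> points"
  shows "\<exists>S. finite S \<and> card S \<le> M + 1 \<and> riemann_roch_space (\<lambda>Q. int M * point_div P Q) \<subseteq> vs.span S"
proof (induction M)
  case 0
  have "riemann_roch_space (\<lambda>Q. - point_div P Q) \<subseteq> {0}"
  proof
    fix f assume f: "f \<in> riemann_roch_space (\<lambda>Q. - point_div P Q)"
    have "f = 0"
    proof (rule zo_all_positive_imp_0[OF P])
      show "zo P f 1" using f P by (auto simp: riemann_roch_space_iff point_div_def)
      fix Q assume Q: "Q \<in> points"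
      then have "zo Q f (point_div P Q)" using f by (auto simp: riemann_roch_space_iff)
      then show "zo Q f 0" by (rule zo_mono[OF Q]) (simp add: point_div_def)
    qed
    then show "f \<in> {0}" by simp
  qed
  then have "riemann_roch_space (\<lambda>Q. - point_div P Q) \<subseteq> vs.span {}" by simp
  from riemann_roch_space_add_point[OF P _ this] show ?case by auto
next
  case (Suc M)
  then obtain S where S: "finite S" "card S \<le> M + 1"
    "riemann_roch_space (\<lambda>Q. int M * point_div P Q) \<subseteq> vs.span S" by blast
  have "(\<lambda>Q. int (Suc M) * point_div P Q) = (\<lambda>Q. int M * point_div P Q + point_div P Q)"
    by (auto simp: algebra_simps)
  then show ?case using riemann_roch_space_add_point[OF P S(1,3)] S(2) by (metis add_le_mono1 add_Suc_right Suc_eq_plus1 order_trans)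
qed

lemma regular_away_iff: "regular_away Q f \<longleftrightarrow> (\<forall>P\<in>points - {Q}. zo P f 0)"
  by (auto simp: regular_away_def zero_of_order_at_least_def)

lemma pole_space_iff:
  assumes "P \<in> points"
  shows "f \<in> riemann_roch_space (\<lambda>Q. int M * point_div P Q) \<longleftrightarrow> regular_away P f \<and> zo P f (- int M)"
  using assms by (auto simp: riemann_roch_space_iff regular_away_iff point_div_def)

context
  fixes infty :: "'f place" and x :: 'f and d :: nat
  assumes infty: "infty \<in> points"
    and x: "regular_away infty x" "infty x = - int d" and d: "d > 0"
begin

lemma regular_away_mult: "regular_away infty f \<Longrightarrow> regular_away infty g \<Longrightarrow> regular_away infty (f * g)"
  by (auto simp: regular_away_iff zo_mult_0)

lemma regular_away_power: "regular_away infty f \<Longrightarrow> regular_away infty (f ^ n)"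
  by (auto simp: regular_away_iff zo_power_0)

lemma regular_away_ev: "regular_away infty (ev x p)"
  using x by (auto simp: regular_away_iff zo_ev)

lemma x_pole: "infty x < 0" using x d by simp

lemma ev_x_nonzero: "p \<noteq> 0 \<Longrightarrow> ev x p \<noteq> 0"
  using ev_nonzero_of_val[OF infty] x_pole by simp

lemma val_ev_x: "p \<noteq> 0 \<Longrightarrow> infty (ev x p) = - int (d * degree p)"
  using val_ev_pole[OF infty x_pole] x by simp

lemma x_minus_const:
  shows "x - emb c \<noteq> 0" "infty (x - emb c) = - int d" "regular_away infty (x - emb c)"
proof -
  show 1: "infty (x - emb c) = - int d"
  proof -
    have "infty (x + emb (- c)) = infty x"
      using x d val_0[OF infty]
      by (intro val_add_dominant(2)[OF infty]) (auto simp: zero_of_order_at_least_def val_emb[OF infty])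
    then show ?thesis using x by (simp add: hom_uminus)
  qed
  then show "x - emb c \<noteq> 0" using d val_0[OF infty] by auto
  show "regular_away infty (x - emb c)"
    using x by (auto simp: regular_away_iff intro!: zo_diff zo_emb)
qed

text \<open>
  The leading coefficient of an algebraic equation for \<open>b\<close> over \<open>k[x]\<close> makes \<open>b\<close> integral over \<open>k[x]\<close>,
  and an element that is integral over \<open>k[x]\<close> is regular wherever \<open>x\<close> is.
\<close>
lemma denominator_exists: "\<exists>a. a \<noteq> 0 \<and> regular_away infty (ev x a * b)"
proof -
  obtain n p where p: "\<exists>j\<le>n. p j \<noteq> 0" "(\<Sum>j\<le>n. ev x (p j) * b ^ j) = 0"
    using algebraically_dependent[of x b] by auto
  define m where "m = Max {j \<in> {..n}. p j \<noteq> 0}"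
  have fin: "finite {j \<in> {..n}. p j \<noteq> 0}" "{j \<in> {..n}. p j \<noteq> 0} \<noteq> {}" using p(1) by auto
  have m: "m \<le> n" "p m \<noteq> 0" using Max_in[OF fin] by (auto simp: m_def)
  have m_max: "p j = 0" if "j \<le> n" "j > m" for j
  proof (rule ccontr)
    assume "p j \<noteq> 0"
    then have "j \<le> m" unfolding m_def using that by (intro Max_ge fin) auto
    then show False using that by simp
  qed
  have "(\<Sum>j\<le>m. ev x (p j) * b ^ j) = (\<Sum>j\<le>n. ev x (p j) * b ^ j)"
    using m m_max by (intro sum.mono_neutral_left) auto
  then have rel: "(\<Sum>j\<le>m. ev x (p j) * b ^ j) = 0" using p(2) by simp
  define c where "c = ev x (p m) * b"
  have "zo P c 0" if "P \<in> points" "P \<noteq> infty" for P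
  proof (rule ccontr)
    note P = that(1)
    assume "\<not> zo P c 0"
    then have c: "c \<noteq> 0" "P c < 0" by (auto simp: zero_of_order_at_least_def)
    have xP: "zo P (ev x q) 0" for q using regular_away_ev that by (auto simp: regular_away_iff)
    have m0: "m > 0"
    proof (rule ccontr)
      assume "\<not> m > 0"
      then have "ev x (p 0) = 0" using rel by simp
      then show False using ev_x_nonzero[of "p m"] m \<open>\<not> m > 0\<close> by simp
    qed
    have term_eq: "ev x (p m) ^ (m - 1) * (ev x (p j) * b ^ j) = ev x (p m ^ (m - 1 - j) * p j) * c ^ j" if "j < m" for j
    proof -
      have "ev x (p m) ^ (m - 1) = ev x (p m) ^ (m - 1 - j) * ev x (p m) ^ j"
        using that by (simp flip: power_add)
      then show ?thesis by (simp add: c_def ev.hom_mult ev.hom_power power_mult_distrib mult_ac)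
    qed
    have "0 = ev x (p m) ^ (m - 1) * (\<Sum>j\<le>m. ev x (p j) * b ^ j)" by (simp add: rel)
    also have "\<dots> = (\<Sum>j<m. ev x (p m) ^ (m - 1) * (ev x (p j) * b ^ j)) + ev x (p m) ^ (m - 1) * (ev x (p m) * b ^ m)"
      by (simp add: sum_distrib_left distrib_left flip: lessThan_Suc_atMost)
    also have "ev x (p m) ^ (m - 1) * (ev x (p m) * b ^ m) = c ^ m"
      using m0 by (cases m) (auto simp: c_def power_mult_distrib mult_ac)
    also have "(\<Sum>j<m. ev x (p m) ^ (m - 1) * (ev x (p j) * b ^ j)) = (\<Sum>j<m. ev x (p m ^ (m - 1 - j) * p j) * c ^ j)"
      using term_eq by (intro sum.cong) auto
    finally have eq: "c ^ m = - (\<Sum>j<m. ev x (p m ^ (m - 1 - j) * p j) * c ^ j)"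
      by (simp add: eq_neg_iff_add_eq_0 add.commute)
    have "zo P (c ^ m) (int (m - 1) * P c)"
      unfolding eq zo_uminus[OF P]
    proof (rule zo_sum[OF P])
      fix j assume "j \<in> {..<m}"
      then have "int (m - 1) * P c \<le> 0 + P (c ^ j)"
        using c by (auto simp: val_power[OF P] mult_le_cancel_right)
      moreover have "zo P (ev x (p m ^ (m - 1 - j) * p j) * c ^ j) (0 + P (c ^ j))"
        by (intro zo_mult[OF P] xP) (simp add: zero_of_order_at_least_def)
      ultimately show "zo P (ev x (p m ^ (m - 1 - j) * p j) * c ^ j) (int (m - 1) * P c)"
        by (rule zo_mono[OF P, rotated])
    qed
    then show False using c m0 by (auto simp: zero_of_order_at_least_def val_power[OF P] mult_le_cancel_right)
  qed
  then show ?thesis using m unfolding c_def by (intro exI[of _ "p m"]) (auto simp: regular_away_iff)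
qed

lemma common_denominator_exists:
  assumes "finite I"
  shows "\<exists>a. a \<noteq> 0 \<and> (\<forall>i\<in>I. regular_away infty (ev x a * w i))"
  using assms
proof induction
  case empty
  show ?case by (intro exI[of _ 1]) auto
next
  case (insert i I)
  then obtain a where a: "a \<noteq> 0" "\<forall>i\<in>I. regular_away infty (ev x a * w i)" by blast
  obtain b where b: "b \<noteq> 0" "regular_away infty (ev x b * w i)" using denominator_exists by blast
  have "regular_away infty (ev x (a * b) * w j)" if "j \<in> insert i I" for j
    using that a(2) b(2) regular_away_mult[OF regular_away_ev[of a], of "ev x b * w i"]
      regular_away_mult[OF regular_away_ev[of b], of "ev x a * w j"]
    by (auto simp: ev.hom_mult mult_ac)
  then show ?case using a b by (intro exI[of _ "a * b"]) auto
qed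

text \<open>
  The field has degree at most \<open>d\<close> over \<open>k(x)\<close>.  More than \<open>d\<close> independent elements, made regular
  outside \<open>infty\<close> and multiplied by \<open>1, x, \<dots>, x^(L - 1)\<close>, would give at least \<open>(d + 1) L\<close> independent
  functions with pole order at most \<open>B + d L\<close>, which is too many for large \<open>L\<close>.
\<close>
lemma rank_le:
  assumes I: "finite I"
    and indep: "\<And>p. (\<Sum>i\<in>I. ev x (p i) * w i) = 0 \<Longrightarrow> \<forall>i\<in>I. p i = 0"
  shows "card I \<le> d"
proof (rule ccontr)
  assume "\<not> card I \<le> d"
  then have card: "card I \<ge> d + 1" by simp
  obtain a where a: "a \<noteq> 0" "\<forall>i\<in>I. regular_away infty (ev x a * w i)"
    using common_denominator_exists[OF I] by blast
  define B where "B = (\<Sum>i\<in>I. nat \<bar>infty (ev x a * w i)\<bar>)"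
  \<comment> \<open>the least \<open>L\<close> with \<open>(d + 1) L > B + d L + 1\<close>\<close>
  define L where "L = B + 2"
  define F where "F = (\<lambda>(i, l). x ^ l * (ev x a * w i))"
  define M where "M = B + d * L"
  have F: "F (i, l) \<in> riemann_roch_space (\<lambda>Q. int M * point_div infty Q)" if "i \<in> I" "l < L" for i l
  proof -
    have x0: "x \<noteq> 0" using x_pole val_0[OF infty] by auto
    have "nat \<bar>infty (ev x a * w i)\<bar> \<le> B"
      unfolding B_def using that I by (intro member_le_sum) auto
    then have "zo infty (ev x a * w i) (- int B)" by (auto simp: zero_of_order_at_least_def)
    moreover have "zo infty (x ^ l) (- int (d * L))"
    proof -
      have "int d * int l \<le> int d * int L" using that by (intro mult_left_mono) auto
      then show ?thesis using x x0 by (simp add: zero_of_order_at_least_def val_power[OF infty] mult.commute[of "int l"])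
    qed
    ultimately have "zo infty (F (i, l)) (- int (d * L) + - int B)"
      unfolding F_def prod.case by (rule zo_mult[OF infty, rotated])
    moreover have "regular_away infty (F (i, l))"
      unfolding F_def using a(2) that x by (auto intro: regular_away_mult regular_away_power)
    moreover have "- int (d * L) + - int B = - int M" by (simp add: M_def)
    ultimately show ?thesis unfolding pole_space_iff[OF infty] by simp
  qed
  obtain S where S: "finite S" "card S \<le> M + 1"
    "riemann_roch_space (\<lambda>Q. int M * point_div infty Q) \<subseteq> vs.span S"
    using pole_space_span[OF infty] by blast
  have sub: "F ` (I \<times> {..<L}) \<subseteq> vs.span S" using F S(3) by auto
  have "card S < (d + 1) * L" using S(2) by (simp add: M_def L_def algebra_simps)
  also have "\<dots> \<le> card (I \<times> {..<L})" using mult_le_mono1[OF card, of L] by (simp add: card_cartesian_product)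
  finally obtain u where u: "\<exists>i\<in>I \<times> {..<L}. u i \<noteq> 0" "(\<Sum>i\<in>I \<times> {..<L}. emb (u i) * F i) = 0"
    using vs.family_dependent[OF _ S(1) sub] I by auto
  define p where "p i = (\<Sum>l<L. monom (u (i, l)) l)" for i
  have cp: "coeff (p i) l = u (i, l)" if "l < L" for i l
    using that by (simp add: p_def coeff_sum)
  have "(\<Sum>i\<in>I \<times> {..<L}. emb (u i) * F i) = (\<Sum>i\<in>I. \<Sum>l<L. emb (u (i, l)) * F (i, l))"
    by (simp add: sum.cartesian_product)
  also have "\<dots> = ev x a * (\<Sum>i\<in>I. ev x (p i) * w i)"
    by (simp add: F_def p_def ev.hom_sum sum_distrib_left sum_distrib_right mult_ac)
  finally have "(\<Sum>i\<in>I. ev x (p i) * w i) = 0" using u(2) ev_x_nonzero[OF a(1)] by simp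
  then have p0: "\<forall>i\<in>I. p i = 0" by (rule indep)
  obtain i l where "i \<in> I" "l < L" "u (i, l) \<noteq> 0" using u(1) by auto
  then show False using p0 cp[of l i] by auto
qed

text \<open>
  For each zero \<open>P\<close> of \<open>x\<close> and each \<open>j\<close> below its multiplicity choose a function of order \<open>j\<close> at \<open>P\<close>
  that vanishes at the other zeros at least as much as \<open>x\<close>.  A primitive relation over \<open>k[x]\<close> between
  these functions has, at a zero \<open>P\<close> that occurs in its reduction modulo \<open>x\<close>, a unique term of least
  order.  So they are independent, and \<open>rank_le\<close> applies.
\<close>
lemma zeros_of_x_le:
  assumes T: "finite T" "T \<subseteq> points" and pos: "\<And>P. P \<in> T \<Longrightarrow> P x > 0"
  shows "(\<Sum>P\<in>T. P x) \<le> int d"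
proof -
  define I where "I = Sigma T (\<lambda>P. {..<nat (P x)})"
  have I: "finite I" using T by (auto simp: I_def)
  define W where "W P j w \<longleftrightarrow> w \<noteq> 0 \<and> P w = int j \<and> (\<forall>Q\<in>T - {P}. Q w \<ge> Q x)" for P j w
  define w where "w = (\<lambda>(P, j). SOME w. W P j w)"
  have w: "w (P, j) \<noteq> 0 \<and> P (w (P, j)) = int j \<and> (\<forall>Q\<in>T - {P}. Q (w (P, j)) \<ge> Q x)" if "P \<in> T" for P j
  proof -
    have "\<exists>w. W P j w" unfolding W_def using T that by (intro local_function_exists) auto
    then have "W P j (w (P, j))" unfolding w_def prod.case by (rule someI_ex)
    then show ?thesis by (simp add: W_def)
  qed
  have "card I \<le> d"
  proof (rule rank_le[OF I, of w])
    fix p assume rel: "(\<Sum>i\<in>I. ev x (p i) * w i) = 0"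
    show "\<forall>i\<in>I. p i = 0"
    proof (rule ccontr)
      assume "\<not> (\<forall>i\<in>I. p i = 0)"
      then obtain a r where r: "\<forall>i\<in>I. p i = [:0, 1:] ^ a * r i" "\<exists>i\<in>I. coeff (r i) 0 \<noteq> 0"
        using common_factor_X[OF I, of p] by blast
      have "(\<Sum>i\<in>I. ev x (p i) * w i) = x ^ a * (\<Sum>i\<in>I. ev x (r i) * w i)"
        unfolding sum_distrib_left
        by (rule sum.cong) (use r(1) in \<open>auto simp: ev.hom_mult ev.hom_power simp del: mult_pCons_left\<close>)
      moreover have "x \<noteq> 0" using x_pole val_0[OF infty] by auto
      ultimately have rel': "(\<Sum>i\<in>I. ev x (r i) * w i) = 0" using rel by simp
      obtain P j0 where Pj0: "(P, j0) \<in> I" "coeff (r (P, j0)) 0 \<noteq> 0" using r(2) by auto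
      define j where "j = (LEAST j. (P, j) \<in> I \<and> coeff (r (P, j)) 0 \<noteq> 0)"
      have j: "(P, j) \<in> I" "coeff (r (P, j)) 0 \<noteq> 0"
        using LeastI[of "\<lambda>j. (P, j) \<in> I \<and> coeff (r (P, j)) 0 \<noteq> 0", OF conjI[OF Pj0]] by (auto simp: j_def)
      have j_min: "coeff (r (P, i)) 0 = 0" if "i < j" for i
      proof -
        have "(P, i) \<in> I" using j(1) that by (auto simp: I_def)
        then show ?thesis using not_less_Least[of i "\<lambda>j. (P, j) \<in> I \<and> coeff (r (P, j)) 0 \<noteq> 0"] that by (auto simp: j_def)
      qed
      have PT: "P \<in> T" "int j < P x" using j(1) by (auto simp: I_def)
      have P: "P \<in> points" using PT T by auto
      have xP: "zo P x 1" "zo P x (P x)" "zo P x 0" using pos[OF PT(1)] by (auto simp: zero_of_order_at_least_def)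
      have main: "ev x (r (P, j)) * w (P, j) \<noteq> 0" "P (ev x (r (P, j)) * w (P, j)) = int j"
        using val_ev_unit[OF P xP(1) j(2)] w[OF PT(1), of j] by (auto simp: val_mult[OF P])
      have dominated: "zo P (ev x (r i) * w i) (P (ev x (r (P, j)) * w (P, j)) + 1)"
        if i: "i \<in> I" "i \<noteq> (P, j)" for i
      proof -
        define Q l where "Q = fst i" and "l = snd i"
        have Ql: "i = (Q, l)" by (simp add: Q_def l_def)
        then have Q: "Q \<in> T" using i by (auto simp: I_def)
        show ?thesis
        proof (cases "Q = P")
          case False
          then have "zo P (w i) (P x)" using w[OF Q, of l] PT Ql by (auto simp: zero_of_order_at_least_def)
          from zo_mult[OF P zo_ev[OF P xP(3), of "r i"] this] show ?thesis
            unfolding main(2) by (rule zo_mono[OF P]) (use PT in simp)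
        next
          case True
          have wi: "zo P (w i) (int l)" using w[OF Q, of l] Ql True by (auto simp: zero_of_order_at_least_def)
          show ?thesis
          proof (cases "coeff (r i) 0 = 0")
            case False
            then have "l > j" using j_min[of l] i Ql True by (cases "l < j") (auto simp: not_less le_less)
            then show ?thesis
              using zo_mult[OF P zo_ev[OF P xP(3), of "r i"] wi] unfolding main(2)
              by (elim zo_mono[OF P]) simp
          next
            case True
            obtain c s where rs: "r i = pCons c s" by (cases "r i")
            then have "ev x (r i) = x * ev x s" using True by simp
            moreover have "zo P (x * ev x s * w i) (P x + 0 + int l)"
              by (intro zo_mult[OF P] wi xP zo_ev[OF P])
            ultimately show ?thesis
              unfolding main(2) using PT zo_mono[OF P, of "ev x (r i) * w i" "P x + 0 + int l" "int j + 1"] by simp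
          qed
        qed
      qed
      have "(\<Sum>i\<in>I. ev x (r i) * w i) \<noteq> 0"
        by (rule val_sum_dominant(1)[of P I "(P, j)" "\<lambda>i. ev x (r i) * w i"])
          (simp_all only: P I j(1) main(1) dominated not_False_eq_True)
      then show False using rel' by simp
    qed
  qed
  moreover have "int (card I) = (\<Sum>P\<in>T. P x)"
    using T pos by (simp add: I_def less_imp_le)
  ultimately show ?thesis by simp
qed

end

text \<open>
  Shifting \<open>x\<close> by a constant changes neither its pole nor its regularity.
\<close>
lemma zeros_le:
  assumes infty: "infty \<in> points" and x: "regular_away infty x" "infty x = - int d" and d: "d > 0"
    and T: "finite T" "T \<subseteq> points" and pos: "\<And>P. P \<in> T \<Longrightarrow> P (x - emb c) > 0"
  shows "(\<Sum>P\<in>T. P (x - emb c)) \<le> int d"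
  by (rule zeros_of_x_le[OF infty _ _ d T]) (simp_all add: x_minus_const[OF infty x d] pos)

section \<open>The genus counts the gaps at a point\<close>

lemma ell_eq_dim: "ell A = vs.dim (riemann_roch_space A)"
  by (simp add: ell_def)

lemma regular_away_pole:
  assumes "infty \<in> points" "regular_away infty f" "f \<noteq> 0"
  shows "infty f \<le> 0"
proof (rule ccontr)
  assume "\<not> infty f \<le> 0"
  then have "zo infty f 1" by (simp add: zero_of_order_at_least_def)
  moreover from this have "zo Q f 0" if "Q \<in> points" for Q
    using assms that by (cases "Q = infty") (auto simp: regular_away_iff zero_of_order_at_least_def)
  ultimately show False using zo_all_positive_imp_0[OF assms(1)] assms(3) by blast
qed

lemma degree_div_eq:
  assumes "finite F" "\<And>P. A P \<noteq> 0 \<Longrightarrow> P \<in> F"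
  shows "degree_div A = (\<Sum>P\<in>F. A P)"
  unfolding degree_div_def using assms by (intro sum.mono_neutral_left) auto

lemma ell_scale:
  assumes z: "z \<noteq> 0" and V: "W = (\<lambda>f. z * f) ` V"
  shows "vs.dim W = vs.dim V"
proof -
  interpret scale: Vector_Spaces.linear "\<lambda>c f. emb c * f" "\<lambda>c f. emb c * f" "\<lambda>f. z * f"
    by unfold_locales (auto simp: algebra_simps)
  obtain B where B: "B \<subseteq> V" "vs.independent B" "V \<subseteq> vs.span B" "card B = vs.dim V"
    by (rule vs.basis_exists)
  have inj: "inj (\<lambda>f. z * f)" using z by (auto simp: inj_def)
  show ?thesis
  proof (rule vs.dim_unique)
    show "(\<lambda>f. z * f) ` B \<subseteq> W" using B(1) V by blast
    show "W \<subseteq> vs.span ((\<lambda>f. z * f) ` B)" unfolding V scale.span_image using B(3) by blast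
    show "vs.independent ((\<lambda>f. z * f) ` B)"
      using B(2) inj by (intro scale.independent_injective_image) (auto simp: inj_on_def)
    show "card ((\<lambda>f. z * f) ` B) = vs.dim V"
      using B(4) inj by (subst card_image) (auto simp: inj_on_def)
  qed
qed

lemma ell_add_point_le:
  assumes P: "P \<in> points" and S: "finite S" "riemann_roch_space A \<subseteq> vs.span S"
  shows "ell (\<lambda>Q. A Q + point_div P Q) \<le> ell A + 1"
proof -
  obtain B where B: "B \<subseteq> riemann_roch_space A" "vs.independent B" "riemann_roch_space A \<subseteq> vs.span B"
    "card B = vs.dim (riemann_roch_space A)" by (rule vs.basis_exists)
  have "finite B" using vs.independent_span_bound[OF S(1) B(2)] B(1) S(2) by blast
  then obtain S' where S': "finite S'" "card S' \<le> card B + 1"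
    "riemann_roch_space (\<lambda>Q. A Q + point_div P Q) \<subseteq> vs.span S'"
    using riemann_roch_space_add_point[OF P _ B(3)] by blast
  then show ?thesis using vs.dim_le_card[OF S'(3,1)] B(4) by (simp add: ell_eq_dim)
qed

text \<open>
  Raising a divisor to \<open>M[infty]\<close> one point at a time; each point adds at most one dimension.
\<close>
lemma ell_le_sum:
  assumes infty: "infty \<in> points" and F: "finite F" "F \<subseteq> points" "infty \<in> F"
    and A: "\<And>P. A P \<noteq> 0 \<Longrightarrow> P \<in> F" "\<And>P. A P \<le> int M * point_div infty P"
  shows "int (ell (\<lambda>P. int M * point_div infty P)) \<le> int (ell A) + (\<Sum>P\<in>F. int M * point_div infty P - A P)"
  using A
proof (induction "nat (\<Sum>P\<in>F. int M * point_div infty P - A P)" arbitrary: A)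
  case 0
  have nonneg: "\<forall>P\<in>F. 0 \<le> int M * point_div infty P - A P" using 0 by auto
  then have "(\<Sum>P\<in>F. int M * point_div infty P - A P) = 0"
    using 0 sum_nonneg[of F "\<lambda>P. int M * point_div infty P - A P"] by auto
  then have "A P = int M * point_div infty P" if "P \<in> F" for P
    using sum_nonneg_eq_0_iff[OF F(1), of "\<lambda>P. int M * point_div infty P - A P"] nonneg that by auto
  then have "A = (\<lambda>P. int M * point_div infty P)"
    using 0(2) F(3) by (intro ext) (fastforce simp: point_div_def)
  then show ?case using \<open>_ = 0\<close> by simp
next
  case (Suc n)
  have "(\<Sum>P\<in>F. int M * point_div infty P - A P) \<noteq> 0" using Suc(2) by auto
  then obtain P where P: "P \<in> F" "int M * point_div infty P - A P \<noteq> 0" by (meson sum.neutral)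
  then have lt: "A P < int M * point_div infty P" using Suc.prems(2)[of P] by linarith
  define A' where "A' Q = A Q + point_div P Q" for Q
  have sum_A': "(\<Sum>Q\<in>F. int M * point_div infty Q - A' Q) = (\<Sum>Q\<in>F. int M * point_div infty Q - A Q) - 1"
  proof -
    have "(\<Sum>Q\<in>F. point_div P Q) = 1" using P(1) F(1) by (simp add: point_div_def)
    then show ?thesis by (simp add: A'_def sum_subtractf sum.distrib)
  qed
  have "n = nat (\<Sum>Q\<in>F. int M * point_div infty Q - A' Q)" using Suc(2) sum_A' by linarith
  moreover have "Q \<in> F" if "A' Q \<noteq> 0" for Q
    using that Suc.prems(1)[of Q] P(1) by (auto simp: A'_def point_div_def split: if_splits)
  moreover have "A' Q \<le> int M * point_div infty Q" for Q
    using Suc.prems(2)[of Q] lt by (auto simp: A'_def point_div_def[of P])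
  ultimately have IH: "int (ell (\<lambda>P. int M * point_div infty P))
      \<le> int (ell A') + (\<Sum>Q\<in>F. int M * point_div infty Q - A' Q)"
    by (rule Suc.hyps(1))
  obtain S where S: "finite S" "riemann_roch_space (\<lambda>Q. int M * point_div infty Q) \<subseteq> vs.span S"
    using pole_space_span[OF infty] by blast
  have "riemann_roch_space A \<subseteq> riemann_roch_space (\<lambda>Q. int M * point_div infty Q)"
  proof
    fix f assume f: "f \<in> riemann_roch_space A"
    have "zo Q f (- (int M * point_div infty Q))" if "Q \<in> points" for Q
      using f that Suc.prems(2)[of Q] zo_mono[OF that, of f "- A Q"] by (auto simp: riemann_roch_space_iff)
    then show "f \<in> riemann_roch_space (\<lambda>Q. int M * point_div infty Q)" by (simp add: riemann_roch_space_iff)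
  qed
  then have "ell A' \<le> ell A + 1"
    unfolding A'_def using P(1) F(2) S by (intro ell_add_point_le[of P S]) auto
  then show ?case using IH sum_A' by linarith
qed

context
  fixes infty :: "'f place" and x :: 'f and d :: nat
  assumes infty: "infty \<in> points"
    and x: "regular_away infty x" "infty x = - int d" and d: "d > 0"
begin

lemma pole_orders_add:
  assumes "a \<in> pole_orders infty" "b \<in> pole_orders infty"
  shows "a + b \<in> pole_orders infty"
proof -
  obtain f where f: "regular_away infty f" "f \<noteq> 0" "infty f = - int a"
    using assms(1) by (auto simp: pole_orders_def has_pole_order_def)
  obtain h where h: "regular_away infty h" "h \<noteq> 0" "infty h = - int b"
    using assms(2) by (auto simp: pole_orders_def has_pole_order_def)
  have "regular_away infty (f * h)" using f h by (auto simp: regular_away_iff zo_mult_0)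
  then show ?thesis
    using f h unfolding pole_orders_def has_pole_order_def
    by (intro CollectI exI[of _ "f * h"]) (auto simp: val_mult[OF infty])
qed

lemma pole_orders_d: "d \<in> pole_orders infty"
  using x d val_0[OF infty] by (auto simp: pole_orders_def has_pole_order_def intro!: exI[of _ x])

lemma pole_orders_add_mult: "a \<in> pole_orders infty \<Longrightarrow> a + d * k \<in> pole_orders infty"
proof (induction k)
  case (Suc k)
  then show ?case using pole_orders_add[OF _ pole_orders_d, of "a + d * k"] by (simp add: algebra_simps)
qed simp

text \<open>
  Start from any function of order \<open>-c\<close> at \<open>infty\<close> and remove its other poles by a polynomial in \<open>x\<close>,
  whose pole order is a multiple of \<open>d\<close>.
\<close>
lemma pole_orders_residues: "\<exists>m. c + d * m \<in> pole_orders infty"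
proof -
  obtain t where t: "t \<noteq> 0" "infty t = 1" using uniformizer_exists[OF infty] by blast
  define b where "b = inverse t ^ c"
  have b: "b \<noteq> 0" "infty b = - int c" using t by (auto simp: b_def val_power[OF infty] val_inverse[OF infty])
  obtain a where a: "a \<noteq> 0" "regular_away infty (ev x a * b)"
    using denominator_exists[OF infty x d] by blast
  have nz: "ev x a \<noteq> 0" using ev_x_nonzero[OF infty x d a(1)] .
  have "infty (ev x a * b) = - int (c + d * degree a)"
    using b nz val_ev_x[OF infty x d a(1)] by (simp add: val_mult[OF infty])
  then have "c + d * degree a \<in> pole_orders infty"
    unfolding pole_orders_def has_pole_order_def using a(2) nz b(1)
    by (intro CollectI exI[of _ "ev x a * b"]) simp
  then show ?thesis by blast
qed

lemma finite_gaps: "finite (- pole_orders infty)"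
proof -
  have "\<forall>c. \<exists>m. c + d * m \<in> pole_orders infty" using pole_orders_residues by blast
  then obtain m where m: "\<And>c. c + d * m c \<in> pole_orders infty" by metis
  \<comment> \<open>\<open>c + d * m c\<close> is a pole order in the residue class of \<open>c\<close>, and all larger members of the class follow\<close>
  have "- pole_orders infty \<subseteq> {..(\<Sum>c<d. c + d * m c)}"
  proof
    fix n assume n: "n \<in> - pole_orders infty"
    define c where "c = n mod d"
    have c: "c < d" using d by (simp add: c_def)
    have "n \<le> c + d * m c"
    proof (rule ccontr)
      assume "\<not> n \<le> c + d * m c"
      moreover have nc: "n = c + d * (n div d)" by (simp add: c_def)
      ultimately have "d * m c < d * (n div d)" by linarith
      then have "m c \<le> n div d" by simp
      then have "n = (c + d * m c) + d * (n div d - m c)"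
        using nc by (simp add: diff_mult_distrib2)
      then have "n \<in> pole_orders infty" using pole_orders_add_mult[OF m] by metis
      then show False using n by simp
    qed
    also have "\<dots> \<le> (\<Sum>c<d. c + d * m c)" using c by (intro member_le_sum[of c]) auto
    finally show "n \<in> {..(\<Sum>c<d. c + d * m c)}" by simp
  qed
  then show ?thesis by (rule finite_subset) simp
qed

lemma infinite_pole_orders: "infinite (pole_orders infty)"
  using finite_gaps by (metis finite_compl infinite_UNIV_nat)

text \<open>
  For \<open>a \<le> n\<close> one of \<open>a\<close> and \<open>n - a\<close> is a gap, since \<open>n\<close> is one.
\<close>
lemma gap_le:
  assumes F: "n \<notin> pole_orders infty"
  shows "n + 1 \<le> 2 * card (- pole_orders infty)"
proof -
  define A where "A = {a. a \<le> n \<and> a \<notin> pole_orders infty}"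
  have A: "finite A" "card A \<le> card (- pole_orders infty)"
    using finite_gaps by (auto simp: A_def intro!: card_mono)
  \<comment> \<open>\<open>a\<close> and \<open>n - a\<close> cannot both be pole orders\<close>
  have "{..n} \<subseteq> A \<union> (\<lambda>a. n - a) ` A"
  proof
    fix a assume a: "a \<in> {..n}"
    show "a \<in> A \<union> (\<lambda>a. n - a) ` A"
    proof (cases "a \<in> pole_orders infty")
      case True
      then have "n - a \<notin> pole_orders infty" using pole_orders_add[of a "n - a"] a F by auto
      then have "n - a \<in> A" "a = n - (n - a)" using a by (auto simp: A_def)
      then show ?thesis by blast
    qed (use a in \<open>auto simp: A_def\<close>)
  qed
  then have "card {..n} \<le> card (A \<union> (\<lambda>a. n - a) ` A)" using A by (intro card_mono) auto
  also have "\<dots> \<le> card A + card A"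
    using A card_Un_le[of A "(\<lambda>a. n - a) ` A"] card_image_le[of A "\<lambda>a. n - a"] by linarith
  finally show ?thesis using A by simp
qed

text \<open>
  Subtracting a multiple of \<open>h s\<close> lowers the pole order.  The bound is phrased with \<open>s < k\<close> so that the
  induction can start at \<open>k = 0\<close>, where \<open>f\<close> vanishes at \<open>infty\<close> and is therefore zero.
\<close>
lemma pole_basis_span:
  assumes h: "\<And>s. s \<in> pole_orders infty \<Longrightarrow> s < k \<Longrightarrow> regular_away infty (h s) \<and> has_pole_order infty (h s) s"
    and f: "regular_away infty f" "zo infty f (1 - int k)"
  shows "\<exists>c. f = (\<Sum>s | s \<in> pole_orders infty \<and> s < k. emb (c s) * h s)"
  using assms
proof (induction k arbitrary: f)
  case 0
  then have "f = 0"
    using regular_away_pole[OF infty, of f] by (cases "f = 0") (auto simp: zero_of_order_at_least_def)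
  then show ?case by simp
next
  case (Suc k)
  note h = Suc.prems(1)
  define S where "S k = {s. s \<in> pole_orders infty \<and> s < k}" for k
  have finS: "finite (S k)" for k by (simp add: S_def)
  show ?case
  proof (cases "zo infty f (1 - int k)")
    case True
    then obtain c where c: "f = (\<Sum>s\<in>S k. emb (c s) * h s)"
      using Suc.IH[of f] h Suc.prems(2) by (auto simp: S_def)
    also have "\<dots> = (\<Sum>s\<in>S (Suc k). emb (if s < k then c s else 0) * h s)"
      using finS by (intro sum.mono_neutral_cong_left) (auto simp: S_def)
    finally show ?thesis unfolding S_def by (intro exI[of _ "\<lambda>s. if s < k then c s else 0"])
  next
    case False
    then have f: "f \<noteq> 0" "infty f = - int k"
      using Suc.prems(3) by (auto simp: zero_of_order_at_least_def)
    then have kS: "k \<in> pole_orders infty"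
      using Suc.prems(2) by (auto simp: pole_orders_def has_pole_order_def)
    then have hk: "regular_away infty (h k)" "h k \<noteq> 0" "infty (h k) = - int k"
      using h[of k] by (auto simp: has_pole_order_def)
    have "zo infty (f / h k) 0" using f hk by (simp add: zero_of_order_at_least_def val_divide[OF infty])
    then obtain e where e: "zo infty (f / h k - emb e) 1" using residue_exists[OF infty] by blast
    have "zo infty ((f / h k - emb e) * h k) (1 + - int k)"
      using hk by (intro zo_mult[OF infty] e) (simp add: zero_of_order_at_least_def)
    moreover have "(f / h k - emb e) * h k = f - emb e * h k" using hk by (simp add: left_diff_distrib)
    ultimately have "zo infty (f - emb e * h k) (1 - int k)" by simp
    moreover have "regular_away infty (f - emb e * h k)"
      using Suc.prems(2) hk(1) by (auto simp: regular_away_iff intro!: zo_diff zo_mult_0 zo_emb)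
    ultimately obtain c where c: "f - emb e * h k = (\<Sum>s\<in>S k. emb (c s) * h s)"
      using Suc.IH[of "f - emb e * h k"] h by (auto simp: S_def)
    have Sk: "S (Suc k) = insert k (S k)" using kS by (auto simp: S_def)
    have "f = emb e * h k + (\<Sum>s\<in>S k. emb (c s) * h s)" using c by (simp add: algebra_simps)
    also have "\<dots> = (\<Sum>s\<in>S (Suc k). emb ((c(k := e)) s) * h s)"
      unfolding Sk using finS by (subst sum.insert) (auto simp: S_def intro!: sum.cong)
    finally show ?thesis unfolding S_def by (intro exI[of _ "c(k := e)"])
  qed
qed

text \<open>
  One function for each pole order up to \<open>M\<close> gives a basis: the values at \<open>infty\<close> are distinct.
\<close>
lemma ell_pole_space:
  "ell (\<lambda>P. int M * point_div infty P) = card (pole_orders infty \<inter> {..M})"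
proof -
  have "\<exists>f. regular_away infty f \<and> has_pole_order infty f s" if "s \<in> pole_orders infty" for s
    using that by (auto simp: pole_orders_def)
  then obtain h where h: "\<And>s. s \<in> pole_orders infty \<Longrightarrow> regular_away infty (h s) \<and> has_pole_order infty (h s) s"
    by metis
  define S where "S = pole_orders infty \<inter> {..M}"
  have finS: "finite S" by (simp add: S_def)
  have hS: "h s \<noteq> 0" "infty (h s) = - int s" if "s \<in> S" for s
    using h[of s] that by (auto simp: S_def has_pole_order_def)
  have inj: "inj_on h S" using hS by (metis inj_onI neg_equal_iff_equal of_nat_eq_iff)
  have S_eq: "{s. s \<in> pole_orders infty \<and> s < M + 1} = S" by (auto simp: S_def)
  have "vs.dim (riemann_roch_space (\<lambda>P. int M * point_div infty P)) = card S"
  proof (rule vs.dim_unique)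
    show "h ` S \<subseteq> riemann_roch_space (\<lambda>P. int M * point_div infty P)"
      using h by (auto simp: pole_space_iff[OF infty] S_def has_pole_order_def zero_of_order_at_least_def)
    show "riemann_roch_space (\<lambda>P. int M * point_div infty P) \<subseteq> vs.span (h ` S)"
    proof
      fix f assume "f \<in> riemann_roch_space (\<lambda>P. int M * point_div infty P)"
      then have "regular_away infty f" "zo infty f (1 - int (M + 1))" by (auto simp: pole_space_iff[OF infty])
      then obtain c where "f = (\<Sum>s\<in>S. emb (c s) * h s)"
        using pole_basis_span[of "M + 1" h f] h unfolding S_eq by blast
      moreover have "(\<Sum>s\<in>S. emb (c s) * h s) \<in> vs.span (h ` S)"
        by (intro vs.span_sum vs.span_scale vs.span_base) auto
      ultimately show "f \<in> vs.span (h ` S)" by simp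
    qed
    show "vs.independent (h ` S)"
    proof (rule ccontr)
      assume "\<not> vs.independent (h ` S)"
      then obtain u where u: "\<exists>v\<in>h ` S. u v \<noteq> 0" "(\<Sum>v\<in>h ` S. emb (u v) * v) = 0"
        using finS by (auto simp: vs.dependent_finite)
      then obtain s0 where s0: "s0 \<in> S" "emb (u (h s0)) * h s0 \<noteq> 0" using hS by auto
      have val: "infty (emb (u (h s)) * h s) = - int s" if "s \<in> S" "emb (u (h s)) * h s \<noteq> 0" for s
        using hS[OF that(1)] that by (auto simp: val_mult[OF infty] val_emb[OF infty])
      have "(\<Sum>s\<in>S. emb (u (h s)) * h s) \<noteq> 0 \<and>
          infty (\<Sum>s\<in>S. emb (u (h s)) * h s) \<le> infty (emb (u (h s0)) * h s0)"
        using infty finS _ s0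
      proof (rule distinct_vals_sum[where F = "\<lambda>s. emb (u (h s)) * h s"])
        fix i j assume ij: "i \<in> S" "j \<in> S" "emb (u (h i)) * h i \<noteq> 0" "emb (u (h j)) * h j \<noteq> 0" "i \<noteq> j"
        show "infty (emb (u (h i)) * h i) \<noteq> infty (emb (u (h j)) * h j)"
          unfolding val[OF ij(1,3)] val[OF ij(2,4)] using ij(5) by simp
      qed
      then show False using u(2) inj by (simp add: sum.reindex)
    qed
    show "card (h ` S) = card S" using inj by (rule card_image)
  qed
  then show ?thesis by (simp add: ell_eq_dim S_def)
qed

lemma ell_pole_space_gaps:
  "int M + 1 - int (ell (\<lambda>P. int M * point_div infty P)) = int (card ({..M} - pole_orders infty))"
proof -
  have "card {..M} = card (pole_orders infty \<inter> {..M}) + card ({..M} - pole_orders infty)"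
    by (metis Int_commute card_Int_Diff finite_atMost)
  then show ?thesis by (simp add: ell_pole_space)
qed

lemma finite_zeros: "finite {P \<in> points. P (x - emb c) > 0}"
proof (rule ccontr)
  assume "infinite {P \<in> points. P (x - emb c) > 0}"
  then obtain T where T: "T \<subseteq> {P \<in> points. P (x - emb c) > 0}" "finite T" "card T = d + 1"
    using infinite_arbitrarily_large by blast
  have "(\<Sum>P\<in>T. 1) \<le> (\<Sum>P\<in>T. P (x - emb c))" using T(1) by (intro sum_mono) force
  also have "\<dots> \<le> int d" using T by (intro zeros_le[OF infty x d]) auto
  finally show False using T(3) by simp
qed

lemma degree_x_minus_const_le:
  assumes F: "finite F" "F \<subseteq> points" "infty \<in> F"
  shows "(\<Sum>Q\<in>F. Q (x - emb c)) \<le> 0"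
proof -
  define T where "T = {Q \<in> F. Q (x - emb c) > 0}"
  have "(\<Sum>Q\<in>F. Q (x - emb c)) = infty (x - emb c) + (\<Sum>Q\<in>F - {infty}. Q (x - emb c))"
    using F by (subst sum.remove) auto
  also have "(\<Sum>Q\<in>F - {infty}. Q (x - emb c)) = (\<Sum>Q\<in>T. Q (x - emb c))"
  proof (rule sum.mono_neutral_right)
    show "T \<subseteq> F - {infty}" using x_minus_const(2)[OF infty x d, of c] d by (auto simp: T_def)
    show "\<forall>Q\<in>F - {infty} - T. Q (x - emb c) = 0"
    proof
      fix Q assume Q: "Q \<in> F - {infty} - T"
      then have "zo Q (x - emb c) 0" using x_minus_const(3)[OF infty x d, of c] F by (auto simp: regular_away_iff)
      then show "Q (x - emb c) = 0" using Q x_minus_const(1)[OF infty x d, of c] by (auto simp: T_def zero_of_order_at_least_def)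
    qed
  qed (use F in auto)
  also have "(\<Sum>Q\<in>T. Q (x - emb c)) \<le> int d"
    using F by (intro zeros_le[OF infty x d]) (auto simp: T_def)
  finally show ?thesis using x_minus_const(2)[OF infty x d, of c] by simp
qed

text \<open>
  The divisor \<open>A\<close> is replaced by the linearly equivalent \<open>A' = A - div z\<close>, where \<open>z\<close> is a polynomial in
  \<open>x\<close> that vanishes sufficiently at the points outside \<open>infty\<close> where \<open>A\<close> is positive.  Then \<open>A'\<close> is
  at most a multiple of \<open>infty\<close>, and the defect of a divisor can only grow when the divisor does.
\<close>
lemma riemann_inequality:
  assumes A: "is_divisor A"
  shows "degree_div A + 1 - int (ell A) \<le> int (card (- pole_orders infty))"
proof -
  define T where "T = {P. A P > 0} - {infty}"
  have finA: "finite {P. A P \<noteq> 0}" and Ap: "{P. A P \<noteq> 0} \<subseteq> points" using A by (auto simp: is_divisor_def)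
  have "T \<subseteq> {P. A P \<noteq> 0}" by (auto simp: T_def)
  then have T: "finite T" "T \<subseteq> points" using finA Ap by (auto intro: finite_subset)
  have "\<exists>c. P (x - emb c) > 0" if "P \<in> T" for P
  proof -
    have P: "P \<in> points" "P \<noteq> infty" using that T by (auto simp: T_def)
    then have "zo P x 0" using x by (auto simp: regular_away_iff)
    then obtain c where "zo P (x - emb c) 1" using residue_exists[OF P(1)] by blast
    then show ?thesis using x_minus_const(1)[OF infty x d, of c] by (intro exI[of _ c]) (auto simp: zero_of_order_at_least_def)
  qed
  then obtain c where c: "\<And>P. P \<in> T \<Longrightarrow> P (x - emb (c P)) > 0" by metis
  \<comment> \<open>\<open>T\<close> consists of zeros of \<open>z\<close>: at \<open>P\<close> the factor with index \<open>P\<close> has order at least \<open>A P\<close>\<close>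
  define z where "z = (\<Prod>P\<in>T. (x - emb (c P)) ^ nat (A P))"
  have z: "z \<noteq> 0" using x_minus_const(1)[OF infty x d] T by (auto simp: z_def)
  have val_z: "Q z = (\<Sum>P\<in>T. int (nat (A P)) * Q (x - emb (c P)))" if "Q \<in> points" for Q
    unfolding z_def using x_minus_const(1)[OF infty x d] by (simp add: val_prod[OF that] val_power[OF that])
  define F where "F = insert infty ({P. A P \<noteq> 0} \<union> (\<Union>P\<in>T. {Q \<in> points. Q (x - emb (c P)) > 0}))"
  have F: "finite F" "F \<subseteq> points" "infty \<in> F"
    using finA Ap infty T finite_zeros by (auto simp: F_def)
  have nonneg: "Q (x - emb e) \<ge> 0" if "Q \<in> points" "Q \<noteq> infty" for Q e
    using x_minus_const(1,3)[OF infty x d, of e] that by (auto simp: regular_away_iff zero_of_order_at_least_def)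
  have outside: "Q z = 0" if "Q \<in> points" "Q \<notin> F" for Q
  proof -
    have "Q (x - emb (c P)) = 0" if "P \<in> T" for P
      using nonneg[of Q "c P"] \<open>Q \<in> points\<close> \<open>Q \<notin> F\<close> that infty by (force simp: F_def)
    then show ?thesis by (simp add: val_z[OF \<open>Q \<in> points\<close>])
  qed
  define A' where "A' Q = A Q - (if Q \<in> points then Q z else 0)" for Q
  define M where "M = nat (A' infty)"
  have A'_F: "Q \<in> F" if "A' Q \<noteq> 0" for Q
    using that outside[of Q] by (auto simp: A'_def F_def split: if_splits)
  have A'_le: "A' Q \<le> int M * point_div infty Q" for Q
  proof (cases "Q \<in> points \<and> Q \<noteq> infty")
    case True
    then have Q: "Q \<in> points" "Q \<noteq> infty" by auto
    have z0: "0 \<le> Q z" unfolding val_z[OF Q(1)] using nonneg[OF Q] by (intro sum_nonneg) auto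
    have "A Q \<le> Q z"
    proof (cases "A Q > 0")
      case True
      then have QT: "Q \<in> T" using Q by (simp add: T_def)
      have "A Q * 1 \<le> A Q * Q (x - emb (c Q))" using c[OF QT] True by (intro mult_left_mono) auto
      also have "\<dots> = int (nat (A Q)) * Q (x - emb (c Q))" using True by simp
      also have "\<dots> \<le> Q z" unfolding val_z[OF Q(1)]
        using nonneg[OF Q] T(1) QT by (intro member_le_sum[of Q T "\<lambda>P. int (nat (A P)) * Q (x - emb (c P))"]) auto
      finally show ?thesis by simp
    qed (use z0 in simp)
    then show ?thesis using Q by (simp add: A'_def point_div_def)
  next
    case False
    have "A' Q \<le> 0" if "Q \<notin> points" using that subsetD[OF Ap, of Q] by (cases "A Q = 0") (auto simp: A'_def)
    then show ?thesis using False by (cases "Q = infty") (simp_all add: M_def point_div_def)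
  qed
  have deg: "degree_div A \<le> (\<Sum>Q\<in>F. A' Q)"
  proof -
    have "(\<Sum>Q\<in>F. Q z) = (\<Sum>Q\<in>F. \<Sum>P\<in>T. int (nat (A P)) * Q (x - emb (c P)))"
      using F(2) by (intro sum.cong val_z) auto
    also have "\<dots> = (\<Sum>P\<in>T. int (nat (A P)) * (\<Sum>Q\<in>F. Q (x - emb (c P))))"
      by (subst sum.swap) (simp add: sum_distrib_left)
    also have "\<dots> \<le> 0"
      by (rule sum_nonpos) (rule mult_nonneg_nonpos[OF _ degree_x_minus_const_le[OF F]], simp)
    finally have "(\<Sum>Q\<in>F. Q z) \<le> 0" .
    moreover have "(\<Sum>Q\<in>F. A' Q) = (\<Sum>Q\<in>F. A Q) - (\<Sum>Q\<in>F. Q z)"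
      unfolding sum_subtractf[symmetric] using F(2) by (intro sum.cong) (auto simp: A'_def)
    moreover have "degree_div A = (\<Sum>Q\<in>F. A Q)"
      using F(1) by (intro degree_div_eq) (auto simp: F_def)
    ultimately show ?thesis by simp
  qed
  have ell_A': "ell A' = ell A"
    unfolding ell_eq_dim
  proof (rule ell_scale[OF z])
    have mem: "f \<in> riemann_roch_space A \<longleftrightarrow> z * f \<in> riemann_roch_space A'" for f
      using z by (auto simp: riemann_roch_space_iff zero_of_order_at_least_def A'_def val_mult)
    show "riemann_roch_space A' = (\<lambda>f. z * f) ` riemann_roch_space A"
    proof (intro equalityI subsetI)
      fix f assume f: "f \<in> riemann_roch_space A'"
      then have "f / z \<in> riemann_roch_space A" using mem[of "f / z"] z by simp
      then show "f \<in> (\<lambda>f. z * f) ` riemann_roch_space A" using z by (intro image_eqI[of _ _ "f / z"]) auto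
    qed (use mem in auto)
  qed
  have "int (ell (\<lambda>P. int M * point_div infty P)) \<le> int (ell A') + (\<Sum>P\<in>F. int M * point_div infty P - A' P)"
    by (rule ell_le_sum[OF infty F A'_F A'_le])
  also have "(\<Sum>P\<in>F. int M * point_div infty P - A' P) = int M - (\<Sum>P\<in>F. A' P)"
  proof -
    have "(\<Sum>P\<in>F. point_div infty P) = 1" using F by (simp add: point_div_def)
    then show ?thesis by (simp add: sum_subtractf flip: sum_distrib_left)
  qed
  finally have "(\<Sum>P\<in>F. A' P) + 1 - int (ell A') \<le> int M + 1 - int (ell (\<lambda>P. int M * point_div infty P))" by simp
  also have "\<dots> \<le> int (card (- pole_orders infty))"
    unfolding ell_pole_space_gaps using finite_gaps by (auto intro!: card_mono)
  finally show ?thesis using deg ell_A' by simp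
qed

text \<open>
  The maximum in the definition of the genus is attained by any multiple of \<open>infty\<close> beyond the last
  gap.
\<close>
lemma genus_eq_card_gaps: "genus = card (- pole_orders infty)"
  unfolding genus_def
proof (rule Greatest_equality)
  obtain M where M: "\<And>n. n \<in> - pole_orders infty \<Longrightarrow> n \<le> M"
    using finite_gaps by (meson finite_nat_set_iff_bounded_le)
  have "{..M} - pole_orders infty = - pole_orders infty" using M by auto
  then have "int M + 1 - int (ell (\<lambda>P. int M * point_div infty P)) = int (card (- pole_orders infty))"
    by (simp add: ell_pole_space_gaps)
  moreover have "is_divisor (\<lambda>P. int M * point_div infty P)"
    using infty by (auto simp: is_divisor_def point_div_def)
  moreover have "degree_div (\<lambda>P. int M * point_div infty P) = int M"
    by (subst degree_div_eq[of "{infty}"]) (auto simp: point_div_def split: if_splits)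
  ultimately show "\<exists>A. is_divisor A \<and> int (card (- pole_orders infty)) = degree_div A + 1 - int (ell A)"
    by (intro exI[of _ "\<lambda>P. int M * point_div infty P"]) simp
next
  fix n assume "\<exists>A. is_divisor A \<and> int n = degree_div A + 1 - int (ell A)"
  then obtain A where "is_divisor A" "int n = degree_div A + 1 - int (ell A)" by blast
  then show "n \<le> card (- pole_orders infty)" using riemann_inequality[of A] by simp
qed

lemma ell_pole_space_large:
  assumes "int M \<ge> 2 * int genus - 1"
  shows "int (ell (\<lambda>P. int M * point_div infty P)) = int M + 1 - int genus"
proof -
  have "n \<le> M" if "n \<notin> pole_orders infty" for n
    using gap_le[OF that] assms by (simp add: genus_eq_card_gaps)
  then have "{..M} - pole_orders infty = - pole_orders infty" by auto
  then show ?thesis using ell_pole_space_gaps[of M] by (simp add: genus_eq_card_gaps)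
qed

end

section \<open>Hasse-Schmidt derivations at an unramified point\<close>

definition ev2 :: "'f \<Rightarrow> 'f \<Rightarrow> 'k poly poly \<Rightarrow> 'f" where
  "ev2 t h G = poly (map_poly (ev t) G) h"

lemma ev2_0 [simp]: "ev2 t h 0 = 0"
  by (simp add: ev2_def)

lemma ev2_pCons [simp]: "ev2 t h (pCons a G) = ev t a + h * ev2 t h G"
  by (simp add: ev2_def ev.map_poly_pCons_hom)

lemma ev2_add: "ev2 t h (F + G) = ev2 t h F + ev2 t h G"
  by (simp add: ev2_def ev.map_poly_hom_add)

lemma ev2_monom: "ev2 t h (monom a n) = ev t a * h ^ n"
  by (simp add: ev2_def poly_monom)

lemma ev2_smult: "ev2 t h (smult a F) = ev t a * ev2 t h F"
  by (simp add: ev2_def ev.map_poly_hom_smult)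

lemma ev2_sum: "ev2 t h (sum F I) = (\<Sum>i\<in>I. ev2 t h (F i))"
  by (induction I rule: infinite_finite_induct) (auto simp: ev2_add)

lemma ev2_eq_sum: "degree G \<le> n \<Longrightarrow> ev2 t h G = (\<Sum>i\<le>n. ev t (coeff G i) * h ^ i)"
  by (subst poly_as_sum_of_monoms'[symmetric]) (auto simp: ev2_sum ev2_monom)

lemma ev2_mult: "ev2 t h (F * G) = ev2 t h F * ev2 t h G"
proof -
  interpret m: map_poly_idom_hom "ev t" by unfold_locales
  show ?thesis by (simp add: ev2_def m.hom_mult)
qed

lemma ev2_pcompose: "ev2 t h (pcompose F G) = ev2 t (ev2 t h G) F"
  by (simp add: ev2_def ev.map_poly_pcompose poly_pcompose)

lemma CHAR_eq: "CHAR('f) = CHAR('k)"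
proof (rule CHAR_eqI)
  show "of_nat CHAR('k) = (0 :: 'f)"
    by (metis hom_of_nat hom_zero of_nat_CHAR)
  fix n assume "of_nat n = (0 :: 'f)"
  then have "emb (of_nat n) = 0" by (simp add: hom_of_nat)
  then show "CHAR('k) dvd n" by (simp add: of_nat_eq_0_iff_char_dvd)
qed

definition pth_root :: "'k \<Rightarrow> 'k" where
  "pth_root a = (SOME b. b ^ CHAR('k) = a)"

lemma pth_root: "CHAR('k) > 0 \<Longrightarrow> pth_root a ^ CHAR('k) = a"
  unfolding pth_root_def by (rule someI_ex) (rule nth_root_exists)

text \<open>
  In characteristic \<open>p > 0\<close> every polynomial over the perfect field \<open>k\<close> is \<open>\<Sum>i<p. X^i * q_i^p\<close>;
  \<open>root_part i q\<close> is \<open>q_i\<close>.  Summing up to \<open>degree q\<close> covers all coefficients; the superfluous ones are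
  zero.
\<close>
definition root_part :: "nat \<Rightarrow> 'k poly \<Rightarrow> 'k poly" where
  "root_part i q = (\<Sum>l\<le>degree q. monom (pth_root (coeff q (CHAR('k) * l + i))) l)"

lemma ev_root_part:
  assumes p: "CHAR('k) > 0"
  shows "ev t q = (\<Sum>i<CHAR('k). t ^ i * ev t (root_part i q) ^ CHAR('k))"
proof -
  let ?p = "CHAR('k)"
  have prime: "prime (CHAR('f))" using p CHAR_eq prime_CHAR_semidom[where 'a = 'f] by simp
  have pow: "ev t (root_part i q) ^ ?p = (\<Sum>l\<le>degree q. emb (coeff q (?p * l + i)) * t ^ (?p * l))" for i
  proof -
    have "ev t (root_part i q) ^ ?p = (\<Sum>l\<le>degree q. (emb (pth_root (coeff q (?p * l + i))) * t ^ l) ^ ?p)"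
      unfolding root_part_def ev.hom_sum ev_monom
      by (rule freshmans_dream_sum) (use prime CHAR_eq in auto)
    also have "\<dots> = (\<Sum>l\<le>degree q. emb (coeff q (?p * l + i)) * t ^ (?p * l))"
      by (intro sum.cong) (simp_all add: power_mult_distrib pth_root[OF p] mult.commute flip: hom_power power_mult)
    finally show ?thesis .
  qed
  define f where "f n = emb (coeff q n) * t ^ n" for n
  have "(\<Sum>i<?p. t ^ i * ev t (root_part i q) ^ ?p) = (\<Sum>i<?p. \<Sum>l\<le>degree q. f (l * ?p + i))"
    by (intro sum.cong) (simp_all add: pow f_def sum_distrib_left power_add mult_ac)
  also have "\<dots> = (\<Sum>l<degree q + 1. \<Sum>i<?p. f (l * ?p + i))"
    by (subst sum.swap) (simp add: lessThan_Suc_atMost)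
  also have "\<dots> = (\<Sum>l<degree q + 1. sum f {l * ?p..<l * ?p + ?p})"
  proof (rule sum.cong[OF refl])
    fix l
    show "(\<Sum>i<?p. f (l * ?p + i)) = sum f {l * ?p..<l * ?p + ?p}"
      by (rule sum.reindex_bij_witness[of _ "\<lambda>n. n - l * ?p" "\<lambda>i. l * ?p + i"]) auto
  qed
  also have "\<dots> = sum f {..<(degree q + 1) * ?p}"
    by (rule sum.nat_group)
  also have "\<dots> = sum f {..degree q}"
  proof (rule sum.mono_neutral_right)
    have "degree q + 1 \<le> (degree q + 1) * ?p"
      using mult_le_mono2[of 1 ?p "degree q + 1"] p by (simp only: mult_1_right)
    then show "{..degree q} \<subseteq> {..<(degree q + 1) * ?p}" by force
  qed (auto simp: f_def coeff_eq_0)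
  also have "\<dots> = ev t q" by (simp add: f_def ev_eq_sum[of q "degree q"])
  finally show ?thesis by simp
qed

context
  fixes P :: "'f place" and t :: 'f
  assumes P: "P \<in> points" and t: "P t = 1"
begin

lemma t_nonzero: "t \<noteq> 0"
  using t val_0[OF P] by auto

lemma ev_t_nonzero: "p \<noteq> 0 \<Longrightarrow> ev t p \<noteq> 0"
  using ev_nonzero_of_val[OF P] t by simp

lemma zo_t: "zo P t 1" "zo P t 0"
  using t by (simp_all add: zero_of_order_at_least_def)

text \<open>
  Take a relation of least degree in \<open>h\<close>.  If its derivative vanished on \<open>h\<close>, it would be zero by
  minimality, so the characteristic \<open>p\<close> would be positive and the relation a polynomial in \<open>h^p\<close>.  Writing its coefficients with
  \<open>ev_root_part\<close> turns it into \<open>\<Sum>i<p. t^i * H_i^p = 0\<close>.  The orders of the nonzero terms at a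
  point where \<open>t\<close> has order one are distinct modulo \<open>p\<close>, so all \<open>H_i\<close> vanish on \<open>h\<close>, and one of them is
  a relation of lower degree.
\<close>
lemma separable_relation: "\<exists>G. ev2 t h G = 0 \<and> ev2 t h (pderiv G) \<noteq> 0"
proof -
  define rel where "rel G \<longleftrightarrow> G \<noteq> 0 \<and> ev2 t h G = 0" for G
  obtain n p where p: "\<exists>j\<le>n. p j \<noteq> 0" "(\<Sum>j\<le>n. ev t (p j) * h ^ j) = 0"
    using algebraically_dependent[of t h] by auto
  have "rel (\<Sum>j\<le>n. monom (p j) j)"
  proof -
    have "coeff (\<Sum>j\<le>n. monom (p j) j) i = p i" if "i \<le> n" for i using that by (simp add: coeff_sum)
    then have "(\<Sum>j\<le>n. monom (p j) j) \<noteq> 0" using p(1) by auto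
    then show ?thesis using p(2) by (simp add: rel_def ev2_sum ev2_monom)
  qed
  then obtain G where G: "rel G" "\<And>F. rel F \<Longrightarrow> degree G \<le> degree F"
    using ex_has_least_nat[of rel _ degree] by blast
  have "ev2 t h (pderiv G) \<noteq> 0"
  proof
    assume der: "ev2 t h (pderiv G) = 0"
    have deg: "degree G > 0"
    proof (rule ccontr)
      assume "\<not> degree G > 0"
      then obtain q where "G = [:q:]" by (metis degree_0_id gr0I)
      then show False using G(1) ev_t_nonzero[of q] by (auto simp: rel_def)
    qed
    have "pderiv G = 0"
    proof (rule ccontr)
      assume "pderiv G \<noteq> 0"
      then have "degree G \<le> degree (pderiv G)" using der by (intro G(2)) (simp add: rel_def)
      moreover have "degree (pderiv G) \<le> degree G - 1" by (rule degree_pderiv_le)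
      ultimately show False using deg by simp
    qed
    then have dvd: "CHAR('k) dvd j" if "coeff G j \<noteq> 0" for j
    proof (cases j)
      case (Suc i)
      have "of_nat j * coeff G j = 0"
        using \<open>pderiv G = 0\<close> coeff_pderiv[of G i] Suc by simp
      then have "of_nat j = (0 :: 'k poly)" using that by simp
      then show ?thesis by (simp add: of_nat_eq_0_iff_char_dvd)
    qed simp
    have lead: "coeff G (degree G) \<noteq> 0" using G(1) by (simp add: rel_def)
    define p where "p = CHAR('k)"
    have "p dvd degree G" using dvd[OF lead] by (simp add: p_def)
    then obtain m where m: "degree G = p * m" by blast
    have p: "p > 0" "m > 0" using deg m by auto
    have "prime p" using p(1) prime_CHAR_semidom[where 'a = 'k] by (simp add: p_def)
    then have p2: "p \<ge> 2" by (rule prime_ge_2_nat)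
    have prime': "prime (CHAR('f))" using \<open>prime p\<close> by (simp add: CHAR_eq p_def)
    define H where "H i = (\<Sum>j\<le>m. monom (root_part i (coeff G (p * j))) j)" for i
    have degH: "degree (H i) < degree G" for i
    proof -
      have "degree (H i) \<le> m" unfolding H_def by (intro degree_sum_le) (auto intro: order_trans[OF degree_monom_le])
      also have "m < p * m" using p p2 by simp
      finally show ?thesis using m by simp
    qed
    have coeffH: "coeff (H i) j = root_part i (coeff G (p * j))" if "j \<le> m" for i j
      using that by (simp add: H_def coeff_sum)
    have "0 = ev2 t h G" using G(1) by (simp add: rel_def)
    also have "\<dots> = (\<Sum>j\<le>degree G. ev t (coeff G j) * h ^ j)" by (rule ev2_eq_sum) simp
    also have "\<dots> = (\<Sum>j\<in>(\<lambda>j. p * j) ` {..m}. ev t (coeff G j) * h ^ j)"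
    proof (rule sum.mono_neutral_right)
      show "(\<lambda>j. p * j) ` {..m} \<subseteq> {..degree G}" using m by auto
      show "\<forall>j\<in>{..degree G} - (\<lambda>j. p * j) ` {..m}. ev t (coeff G j) * h ^ j = 0"
      proof
        fix j assume j: "j \<in> {..degree G} - (\<lambda>j. p * j) ` {..m}"
        have "coeff G j = 0"
        proof (rule ccontr)
          assume "coeff G j \<noteq> 0"
          then obtain i where i: "j = p * i" using dvd unfolding p_def by (auto elim: dvdE)
          then have "i \<le> m" using j m p by auto
          then show False using i j by auto
        qed
        then show "ev t (coeff G j) * h ^ j = 0" by simp
      qed
    qed simp
    also have "\<dots> = (\<Sum>j\<le>m. ev t (coeff G (p * j)) * h ^ (p * j))"
      using p by (subst sum.reindex) (auto simp: inj_on_def)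
    also have "\<dots> = (\<Sum>j\<le>m. \<Sum>i<p. t ^ i * (ev t (root_part i (coeff G (p * j))) * h ^ j) ^ p)"
    proof (rule sum.cong[OF refl])
      fix j
      have "ev t (coeff G (p * j)) * h ^ (p * j)
          = (\<Sum>i<p. t ^ i * ev t (root_part i (coeff G (p * j))) ^ p) * h ^ (p * j)"
        using ev_root_part[of t "coeff G (p * j)"] p(1) by (simp only: p_def)
      also have "\<dots> = (\<Sum>i<p. t ^ i * (ev t (root_part i (coeff G (p * j))) * h ^ j) ^ p)"
        unfolding sum_distrib_right
        by (intro sum.cong) (simp_all add: power_mult_distrib mult_ac flip: power_mult)
      finally show "ev t (coeff G (p * j)) * h ^ (p * j)
          = (\<Sum>i<p. t ^ i * (ev t (root_part i (coeff G (p * j))) * h ^ j) ^ p)" .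
    qed
    also have "\<dots> = (\<Sum>i<p. \<Sum>j\<le>m. t ^ i * (ev t (root_part i (coeff G (p * j))) * h ^ j) ^ p)"
      by (rule sum.swap)
    also have "\<dots> = (\<Sum>i<p. t ^ i * ev2 t h (H i) ^ p)"
    proof (rule sum.cong[OF refl])
      fix i
      have "ev2 t h (H i) ^ p = (\<Sum>j\<le>m. (ev t (root_part i (coeff G (p * j))) * h ^ j) ^ p)"
        unfolding H_def ev2_sum ev2_monom
        by (rule freshmans_dream_sum[OF prime']) (simp add: CHAR_eq p_def)
      then show "(\<Sum>j\<le>m. t ^ i * (ev t (root_part i (coeff G (p * j))) * h ^ j) ^ p) = t ^ i * ev2 t h (H i) ^ p"
        by (simp add: sum_distrib_left)
    qed
    finally have sum0: "(\<Sum>i<p. t ^ i * ev2 t h (H i) ^ p) = 0" by simp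
    have all0: "ev2 t h (H i) = 0" if "i < p" for i
    proof (rule ccontr)
      assume ne: "ev2 t h (H i) \<noteq> 0"
      have val: "P (t ^ l * ev2 t h (H l) ^ p) = int l + int p * P (ev2 t h (H l))"
        if "ev2 t h (H l) \<noteq> 0" for l
        using that t t_nonzero by (simp add: val_mult[OF P] val_power[OF P])
      have "(\<Sum>i<p. t ^ i * ev2 t h (H i) ^ p) \<noteq> 0 \<and>
          P (\<Sum>i<p. t ^ i * ev2 t h (H i) ^ p) \<le> P (t ^ i * ev2 t h (H i) ^ p)"
      proof (rule distinct_vals_sum[OF P, where F = "\<lambda>i. t ^ i * ev2 t h (H i) ^ p"])
        fix a b assume ab: "a \<in> {..<p}" "b \<in> {..<p}" "t ^ a * ev2 t h (H a) ^ p \<noteq> 0"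
          "t ^ b * ev2 t h (H b) ^ p \<noteq> 0" "a \<noteq> b"
        then have nz: "ev2 t h (H a) \<noteq> 0" "ev2 t h (H b) \<noteq> 0" using p by auto
        show "P (t ^ a * ev2 t h (H a) ^ p) \<noteq> P (t ^ b * ev2 t h (H b) ^ p)"
        proof
          assume "P (t ^ a * ev2 t h (H a) ^ p) = P (t ^ b * ev2 t h (H b) ^ p)"
          then have "int a + int p * P (ev2 t h (H a)) = int b + int p * P (ev2 t h (H b))"
            by (simp only: val[OF nz(1)] val[OF nz(2)])
          then have "(int a + int p * P (ev2 t h (H a))) mod int p = (int b + int p * P (ev2 t h (H b))) mod int p"
            by simp
          then have "int a mod int p = int b mod int p" by simp
          then show False using ab by simp
        qed
      qed (use that ne t_nonzero in auto)
      then show False using sum0 by simp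
    qed
    have "ev t (coeff G (degree G)) \<noteq> 0" using ev_t_nonzero lead by blast
    have "\<exists>i<p. root_part i (coeff G (degree G)) \<noteq> 0"
    proof (rule ccontr)
      assume "\<not> ?thesis"
      then have "(\<Sum>i<p. t ^ i * ev t (root_part i (coeff G (degree G))) ^ p) = 0"
        using p(1) by (intro sum.neutral) auto
      then show False
        using ev_root_part[of t "coeff G (degree G)"] p(1) \<open>ev t (coeff G (degree G)) \<noteq> 0\<close>
        unfolding p_def by simp
    qed
    then obtain i where i: "i < p" "root_part i (coeff G (degree G)) \<noteq> 0" by blast
    have "H i \<noteq> 0" using coeffH[of m i] i(2) m by auto
    then have "rel (H i)" using all0[OF i(1)] by (simp add: rel_def)
    from G(2)[OF this] degH[of i] show False by simp
  qed
  then show ?thesis using G(1) by (auto simp: rel_def)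
qed

lemma ev_divisible_by_X:
  assumes "zo P (ev t a) 1"
  shows "\<exists>b. a = pCons 0 b"
proof (cases a)
  case (pCons c b)
  have "zo P (ev t a - (ev t a - emb (coeff a 0))) 1"
    by (rule zo_diff[OF P assms ev_const_coeff[OF P zo_t(1)]])
  then have "zo P (emb c) 1" by (simp add: pCons)
  then have "c = 0" by (auto simp: zero_of_order_at_least_def val_emb[OF P])
  then show ?thesis using pCons by blast
qed

lemma zo_ev2: "zo P h 0 \<Longrightarrow> zo P (ev2 t h G) 0"
  by (induction G) (auto intro!: zo_add[OF P] zo_mult_0[OF P] zo_ev[OF P] zo_t zo_0[OF P])

lemma zo_divide_t: "zo P (t * f) (n + 1) \<Longrightarrow> zo P f n"
  using t t_nonzero by (cases "f = 0") (auto simp: zero_of_order_at_least_def val_mult[OF P])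

text \<open>
  One step of the Taylor expansion \<open>h = c + t u\<close>.  In terms of \<open>w = h - c\<close> the relation is
  \<open>a_0 + a_1 w + e w^2 = 0\<close>; as the derivative vanishes at the point, \<open>t\<close> divides \<open>a_1\<close>, hence \<open>t^2\<close> divides
  \<open>a_0\<close>.  So after substituting \<open>w = t u\<close> the relation can be divided by \<open>t^2\<close>, whereas its
  derivative with respect to \<open>u\<close> has only gained one factor \<open>t\<close>.
\<close>
lemma relation_descent:
  assumes h: "zo P h 0" and G: "ev2 t h G = 0" "ev2 t h (pderiv G) \<noteq> 0" "P (ev2 t h (pderiv G)) > 0"
  shows "\<exists>c u H. h = emb c + t * u \<and> zo P u 0 \<and> ev2 t u H = 0 \<and> t * ev2 t u (pderiv H) = ev2 t h (pderiv G)"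
proof -
  obtain c where c: "zo P (h - emb c) 1" using residue_exists[OF P h] by blast
  define w where "w = h - emb c"
  define u where "u = w / t"
  have w: "w = t * u" using t_nonzero by (simp add: u_def)
  have h_eq: "h = emb c + t * u" using w by (simp add: w_def algebra_simps)
  have u0: "zo P u 0" using c zo_divide_t[of u 0] w by (simp add: w_def)
  have w1: "zo P w 1" "zo P w 0" using c zo_mono[OF P c, of 0] by (simp_all add: w_def)
  define K where "K = pcompose G [:[:c:], 1:]"
  have K: "ev2 t w K = ev2 t h G" by (simp add: K_def ev2_pcompose w_def)
  have K': "ev2 t w (pderiv K) = ev2 t h (pderiv G)"
    by (simp add: K_def pderiv_pcompose ev2_mult ev2_pcompose w_def pderiv_pCons)
  obtain a0 K1 where K1: "K = pCons a0 K1" by (cases K)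
  obtain a1 K2 where K2: "K1 = pCons a1 K2" by (cases K1)
  define e0 where "e0 = ev2 t w K2"
  define e1 where "e1 = ev2 t w (pderiv K2)"
  have e: "zo P e0 0" "zo P e1 0" using zo_ev2[OF w1(2)] by (auto simp: e0_def e1_def)
  have val: "ev2 t w K = ev t a0 + w * (ev t a1 + w * e0)" by (simp add: K1 K2 e0_def)
  have "ev2 t w K1 = ev t a1 + w * e0" by (simp add: K2 e0_def)
  moreover have "ev2 t w (pderiv K1) = e0 + w * e1" by (simp add: K2 e0_def e1_def pderiv_pCons ev2_add)
  ultimately have "ev2 t w (pderiv K) = (ev t a1 + w * e0) + w * (e0 + w * e1)"
    by (simp add: K1 pderiv_pCons ev2_add)
  then have der: "ev2 t w (pderiv K) = ev t a1 + w * (2 * e0 + w * e1)" by (simp add: algebra_simps)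
  have "zo P (ev2 t w (pderiv K)) 1" using G(3) by (simp add: K' zero_of_order_at_least_def)
  moreover have "zo P (w * (2 * e0 + w * e1)) (1 + 0)"
    using e w1 zo_of_nat[OF P, of 2] by (intro zo_mult[OF P] zo_add[OF P] zo_mult_0[OF P]) auto
  ultimately have "zo P (ev2 t w (pderiv K) - w * (2 * e0 + w * e1)) 1" by (intro zo_diff[OF P]) auto
  then have "zo P (ev t a1) 1" by (simp add: der)
  then obtain b1 where b1: "a1 = pCons 0 b1" using ev_divisible_by_X by blast
  have eq0: "ev t a0 + w * (t * ev t b1 + w * e0) = 0" using val K G(1) b1 by simp
  then have a0_eq: "ev t a0 = - (t * (t * (u * (ev t b1 + u * e0))))"
    unfolding w by (simp add: algebra_simps eq_neg_iff_add_eq_0)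
  have rest: "zo P (u * (ev t b1 + u * e0)) 0"
    by (intro zo_mult_0[OF P] zo_add[OF P] u0 e zo_ev[OF P] zo_t)
  have "zo P (ev t a0) (1 + (1 + 0))"
    unfolding a0_eq zo_uminus[OF P] by (intro zo_mult[OF P] zo_t rest)
  then have a02: "zo P (ev t a0) 2" by simp
  then obtain b where b: "a0 = pCons 0 b" using ev_divisible_by_X[of a0] zo_mono[OF P, of _ 2 1] by auto
  then have "zo P (ev t b) 1" using a02 zo_divide_t[of "ev t b" 1] by simp
  then obtain b0 where b0: "b = pCons 0 b0" using ev_divisible_by_X by blast
  define H1 where "H1 = pCons b1 (pcompose K2 [:0, [:0, 1:]:])"
  define H where "H = pCons b0 H1"
  have w': "u * t = w" by (simp add: w mult.commute)
  have H2: "ev2 t u (pcompose K2 [:0, [:0, 1:]:]) = e0"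
    by (simp add: ev2_pcompose e0_def w')
  have H2': "ev2 t u (pderiv (pcompose K2 [:0, [:0, 1:]:])) = t * e1"
    by (simp add: pderiv_pcompose ev2_smult ev2_pcompose e1_def w' pderiv_pCons)
  have H1: "ev2 t u H1 = ev t b1 + u * e0" "ev2 t u (pderiv H1) = e0 + u * (t * e1)"
    by (simp_all add: H1_def H2 H2' pderiv_pCons ev2_add)
  have "ev t a0 = t * (t * ev t b0)" by (simp add: b b0)
  then have "t * (t * ev2 t u H) = 0"
    using eq0 by (simp add: H_def H1 w algebra_simps)
  then have "ev2 t u H = 0" using t_nonzero by simp
  moreover have "t * ev2 t u (pderiv H) = ev2 t h (pderiv G)"
    unfolding K'[symmetric] der by (simp add: H_def pderiv_pCons ev2_add H1 b1 w algebra_simps)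
  ultimately show ?thesis using h_eq u0 by blast
qed

context
  fixes D :: "nat \<Rightarrow> 'f \<Rightarrow> 'f"
  assumes D: "hasse_schmidt_derivation D" and Dt: "\<And>n. zo P (D n t) (1 - int n)" "\<And>n. zo P (D n t) 0"
begin

lemma D_0: "D 0 f = f"
  and D_add: "D n (f + g) = D n f + D n g"
  and D_mult: "D n (f * g) = (\<Sum>i\<le>n. D i f * D (n - i) g)"
  and D_emb: "n > 0 \<Longrightarrow> D n (emb c) = 0"
  using D by (auto simp: hasse_schmidt_derivation_def)

lemma D_zero: "D n 0 = 0"
proof -
  have "D n (0 + 0) = D n 0 + D n 0" by (rule D_add)
  then have "D n 0 = D n 0 + D n 0" by (simp only: add_0_right)
  then show ?thesis by (metis add_cancel_right_right)
qed

definition D_regular :: "'f \<Rightarrow> bool" where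
  "D_regular f \<longleftrightarrow> (\<forall>n. zo P (D n f) 0)"

lemma D_regular_emb: "D_regular (emb c)"
  unfolding D_regular_def
proof
  fix n show "zo P (D n (emb c)) 0"
    by (cases "n = 0") (simp_all add: D_0 D_emb zo_emb[OF P] zo_0[OF P])
qed

lemma D_regular_t: "D_regular t"
  using Dt by (simp add: D_regular_def)

lemma D_regular_add: "D_regular f \<Longrightarrow> D_regular g \<Longrightarrow> D_regular (f + g)"
  by (auto simp: D_regular_def D_add intro: zo_add[OF P])

lemma D_regular_mult: "D_regular f \<Longrightarrow> D_regular g \<Longrightarrow> D_regular (f * g)"
  by (auto simp: D_regular_def D_mult intro!: zo_sum[OF P] zo_mult_0[OF P])

lemma D_regular_ev: "D_regular (ev t p)"
proof (induction p)
  case 0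
  show ?case using D_regular_emb[of 0] by simp
next
  case (pCons c p)
  then show ?case by (auto intro!: D_regular_add D_regular_mult D_regular_emb D_regular_t)
qed

text \<open>
  Modulo the local ring, and once the \<open>D i u\<close> with \<open>i < n\<close> are known to be regular, \<open>D n\<close> behaves like an
  ordinary derivation on polynomials in \<open>u\<close>: the value \<open>D n (F u)\<close> is \<open>F' u * D n u\<close> up to regular
  terms.  For a relation \<open>F = G\<close> the left side is zero and \<open>G' u\<close> is a unit.
\<close>
lemma D_regular_simple_root:
  assumes u: "zo P u 0" and G: "ev2 t u G = 0" "ev2 t u (pderiv G) \<noteq> 0" "P (ev2 t u (pderiv G)) = 0"
  shows "D_regular u"
  unfolding D_regular_def
proof
  fix n show "zo P (D n u) 0"
  proof (induction n rule: less_induct)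
    case (less n)
    show ?case
    proof (cases "n = 0")
      case True
      then show ?thesis using u by (simp add: D_0)
    next
      case False
      have "(\<forall>i<n. zo P (D i (ev2 t u F)) 0) \<and> zo P (D n (ev2 t u F) - ev2 t u (pderiv F) * D n u) 0" for F
      proof (induction F)
        case 0
        then show ?case by (simp add: D_zero zo_0[OF P])
      next
        case (pCons a F)
        define E where "E = ev2 t u F"
        define E' where "E' = ev2 t u (pderiv F)"
        have IH: "\<And>i. i < n \<Longrightarrow> zo P (D i E) 0" "zo P (D n E - E' * D n u) 0"
          using pCons by (auto simp: E_def E'_def)
        have a: "zo P (D i (ev t a)) 0" for i using D_regular_ev by (simp add: D_regular_def)
        have "zo P (D i (ev2 t u (pCons a F))) 0" if "i < n" for i
          using that a IH(1) less by (auto simp: D_add D_mult E_def[symmetric] intro!: zo_add[OF P] zo_sum[OF P] zo_mult_0[OF P])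
        moreover have "zo P (D n (ev2 t u (pCons a F)) - ev2 t u (pderiv (pCons a F)) * D n u) 0"
        proof -
          have "D n (u * E) = (\<Sum>i\<in>{..n} - {0} - {n}. D i u * D (n - i) E) + D n u * E + u * D n E"
            using False by (simp add: D_mult sum.remove[of "{..n}" 0] sum.remove[of "{..n} - {0}" n] D_0)
          then have "D n (ev2 t u (pCons a F)) - ev2 t u (pderiv (pCons a F)) * D n u
             = D n (ev t a) + (\<Sum>i\<in>{..n} - {0} - {n}. D i u * D (n - i) E) + u * (D n E - E' * D n u)"
            by (simp add: D_add pderiv_pCons ev2_add E_def[symmetric] E'_def[symmetric] algebra_simps)
          moreover have "zo P (\<Sum>i\<in>{..n} - {0} - {n}. D i u * D (n - i) E) 0"
            using less IH(1) by (intro zo_sum[OF P] zo_mult_0[OF P]) auto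
          ultimately show ?thesis using a IH(2) u by (auto intro!: zo_add[OF P] zo_mult_0[OF P])
        qed
        ultimately show ?case by blast
      qed
      then have "zo P (D n (ev2 t u G) - ev2 t u (pderiv G) * D n u) 0" by blast
      then have "zo P (ev2 t u (pderiv G) * D n u) 0" by (simp add: G(1) D_zero zo_uminus[OF P])
      then show ?thesis using G(2,3)
        by (cases "D n u = 0") (auto simp: zero_of_order_at_least_def val_mult[OF P])
    qed
  qed
qed

text \<open>
  \<open>relation_descent\<close> lowers the order of the derivative by one, so after finitely many steps the root is
  simple; \<open>h\<close> is then recovered from \<open>u\<close> by ring operations that preserve regularity.
\<close>
lemma D_regular_root:
  assumes "zo P h 0" "ev2 t h G = 0" "ev2 t h (pderiv G) \<noteq> 0"
  shows "D_regular h"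
  using assms
proof (induction "nat (P (ev2 t h (pderiv G)))" arbitrary: h G rule: less_induct)
  case less
  have ge: "P (ev2 t h (pderiv G)) \<ge> 0"
    using zo_ev2[OF less.prems(1), of "pderiv G"] less.prems(3) by (simp add: zero_of_order_at_least_def)
  show ?case
  proof (cases "P (ev2 t h (pderiv G)) = 0")
    case True
    then show ?thesis using D_regular_simple_root less.prems by blast
  next
    case False
    then have pos: "P (ev2 t h (pderiv G)) > 0" using ge by simp
    obtain c u H where H: "h = emb c + t * u" "zo P u 0" "ev2 t u H = 0"
      "t * ev2 t u (pderiv H) = ev2 t h (pderiv G)"
      using relation_descent[OF less.prems pos] by blast
    have nz: "ev2 t u (pderiv H) \<noteq> 0" using H(4) less.prems(3) by auto
    have "P (ev2 t h (pderiv G)) = 1 + P (ev2 t u (pderiv H))"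
      unfolding H(4)[symmetric] using nz t_nonzero t by (simp add: val_mult[OF P])
    then have "nat (P (ev2 t u (pderiv H))) < nat (P (ev2 t h (pderiv G)))" using pos by simp
    then have "D_regular u" using less.hyps H(2,3) nz by blast
    then show ?thesis unfolding H(1) by (intro D_regular_add D_regular_mult D_regular_emb D_regular_t)
  qed
qed

lemma D_regular_of_regular: "zo P h 0 \<Longrightarrow> zo P (D n h) 0"
  using separable_relation[of h] D_regular_root[of h] by (auto simp: D_regular_def)

lemma D_power_t: "zo P (D n (t ^ m)) (int m - int n)"
proof (induction m arbitrary: n)
  case 0
  have "zo P (D n (emb 1)) (0 - int n)"
    by (cases "n = 0") (simp_all add: D_0 D_emb zo_1[OF P] zo_0[OF P] del: hom_one, simp add: zo_1[OF P])
  then show ?case by simp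
next
  case (Suc m)
  have "zo P (D i t * D (n - i) (t ^ m)) (int (Suc m) - int n)" if "i \<le> n" for i
  proof -
    have "1 - int i + (int m - int (n - i)) = int (Suc m) - int n" using that by simp
    then show ?thesis using zo_mult[OF P Dt(1)[of i] Suc.IH[of "n - i"]] by (simp only:)
  qed
  then show ?case unfolding power_Suc D_mult by (intro zo_sum[OF P]) auto
qed

lemma D_lowers_order:
  assumes "zo P f (int m)"
  shows "zo P (D n f) (int m - int n)"
proof -
  define u where "u = f / t ^ m"
  have f: "f = t ^ m * u" using t_nonzero by (simp add: u_def)
  have "zo P u 0"
    using assms t t_nonzero
    by (cases "f = 0") (auto simp: u_def zero_of_order_at_least_def val_divide[OF P] val_power[OF P])
  then have u: "zo P (D i u) 0" for i by (rule D_regular_of_regular)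
  show ?thesis
    unfolding f D_mult
  proof (rule zo_sum[OF P])
    fix i assume i: "i \<in> {..n}"
    have "zo P (D i (t ^ m) * D (n - i) u) (int m - int i + 0)" by (intro zo_mult[OF P] D_power_t u)
    then show "zo P (D i (t ^ m) * D (n - i) u) (int m - int n)" by (rule zo_mono[OF P]) (use i in simp)
  qed
qed

end

end

section \<open>The determinant\<close>

lemma zo_prod:
  assumes P: "P \<in> points" and "finite I" "\<And>i. i \<in> I \<Longrightarrow> zo P (f i) (m i)"
  shows "zo P (prod f I) (sum m I)"
  using assms(2,3) by (induction I) (auto intro: zo_1[OF P] zo_mult[OF P])

text \<open>
  The power of the coset in the quotient group contains the multiple \<open>N([\<xi>] - [infty])\<close> of its
  representative, and it is the set of principal divisors.
\<close>
lemma torsion_function_exists: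
  assumes "\<xi> \<in> torsion_points infty N"
  shows "\<exists>f. f \<noteq> 0 \<and> (\<forall>P\<in>points. P f = int N * (point_div \<xi> P - point_div infty P))"
proof -
  define a where "a P = point_div \<xi> P - point_div infty P" for P
  let ?c = "embed_jacobian infty \<xi>"
  have one: "(\<lambda>P. 0) \<in> principal_divs"
    unfolding principal_divs_def
    by (intro CollectI exI[of _ 1]) (auto simp: principal_div_def val_1)
  have "?c = (\<lambda>h P. h P + a P) ` principal_divs"
    by (auto simp: embed_jacobian_def r_coset_def div0_group_def a_def)
  then have a: "a \<in> ?c" using one by (simp add: image_iff) (rule bexI[OF _ one], simp)
  have mult: "X \<otimes>\<^bsub>jacobian\<^esub> Y = {(\<lambda>P. A P + B P) | A B. A \<in> X \<and> B \<in> Y}" for X Y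
    by (auto simp: jacobian_def FactGroup_def set_mult_def div0_group_def)
  have "(\<lambda>P. int n * a P) \<in> ?c [^]\<^bsub>jacobian\<^esub> n" for n
  proof (induction n)
    case 0
    then show ?case using one by (simp add: jacobian_def FactGroup_def)
  next
    case (Suc n)
    have "(\<lambda>P. int n * a P + a P) \<in> ?c [^]\<^bsub>jacobian\<^esub> n \<otimes>\<^bsub>jacobian\<^esub> ?c"
      unfolding mult by (intro CollectI exI[of _ "\<lambda>P. int n * a P"] exI[of _ a] conjI refl Suc a)
    then show ?case by (simp add: algebra_simps)
  qed
  then have "(\<lambda>P. int N * a P) \<in> ?c [^]\<^bsub>jacobian\<^esub> N" .
  also have "?c [^]\<^bsub>jacobian\<^esub> N = principal_divs"
    using assms by (simp add: torsion_points_def jacobian_torsion_def) (simp add: jacobian_def FactGroup_def)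
  finally obtain f where f: "f \<noteq> 0" "(\<lambda>P. int N * a P) = principal_div f"
    by (auto simp: principal_divs_def)
  have "P f = int N * a P" if "P \<in> points" for P
    using fun_cong[OF f(2), of P] that by (simp add: principal_div_def)
  then show ?thesis using f(1) by (auto simp: a_def)
qed

text \<open>
  \<open>D 1 x = 1\<close>, while \<open>D 1\<close> is zero on constants.
\<close>
lemma nonconstant_of_hasse_derivation:
  assumes "hasse_derivation_wrt x D"
  shows "x \<noteq> emb c"
proof
  assume x: "x = emb c"
  have "D 1 (x powi 1) = of_int (int_binomial 1 1) * x powi (1 - int 1)"
    using assms unfolding hasse_derivation_wrt_def by blast
  then have "D 1 x = 1" by (simp add: int_binomial_def)
  moreover have "D 1 (emb c) = 0"
    using assms by (simp add: hasse_derivation_wrt_def hasse_schmidt_derivation_def)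
  ultimately show False using x by simp
qed

lemma hasse_derivation_coordinate:
  assumes D: "hasse_derivation_wrt x D" and n: "n > 0"
  shows "D n (x - emb c) = (if n = 1 then 1 else 0)"
proof -
  have hs: "hasse_schmidt_derivation D" using D by (simp add: hasse_derivation_wrt_def)
  have "D n (x - emb c + emb c) = D n (x - emb c) + D n (emb c)"
    using hs unfolding hasse_schmidt_derivation_def by blast
  moreover have "D n (emb c) = 0" using hs n by (simp add: hasse_schmidt_derivation_def)
  ultimately have eq: "D n (x - emb c) = D n x" by simp
  have Dx: "D n (x powi 1) = of_int (int_binomial 1 n) * x powi (1 - int n)"
    using D unfolding hasse_derivation_wrt_def by blast
  show ?thesis
  proof (cases "n = 1")
    case True
    then show ?thesis using Dx eq by (simp add: int_binomial_def)
  next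
    case False
    have "int_binomial 1 n = 0"
      unfolding int_binomial_def using False n by (subst prod_zero[of _ "\<lambda>i. 1 - int i"]) (auto intro!: bexI[of _ 1])
    then show ?thesis using Dx eq False by simp
  qed
qed

lemma unramified_coordinate:
  assumes P: "P \<in> points" and x: "zo P x 0" "\<And>c. x \<noteq> emb c" and unram: "P \<notin> ramified_points x"
  shows "\<exists>c. P (x - emb c) = 1"
proof -
  obtain c where c: "zo P (x - emb c) 1" using residue_exists[OF P x(1)] by blast
  have "value_at P x = c"
    unfolding value_at_def
  proof (rule the_equality)
    show "x = emb c \<or> 0 < P (x - emb c)" using c x(2) by (auto simp: zero_of_order_at_least_def)
    fix e assume "x = emb e \<or> 0 < P (x - emb e)"
    then have "zo P (x - emb e) 1" using x(2) by (auto simp: zero_of_order_at_least_def)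
    from zo_diff[OF P c this] have "zo P (emb (e - c)) 1" by (simp add: hom_minus)
    then show "e = c" by (auto simp: zero_of_order_at_least_def val_emb[OF P])
  qed
  moreover have "\<not> P x < 0" using x(1) val_0[OF P] by (auto simp: zero_of_order_at_least_def)
  ultimately have "P (x - emb c) \<le> 1" using unram P by (auto simp: ramified_points_def ramification_index_def)
  then show ?thesis using c x(2)[of c] by (intro exI[of _ c]) (auto simp: zero_of_order_at_least_def)
qed

text \<open>
  A permutation takes the entries of the rows in \<open>L\<close> from \<open>q + 1\<close> distinct columns, whose numbers sum
  to at most \<open>(n - 1) + (n - 2) + \<dots> + (n - 1 - q)\<close>.
\<close>
lemma det_order:
  assumes P: "P \<in> points" and W: "W \<in> carrier_mat n n" and L: "L \<subseteq> {..<n}" "card L = q + 1"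
    and other: "\<And>i j. i < n \<Longrightarrow> j < n \<Longrightarrow> i \<notin> L \<Longrightarrow> zo P (W $$ (i, j)) 0"
    and rows: "\<And>i j. i \<in> L \<Longrightarrow> j < n \<Longrightarrow> zo P (W $$ (i, j)) (a i - int j)"
  shows "zo P (det W) ((\<Sum>i\<in>L. a i) - int (q + 1) * (int n - 1) + (\<Sum>k\<le>q. int k))"
  unfolding det_def'[OF W]
proof (rule zo_sum[OF P])
  fix p assume "p \<in> {p. p permutes {0..<n}}"
  then have p: "p permutes {0..<n}" by simp
  have pn: "p i < n" if "i < n" for i using permutes_in_image[OF p, of i] that by simp
  have "zo P (\<Prod>i = 0..<n. W $$ (i, p i)) (\<Sum>i = 0..<n. if i \<in> L then a i - int (p i) else 0)"
    by (rule zo_prod[OF P]) (auto intro!: other rows pn)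
  also have "(\<Sum>i = 0..<n. if i \<in> L then a i - int (p i) else 0) = (\<Sum>i\<in>L. a i - int (p i))"
    using L(1) by (subst sum.inter_restrict[symmetric]) (auto intro!: sum.cong)
  also have "\<dots> = (\<Sum>i\<in>L. a i) - (\<Sum>i\<in>L. int (p i))" by (rule sum_subtractf)
  finally have "zo P (\<Prod>i = 0..<n. W $$ (i, p i)) ((\<Sum>i\<in>L. a i) - (\<Sum>i\<in>L. int (p i)))" .
  moreover have "(\<Sum>i\<in>L. int (p i)) \<le> int (q + 1) * (int n - 1) - (\<Sum>k\<le>q. int k)"
  proof -
    have inj: "inj_on p L" using permutes_inj[OF p] by (rule inj_on_subset) simp
    have "(\<Sum>i\<in>L. int (p i)) = (\<Sum>a\<in>p ` L. int a)" using inj by (simp add: sum.reindex)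
    also have "\<dots> \<le> int (q + 1) * (int n - 1) - (\<Sum>k\<le>q. int k)"
      using L pn inj by (intro sum_distinct_le) (auto simp: card_image)
    finally show ?thesis .
  qed
  ultimately have "zo P (\<Prod>i = 0..<n. W $$ (i, p i))
      ((\<Sum>i\<in>L. a i) - int (q + 1) * (int n - 1) + (\<Sum>k\<le>q. int k))"
    by (elim zo_mono[OF P]) simp
  moreover have "zo P (signof p) 0"
    using zo_emb[OF P, of "of_int (sign p)"] by (simp add: hom_of_int)
  ultimately show "zo P (signof p * (\<Prod>i = 0..<n. W $$ (i, p i)))
      ((\<Sum>i\<in>L. a i) - int (q + 1) * (int n - 1) + (\<Sum>k\<le>q. int k))"
    using zo_mult[OF P, of "signof p" 0] by fastforce
qed

text \<open>
  The two matrices differ by a triangular factor over \<open>k\<close>, because every \<open>D j\<close> is \<open>k\<close>-linear.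
\<close>
lemma det_triangular_change:
  assumes P: "P \<in> points" and hs: "hasse_schmidt_derivation D"
    and y': "\<And>i. i < n \<Longrightarrow> y' i = (\<Sum>m\<le>i. emb (C i m) * y m)" and C: "\<And>i. i < n \<Longrightarrow> C i i \<noteq> 0"
    and zo: "zo P (det (mat n n (\<lambda>(i, j). D j (y' i)))) k"
  shows "zo P (det (mat n n (\<lambda>(i, j). D j (y i)))) k"
proof -
  have D_scale: "D j (emb c * f) = emb c * D j f" for j c f
  proof -
    have "D j (emb c * f) = (\<Sum>i\<le>j. D i (emb c) * D (j - i) f)"
      using hs by (simp add: hasse_schmidt_derivation_def)
    also have "\<dots> = (\<Sum>i\<in>{0}. D i (emb c) * D (j - i) f)"
      using hs by (intro sum.mono_neutral_right) (auto simp: hasse_schmidt_derivation_def)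
    finally show ?thesis using hs by (simp add: hasse_schmidt_derivation_def)
  qed
  have D_add: "D j (f + g) = D j f + D j g" for j f g using hs by (simp add: hasse_schmidt_derivation_def)
  have D0: "D j 0 = 0" for j using D_scale[of j 0 0] by simp
  have D_sum: "D j (sum F I) = (\<Sum>i\<in>I. D j (F i))" for j F and I :: "nat set"
    by (induction I rule: infinite_finite_induct) (auto simp: D_add D0)
  define T where "T = mat n n (\<lambda>(i, j). if j \<le> i then emb (C i j) else 0)"
  define W where "W = mat n n (\<lambda>(i, j). D j (y i))"
  have TW: "T \<in> carrier_mat n n" "W \<in> carrier_mat n n" by (auto simp: T_def W_def)
  have "mat n n (\<lambda>(i, j). D j (y' i)) = T * W"
  proof (rule eq_matI)
    fix i j assume "i < dim_row (T * W)" "j < dim_col (T * W)"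
    then have ij: "i < n" "j < n" using TW by auto
    have "(T * W) $$ (i, j) = (\<Sum>m = 0..<n. T $$ (i, m) * W $$ (m, j))"
      using ij TW by (simp add: scalar_prod_def)
    also have "\<dots> = (\<Sum>m = 0..<n. (if m \<le> i then emb (C i m) else 0) * D j (y m))"
      using ij by (intro sum.cong) (auto simp: T_def W_def)
    also have "\<dots> = (\<Sum>m\<le>i. emb (C i m) * D j (y m))"
      using ij by (intro sum.mono_neutral_cong_right) auto
    also have "\<dots> = D j (y' i)" by (simp add: y'[OF ij(1)] D_sum D_scale)
    finally show "mat n n (\<lambda>(i, j). D j (y' i)) $$ (i, j) = (T * W) $$ (i, j)" using ij by simp
  qed (use TW in auto)
  then have det: "det (mat n n (\<lambda>(i, j). D j (y' i))) = det T * det W" using TW by (simp add: det_mult)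
  have "det T = prod_list (diag_mat T)"
    by (rule det_lower_triangular[OF _ TW(1)]) (simp add: T_def)
  also have "\<dots> = (\<Prod>i = 0..<n. emb (C i i))"
    unfolding prod_list_diag_prod using TW(1) by (intro prod.cong) (auto simp: T_def)
  also have "\<dots> = emb (\<Prod>i = 0..<n. C i i)" by (simp add: hom_prod)
  finally have T: "det T \<noteq> 0" "P (det T) = 0" using C by (auto simp: val_emb[OF P])
  show ?thesis
    using zo T unfolding det W_def[symmetric]
    by (cases "det W = 0") (auto simp: zero_of_order_at_least_def val_mult[OF P])
qed

lemma Delta_order:
  fixes g d N r :: nat
  assumes genus: "g = genus" "g \<ge> 2"
    and infty: "infty \<in> points"
    and x: "regular_away infty x" "has_pole_order infty x d"
    and D: "hasse_derivation_wrt x D"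
    and y: "\<And>n. n \<ge> 1 \<Longrightarrow> regular_away infty (y n) \<and> has_pole_order infty (y n) (pole_seq infty n)"
    and N: "int N \<ge> 2 * int g - 1"
    and \<xi>: "\<xi> \<in> torsion_points infty N" "\<xi> \<notin> ramified_points x"
  shows "zo \<xi> (Delta infty D y (N + r)) ((int g - int r + int (r div d)) * (int (r div d) + 1))"
proof -
  have hs: "hasse_schmidt_derivation D" using D by (simp add: hasse_derivation_wrt_def)
  have nonconst: "x \<noteq> emb c" for c using nonconstant_of_hasse_derivation[OF D] .
  have xv: "x \<noteq> 0" "infty x = - int d" using x(2) by (auto simp: has_pole_order_def)
  have d0: "d > 0"
  proof (rule ccontr)
    assume "\<not> d > 0"
    then have "infty x = 0" using xv by simp
    obtain Q where Q: "Q \<in> points" "Q x < 0" using pole_exists[OF nonconst] by blast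
    then have "Q \<noteq> infty" using \<open>infty x = 0\<close> by auto
    then have "zo Q x 0" using x(1) Q(1) by (simp add: regular_away_iff)
    then show False using Q(2) xv(1) by (simp add: zero_of_order_at_least_def)
  qed
  note xd = infty x(1) xv(2) d0
  define S where "S = pole_orders infty"
  have infS: "infinite S" unfolding S_def by (rule infinite_pole_orders[OF xd])
  have zeroS: "0 \<in> S"
    unfolding S_def pole_orders_def has_pole_order_def regular_away_iff
    using infty by (auto intro!: exI[of _ 1] simp: zo_1 val_1)
  \<comment> \<open>if \<open>x\<close> had a simple pole there would be no gaps and the genus would be zero\<close>
  have "d \<noteq> 1"
  proof
    assume "d = 1"
    then have "n \<in> S" for n using pole_orders_add_mult[OF xd, of 0 n] zeroS by (simp add: S_def)
    then have "- S = {}" by blast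
    then have "genus = 0" using genus_eq_card_gaps[OF xd] by (simp add: S_def)
    then show False using genus by simp
  qed
  have xi: "\<xi> \<in> points" using \<xi>(1) by (simp add: torsion_points_def)
  \<comment> \<open>hence \<open>infty\<close> is ramified and differs from \<open>\<xi>\<close>\<close>
  have "infty \<in> ramified_points x"
    using infty xv d0 \<open>d \<noteq> 1\<close> by (auto simp: ramified_points_def ramification_index_def val_inverse[OF infty])
  then have xi_infty: "\<xi> \<noteq> infty" using \<xi>(2) by auto
  then have reg: "zo \<xi> h 0" if "regular_away infty h" for h using that xi xi_infty by (simp add: regular_away_iff)
  obtain c where t1: "\<xi> (x - emb c) = 1"
    using unramified_coordinate[OF xi reg[OF x(1)] nonconst \<xi>(2)] by blast
  define t where "t = x - emb c"
  have t: "t \<noteq> 0" "\<xi> t = 1" "infty t = - int d" "regular_away infty t"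
    using t1 x_minus_const[OF xd, of c] by (auto simp: t_def)
  have Dt: "zo \<xi> (D n t) (1 - int n)" "zo \<xi> (D n t) 0" for n
  proof -
    have "D 0 t = t" using hs by (simp add: hasse_schmidt_derivation_def)
    then show "zo \<xi> (D n t) (1 - int n)" "zo \<xi> (D n t) 0"
      using t hasse_derivation_coordinate[OF D, of n c]
      by (cases "n = 0"; auto simp: zero_of_order_at_least_def val_1[OF xi] t_def)+
  qed
  obtain f where f: "f \<noteq> 0" "\<And>P. P \<in> points \<Longrightarrow> P f = int N * (point_div \<xi> P - point_div infty P)"
    using torsion_function_exists[OF \<xi>(1)] by blast
  have fv: "\<xi> f = int N" "infty f = - int N"
    using f(2)[OF xi] f(2)[OF infty] xi_infty by (simp_all add: point_div_def)
  have f_reg: "regular_away infty f"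
    unfolding regular_away_iff
  proof
    fix P assume "P \<in> points - {infty}"
    then have "P f = int N * point_div \<xi> P" using f(2)[of P] by (simp add: point_div_def)
    then show "zo P f 0" by (simp add: zero_of_order_at_least_def point_div_def)
  qed
  define M where "M = N + r"
  define n where "n = dim_bounded_pole infty M"
  have n_int: "int n = int N + int r + 1 - int g"
    unfolding n_def dim_bounded_pole_def using ell_pole_space_large[OF xd, of M] N genus by (simp add: M_def)
  have n_card: "n = card (S \<inter> {..M})"
    by (simp add: n_def dim_bounded_pole_def ell_pole_space[OF xd] S_def)
  define e where "e = enumerate S"
  have e_le: "e l \<le> M \<longleftrightarrow> l < n" for l unfolding e_def n_card by (rule enumerate_le_iff[OF infS])
  have e_mono: "e a < e b \<longleftrightarrow> a < b" for a b using infS by (simp add: e_def)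
  have e_inj: "e a = e b \<longleftrightarrow> a = b" for a b
    using e_mono[of a b] e_mono[of b a] by (cases a b rule: linorder_cases) auto
  have eS: "\<exists>l. e l = s" if "s \<in> S" for s unfolding e_def by (rule enumerate_Ex[OF infS that])
  define z where "z l = y (Suc l)" for l
  have z: "regular_away infty (z l)" "has_pole_order infty (z l) (e l)" for l
    using y[of "Suc l"] by (auto simp: z_def pole_seq_def e_def S_def)
  define q where "q = r div d"
  have F: "f * t ^ k \<noteq> 0" "infty (f * t ^ k) = - int (N + k * d)" "\<xi> (f * t ^ k) = int (N + k)"
      "regular_away infty (f * t ^ k)" for k
    using f(1) fv t regular_away_mult[OF xd f_reg regular_away_power[OF xd t(4), of k]]
    by (simp_all add: val_mult[OF infty] val_mult[OF xi] val_power[OF infty] val_power[OF xi])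
  have "N + k * d \<in> S" for k
    unfolding S_def pole_orders_def has_pole_order_def using F[of k] by blast
  then have "\<forall>k. \<exists>l. e l = N + k * d" using eS by blast
  then obtain row where row: "\<And>k. e (row k) = N + k * d" by metis
  have row_inj: "inj_on row {..q}" using row d0 by (intro inj_onI) (metis add_left_cancel mult_cancel2 less_numeral_extra(3))
  \<comment> \<open>\<open>row k\<close> is the position of \<open>N + k * d\<close> among the pole orders, and \<open>\<kappa>\<close> inverts \<open>row\<close>\<close>
  define L where "L = row ` {..q}"
  have L_n: "L \<subseteq> {..<n}"
  proof -
    have "e (row k) \<le> M" if "k \<le> q" for k
    proof -
      have "k * d \<le> q * d" using that by simp
      also have "\<dots> \<le> r" by (simp add: q_def)
      finally show ?thesis by (simp add: row M_def)
    qed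
    then show ?thesis by (auto simp: L_def e_le)
  qed
  have L_card: "card L = q + 1" using row_inj by (simp add: L_def card_image)
  define \<kappa> where "\<kappa> = the_inv_into {..q} row"
  have \<kappa>: "\<kappa> (row k) = k" if "k \<le> q" for k using the_inv_into_f_f[OF row_inj] that by (simp add: \<kappa>_def)
  \<comment> \<open>the new basis, with the same pole orders as the old one\<close>
  define y' where "y' l = (if l \<in> L then f * t ^ \<kappa> l else z l)" for l
  have y': "regular_away infty (y' l)" "y' l \<noteq> 0" "infty (y' l) = - int (e l)" for l
    using z[of l] F[of "\<kappa> l"] \<kappa> row by (auto simp: y'_def L_def has_pole_order_def)
  have "\<exists>C. y' l = (\<Sum>m\<le>l. emb (C m) * z m)" for l
  proof -
    define h where "h s = z (the_inv e s)" for s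
    have inv: "the_inv e (e m) = m" for m using e_inj by (intro the_inv_f_f) (auto simp: inj_def)
    have h: "regular_away infty (h s) \<and> has_pole_order infty (h s) s" if s: "s \<in> S" for s
    proof -
      obtain m where "s = e m" using eS[OF s] by blast
      then show ?thesis using z[of m] inv by (simp add: h_def)
    qed
    have "zo infty (y' l) (1 - int (e l + 1))" using y'(3)[of l] by (simp add: zero_of_order_at_least_def)
    then obtain C where C: "y' l = (\<Sum>s | s \<in> S \<and> s < e l + 1. emb (C s) * h s)"
      using pole_basis_span[OF xd, of "e l + 1" h "y' l"] h y'(1) unfolding S_def by blast
    have "{s. s \<in> S \<and> s < e l + 1} = e ` {..l}"
    proof (intro equalityI subsetI)
      fix s assume s: "s \<in> {s. s \<in> S \<and> s < e l + 1}"
      then obtain m where "s = e m" using eS by blast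
      then show "s \<in> e ` {..l}" using s e_mono[of l m] by (auto simp: not_less)
    next
      fix s assume "s \<in> e ` {..l}"
      then obtain m where m: "s = e m" "m \<le> l" by blast
      then have "e m \<le> e l" using e_mono[of l m] by (simp add: not_less[symmetric])
      then show "s \<in> {s. s \<in> S \<and> s < e l + 1}" using m enumerate_in_set[OF infS, of m] by (simp add: e_def)
    qed
    then have "y' l = (\<Sum>m\<le>l. emb (C (e m)) * z m)"
      unfolding C using e_inj by (simp add: sum.reindex inj_on_def h_def inv)
    then show ?thesis by (rule exI[of _ "\<lambda>m. C (e m)"])
  qed
  then obtain C where C: "\<And>l. y' l = (\<Sum>m\<le>l. emb (C l m) * z m)" by metis
  \<comment> \<open>only the last term of the combination has the pole order of \<open>y' l\<close>\<close>
  have C_diag: "C l l \<noteq> 0" for l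
  proof
    assume "C l l = 0"
    have "zo infty (\<Sum>m\<le>l. emb (C l m) * z m) (1 - int (e l))"
    proof (rule zo_sum[OF infty])
      fix m assume m: "m \<in> {..l}"
      show "zo infty (emb (C l m) * z m) (1 - int (e l))"
      proof (cases "m = l")
        case True
        then show ?thesis using \<open>C l l = 0\<close> by (simp add: zo_0[OF infty])
      next
        case False
        then have "e m < e l" using m by (simp add: e_mono)
        then have "zo infty (z m) (1 - int (e l))" using z(2)[of m] by (simp add: has_pole_order_def zero_of_order_at_least_def)
        from zo_mult[OF infty zo_emb[OF infty] this] show ?thesis by simp
      qed
    qed
    then show False using y'(2,3)[of l] unfolding C[symmetric] by (simp add: zero_of_order_at_least_def)
  qed
  define W where "W = mat n n (\<lambda>(i, j). D j (y' i))"
  have "zo \<xi> (det W) ((\<Sum>i\<in>L. int (N + \<kappa> i)) - int (q + 1) * (int n - 1) + (\<Sum>k\<le>q. int k))"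
  proof (rule det_order[OF xi _ L_n L_card])
    fix i j assume ij: "i < n" "j < n" "i \<notin> L"
    then show "zo \<xi> (W $$ (i, j)) 0"
      using D_regular_of_regular[OF xi t(2) hs Dt reg[OF y'(1)]] by (simp add: W_def)
  next
    fix i j assume ij: "i \<in> L" "j < n"
    then have "i < n" using L_n by auto
    have "zo \<xi> (f * t ^ \<kappa> i) (int (N + \<kappa> i))" using F[of "\<kappa> i"] by (simp add: zero_of_order_at_least_def)
    then have "zo \<xi> (D j (f * t ^ \<kappa> i)) (int (N + \<kappa> i) - int j)"
      by (rule D_lowers_order[OF xi t(2) hs Dt])
    then show "zo \<xi> (W $$ (i, j)) (int (N + \<kappa> i) - int j)"
      using ij \<open>i < n\<close> by (simp add: W_def y'_def)
  qed (simp add: W_def)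
  also have "(\<Sum>i\<in>L. int (N + \<kappa> i)) = int (q + 1) * int N + (\<Sum>k\<le>q. int k)"
    unfolding L_def using row_inj \<kappa> by (simp add: sum.reindex sum.distrib card_image)
  also have "int (q + 1) * int N + (\<Sum>k\<le>q. int k) - int (q + 1) * (int n - 1) + (\<Sum>k\<le>q. int k)
      = (int g - int r + int q) * (int q + 1)"
    using double_sum_int[of q] by (simp add: n_int algebra_simps)
  finally have "zo \<xi> (det W) ((int g - int r + int q) * (int q + 1))" .
  then have "zo \<xi> (det (mat n n (\<lambda>(i, j). D j (z i)))) ((int g - int r + int q) * (int q + 1))"
    unfolding W_def by (rule det_triangular_change[OF xi hs C C_diag])
  then show ?thesis by (simp add: Delta_def n_def M_def z_def q_def Let_def)
qed

end

theorem proposition1p5: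
  fixes emb :: "'k::alg_closed_field \<Rightarrow> 'f::field"
    and infty \<xi> :: "'f place"
    and x :: 'f
    and D :: "nat \<Rightarrow> 'f \<Rightarrow> 'f"
    and y :: "nat \<Rightarrow> 'f"
    and g d N r :: nat
  assumes curve: "function_field emb"
    and genus: "g = function_field.genus emb" "g \<ge> 2"
    and infty: "infty \<in> function_field.points emb"
    and d: "d = function_field.min_pole_order emb infty"
    and x: "function_field.regular_away emb infty x" "function_field.has_pole_order infty x d"
    and D: "function_field.hasse_derivation_wrt emb x D"
    and y: "\<And>n. n \<ge> 1 \<Longrightarrow> function_field.regular_away emb infty (y n) \<and>
              function_field.has_pole_order infty (y n) (function_field.pole_seq emb infty n)"
    and N: "N \<ge> 2" "int N \<ge> 2 * int g - 1"
    and r: "int g - int r + int (r div d) > 0"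
    and \<xi>: "\<xi> \<in> function_field.torsion_points emb infty N"
           "\<xi> \<notin> function_field.ramified_points emb x"
  shows "function_field.zero_of_order_at_least \<xi>
           (function_field.Delta emb infty D y (N + r))
           ((int g - int r + int (r div d)) * (int (r div d) + 1))"
  by (rule function_field.Delta_order[OF curve genus infty x D y N(2) \<xi>])

end
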